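(* Let $p\geq 1$, let $E$ and $F$ be Banach spaces, and suppose that $E$ is superreflexive. If $E$ contains a complemented infinite-dimensional subspace with unconditional basis or $F$ contains an infinite unconditional basic sequence, then $\mathcal{K}(E;F)\setminus\Pi_{p}(E;F)$ (hence $\mathcal{L}(E;F)\setminus\Pi_{p}(E;F)$) is $\aleph_{1}$-lineable.
   Context: $\mathcal{L}(E;F)$ is the space of bounded linear operators from $E$ to $F$, $\mathcal{K}(E;F)$ is the space of compact operators from $E$ to $F$, and $\Pi_{p}(E;F)$ is the space of absolutely $p$-summing linear operators from $E$ to $F$. Here $\aleph_{1}$ denotes, by convention, the cardinality of $\mathbb{R}$. A subset $A$ of an infinite-dimensional vector space $V$ is called $\mu$-lineable if $A\cup\{0\}$ contains an infinite-dimensional subspace of dimension $\mu$. A complemented subspace is a closed subspace that is the range of a bounded linear projection.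
   Formalization: E and F are both assumed infinite-dimensional; without this the claim is false (e.g. E one-dimensional and F = l2: every operator has finite rank, hence is absolutely p-summing, and the sets are empty). *)

theory Defs
  imports "HOL-Analysis.Analysis" "HOL-Library.Equipollence"
begin

section \<open>Banach spaces over a real or complex scalar field\<close>

text \<open>A field that is a finite-dimensional real algebra with multiplicative norm is
  isometrically isomorphic to the reals or the complex numbers, so the sort
  \<open>{real_normed_field, euclidean_space}\<close> treats both cases at once. The class \<open>banach\<close> only
  knows real scalars; the scalar multiplication of the actual field is the parameter \<open>scale\<close>.\<close>

locale kbanach = vector_space scale
  for scale :: "'k::{real_normed_field,euclidean_space} \<Rightarrow> 'a::banach \<Rightarrow> 'a" +
  assumes scale_of_real: "scale (of_real r) x = r *\<^sub>R x"
    and norm_scale: "norm (scale c x) = norm c * norm x"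

lemma kbanach_real: "kbanach (scaleR :: real \<Rightarrow> 'a::banach \<Rightarrow> 'a)"
  by unfold_locales (simp_all add: scaleR_add_right scaleR_add_left)

lemma kbanach_complex: "kbanach ((*) :: complex \<Rightarrow> complex \<Rightarrow> complex)"
  by unfold_locales (simp_all add: algebra_simps norm_mult scaleR_conv_of_real)

definition fin_dim :: "('k::field \<Rightarrow> 'a::ab_group_add \<Rightarrow> 'a) \<Rightarrow> 'a set \<Rightarrow> bool" where
  "fin_dim s M \<longleftrightarrow> (\<exists>S. finite S \<and> M \<subseteq> module.span s S)"

section \<open>Banach spaces on a carrier set, duality and reflexivity\<close>

text \<open>Superreflexivity quantifies over Banach spaces, so these are needed as values of a type,
  not only as types.\<close>

record ('k, 'u) nspace =
  pts :: "'u set"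
  zer :: 'u
  add :: "'u \<Rightarrow> 'u \<Rightarrow> 'u"
  smul :: "'k \<Rightarrow> 'u \<Rightarrow> 'u"
  nrm :: "'u \<Rightarrow> real"

locale carrier_banach =
  fixes X :: "('k::{real_normed_field,euclidean_space}, 'u) nspace"
  assumes zer_closed: "zer X \<in> pts X"
    and add_closed: "\<lbrakk>x \<in> pts X; y \<in> pts X\<rbrakk> \<Longrightarrow> add X x y \<in> pts X"
    and smul_closed: "x \<in> pts X \<Longrightarrow> smul X c x \<in> pts X"
    and add_assoc: "\<lbrakk>x \<in> pts X; y \<in> pts X; z \<in> pts X\<rbrakk> \<Longrightarrow>
      add X (add X x y) z = add X x (add X y z)"
    and add_commute: "\<lbrakk>x \<in> pts X; y \<in> pts X\<rbrakk> \<Longrightarrow> add X x y = add X y x"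
    and add_zer: "x \<in> pts X \<Longrightarrow> add X x (zer X) = x"
    and add_inverse: "x \<in> pts X \<Longrightarrow> add X x (smul X (- 1) x) = zer X"
    and smul_add_right: "\<lbrakk>x \<in> pts X; y \<in> pts X\<rbrakk> \<Longrightarrow>
      smul X c (add X x y) = add X (smul X c x) (smul X c y)"
    and smul_add_left: "x \<in> pts X \<Longrightarrow> smul X (c + d) x = add X (smul X c x) (smul X d x)"
    and smul_smul: "x \<in> pts X \<Longrightarrow> smul X c (smul X d x) = smul X (c * d) x"
    and smul_one: "x \<in> pts X \<Longrightarrow> smul X 1 x = x"
    and nrm_nonneg: "x \<in> pts X \<Longrightarrow> 0 \<le> nrm X x"
    and nrm_eq_0: "x \<in> pts X \<Longrightarrow> nrm X x = 0 \<longleftrightarrow> x = zer X"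
    and nrm_triangle: "\<lbrakk>x \<in> pts X; y \<in> pts X\<rbrakk> \<Longrightarrow> nrm X (add X x y) \<le> nrm X x + nrm X y"
    and nrm_smul: "x \<in> pts X \<Longrightarrow> nrm X (smul X c x) = norm c * nrm X x"
    and complete: "\<lbrakk>range \<sigma> \<subseteq> pts X;
        \<forall>\<epsilon>>0. \<exists>N. \<forall>m\<ge>N. \<forall>n\<ge>N. nrm X (add X (\<sigma> m) (smul X (- 1) (\<sigma> n))) < \<epsilon>\<rbrakk> \<Longrightarrow>
      \<exists>x\<in>pts X. (\<lambda>n. nrm X (add X (\<sigma> n) (smul X (- 1) x))) \<longlonglongrightarrow> 0"

text \<open>Functionals are normalised to vanish off the carrier, so that equality in the dual is
  equality of functions.\<close>

definition dual :: "('k::{real_normed_field,euclidean_space}, 'u) nspace \<Rightarrow> ('k, 'u \<Rightarrow> 'k) nspace"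
  where "dual X =
    \<lparr>pts = {f. (\<forall>x\<in>pts X. \<forall>y\<in>pts X. f (add X x y) = f x + f y)
             \<and> (\<forall>c. \<forall>x\<in>pts X. f (smul X c x) = c * f x)
             \<and> (\<exists>C. \<forall>x\<in>pts X. norm (f x) \<le> C * nrm X x)
             \<and> (\<forall>x. x \<notin> pts X \<longrightarrow> f x = 0)},
     zer = (\<lambda>x. 0),
     add = (\<lambda>f g x. f x + g x),
     smul = (\<lambda>c f x. c * f x),
     nrm = (\<lambda>f. SUP x\<in>{x \<in> pts X. nrm X x \<le> 1}. norm (f x))\<rparr>"

definition reflexive :: "('k::{real_normed_field,euclidean_space}, 'u) nspace \<Rightarrow> bool" where
  "reflexive X \<longleftrightarrow>
     (\<forall>\<Phi>\<in>pts (dual (dual X)). \<exists>x\<in>pts X. \<forall>f\<in>pts (dual X). \<Phi> f = f x)"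

definition subspace_in :: "('k, 'u) nspace \<Rightarrow> 'u set \<Rightarrow> bool" where
  "subspace_in X G \<longleftrightarrow> G \<subseteq> pts X \<and> zer X \<in> G
     \<and> (\<forall>x\<in>G. \<forall>y\<in>G. add X x y \<in> G) \<and> (\<forall>c. \<forall>x\<in>G. smul X c x \<in> G)"

definition fin_dim_subspace_in :: "('k, 'u) nspace \<Rightarrow> 'u set \<Rightarrow> bool" where
  "fin_dim_subspace_in X G \<longleftrightarrow> subspace_in X G
     \<and> (\<exists>S. finite S \<and> S \<subseteq> G \<and> (\<forall>H. subspace_in X H \<and> S \<subseteq> H \<longrightarrow> G \<subseteq> H))"

section \<open>Superreflexivity\<close>

definition finitely_representable ::
    "('k::{real_normed_field,euclidean_space}, 'u) nspace \<Rightarrow> ('k \<Rightarrow> 'a::banach \<Rightarrow> 'a) \<Rightarrow> bool"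
  where "finitely_representable X s \<longleftrightarrow>
    (\<forall>G \<epsilon>. fin_dim_subspace_in X G \<and> \<epsilon> > 0 \<longrightarrow>
      (\<exists>T. (\<forall>x\<in>G. \<forall>y\<in>G. T (add X x y) = T x + T y)
         \<and> (\<forall>c. \<forall>x\<in>G. T (smul X c x) = s c (T x))
         \<and> (\<forall>x\<in>G. nrm X x \<le> norm (T x) \<and> norm (T x) \<le> (1 + \<epsilon>) * nrm X x)))"

text \<open>\<open>E\<close> is superreflexive if every Banach space finitely representable in \<open>E\<close> is reflexive.
  HOL cannot quantify over all Banach spaces, so their points are taken from the type
  \<open>(nat \<Rightarrow> 'a) set\<close>, which loses nothing. Indeed, if \<open>E\<close> is nonzero this type has at least the
  cardinality of the continuum, hence contains a copy of every separable Banach space; a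
  nonreflexive space has a separable nonreflexive closed subspace, and finite representability
  passes to subspaces. If \<open>E\<close> is zero, only zero spaces are finitely representable in it. The
  equivalence classes forming an ultrapower of \<open>E\<close> over the naturals are elements of this type.\<close>

definition superreflexive ::
    "('k::{real_normed_field,euclidean_space} \<Rightarrow> 'a::banach \<Rightarrow> 'a) \<Rightarrow> bool" where
  "superreflexive s \<longleftrightarrow>
     (\<forall>X :: ('k, (nat \<Rightarrow> 'a) set) nspace.
        carrier_banach X \<and> finitely_representable X s \<longrightarrow> reflexive X)"

section \<open>Unconditional bases and complemented subspaces\<close>

definition schauder_basis_of ::
    "('k::field \<Rightarrow> 'a::banach \<Rightarrow> 'a) \<Rightarrow> (nat \<Rightarrow> 'a) \<Rightarrow> 'a set \<Rightarrow> bool" where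
  "schauder_basis_of s e M \<longleftrightarrow>
     range e \<subseteq> M \<and> (\<forall>x\<in>M. \<exists>!a. (\<lambda>n. s (a n) (e n)) sums x)"

text \<open>Unconditional convergence is convergence of the net of finite partial sums.\<close>

definition unconditional_basis_of ::
    "('k::field \<Rightarrow> 'a::banach \<Rightarrow> 'a) \<Rightarrow> (nat \<Rightarrow> 'a) \<Rightarrow> 'a set \<Rightarrow> bool" where
  "unconditional_basis_of s e M \<longleftrightarrow> schauder_basis_of s e M
     \<and> (\<forall>a. summable (\<lambda>n. s (a n) (e n)) \<longrightarrow> (\<lambda>n. s (a n) (e n)) summable_on UNIV)"

definition unconditional_basic_sequence ::
    "('k::field \<Rightarrow> 'a::banach \<Rightarrow> 'a) \<Rightarrow> (nat \<Rightarrow> 'a) \<Rightarrow> bool" where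
  "unconditional_basic_sequence s e \<longleftrightarrow>
     unconditional_basis_of s e (closure (module.span s (range e)))"

definition complemented :: "('k::field \<Rightarrow> 'a::banach \<Rightarrow> 'a) \<Rightarrow> 'a set \<Rightarrow> bool" where
  "complemented s M \<longleftrightarrow> closed M \<and> module.subspace s M
     \<and> (\<exists>P. Vector_Spaces.linear s s P \<and> bounded_linear P \<and> P \<circ> P = P \<and> range P = M)"

section \<open>Spaces of operators\<close>

text \<open>The type \<open>'a \<Rightarrow>\<^sub>L 'b\<close> consists of all bounded real-linear maps; the operators between spaces
  over \<open>'k\<close> are the \<open>'k\<close>-linear ones among them.\<close>

definition bounded_ops ::
    "('k::field \<Rightarrow> 'a::banach \<Rightarrow> 'a) \<Rightarrow> ('k \<Rightarrow> 'b::banach \<Rightarrow> 'b) \<Rightarrow> ('a \<Rightarrow>\<^sub>L 'b) set" where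
  "bounded_ops sE sF = {T. Vector_Spaces.linear sE sF (blinfun_apply T)}"

definition compact_ops ::
    "('k::field \<Rightarrow> 'a::banach \<Rightarrow> 'a) \<Rightarrow> ('k \<Rightarrow> 'b::banach \<Rightarrow> 'b) \<Rightarrow> ('a \<Rightarrow>\<^sub>L 'b) set" where
  "compact_ops sE sF =
     {T \<in> bounded_ops sE sF. compact (closure (blinfun_apply T ` cball 0 1))}"

definition dual_ball ::
    "('k::{real_normed_field,euclidean_space} \<Rightarrow> 'a::banach \<Rightarrow> 'a) \<Rightarrow> ('a \<Rightarrow> 'k) set" where
  "dual_ball s = {\<phi>. Vector_Spaces.linear s (*) \<phi> \<and> (\<forall>x. norm (\<phi> x) \<le> norm x)}"

definition summing_ops ::
    "real \<Rightarrow> ('k::{real_normed_field,euclidean_space} \<Rightarrow> 'a::banach \<Rightarrow> 'a) \<Rightarrow>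
      ('k \<Rightarrow> 'b::banach \<Rightarrow> 'b) \<Rightarrow> ('a \<Rightarrow>\<^sub>L 'b) set" where
  "summing_ops p sE sF = {T \<in> bounded_ops sE sF.
     \<exists>C. \<forall>(m::nat) (x :: nat \<Rightarrow> 'a).
       (\<Sum>i<m. norm (blinfun_apply T (x i)) powr p) powr (1 / p)
         \<le> C * (SUP \<phi>\<in>dual_ball sE. (\<Sum>i<m. norm (\<phi> (x i)) powr p) powr (1 / p))}"

section \<open>Lineability\<close>

definition op_scale ::
    "('k \<Rightarrow> 'b::banach \<Rightarrow> 'b) \<Rightarrow> 'k \<Rightarrow> ('a::banach \<Rightarrow>\<^sub>L 'b) \<Rightarrow> ('a \<Rightarrow>\<^sub>L 'b)" where
  "op_scale s c T = Blinfun (\<lambda>x. s c (blinfun_apply T x))"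

lemma (in kbanach) bounded_linear_scale: "bounded_linear (scale c)"
proof
  fix x y :: 'a and r :: real
  show "scale c (x + y) = scale c x + scale c y"
    by (rule scale_right_distrib)
  have "scale c (scale (of_real r) x) = scale (of_real r) (scale c x)"
    by (simp add: mult.commute)
  then show "scale c (r *\<^sub>R x) = r *\<^sub>R scale c x"
    by (simp only: scale_of_real)
  show "\<exists>K. \<forall>x. norm (scale c x) \<le> norm x * K"
    by (rule exI[of _ "norm c"]) (simp add: norm_scale mult.commute)
qed

lemma (in kbanach) op_scale_apply:
  "blinfun_apply (op_scale scale c T) x = scale c (blinfun_apply T x)"
  unfolding op_scale_def
  by (subst bounded_linear_Blinfun_apply)
    (auto intro: bounded_linear_compose[OF bounded_linear_scale] blinfun.bounded_linear_right)

lemma (in kbanach) vector_space_op_scale: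
  "vector_space (op_scale scale :: 'k \<Rightarrow> ('b::banach \<Rightarrow>\<^sub>L 'a) \<Rightarrow> _)"
  by unfold_locales
    (auto intro!: blinfun_eqI
      simp: op_scale_apply blinfun.add_left scale_right_distrib scale_left_distrib)

text \<open>The cardinal is given by a set \<open>\<mu>\<close> of that cardinality.\<close>

definition lineable ::
    "('k::field \<Rightarrow> 'v::ab_group_add \<Rightarrow> 'v) \<Rightarrow> 'm set \<Rightarrow> 'v set \<Rightarrow> bool" where
  "lineable s \<mu> A \<longleftrightarrow>
     (\<exists>W B. module.subspace s W \<and> \<not> fin_dim s W \<and> W \<subseteq> A \<union> {0}
        \<and> \<not> module.dependent s B \<and> module.span s B = W \<and> B \<approx> \<mu>)"

end

theory Submission
  imports Defs "HOL-Library.Ramsey" "Jordan_Normal_Form.Determinant"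
begin

text \<open>
  If every finite rank operator \<open>E \<rightarrow> F\<close> of norm at most 1 had \<open>p\<close>-summing norm at most \<open>C\<close>, then
  \<open>E\<close> would not be superreflexive. Pairing Dvoretzky--Rogers families of the dual of \<open>E\<close> and of \<open>F\<close>
  gives, for every \<open>n\<close>, bounded finite rank operators that keep \<open>n\<close> points of the unit ball of \<open>E\<close>
  apart. Testing the summing inequality on the differences of these points yields functionals in
  the unit ball that are large on a fixed proportion of any given list of differences. In a
  spreading limit of the points, obtained from Ramsey's theorem and compactness, the consecutive
  differences are suppression unconditional, so these functionals make them equivalent to the unit
  vector basis of \<open>l1\<close>. Thus a renorming of \<open>l1\<close> is finitely representable in \<open>E\<close>.

  Hence there are finite rank operators of norm at most 1 with arbitrarily large \<open>p\<close>-summing norm.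
  A rapidly decreasing sequence \<open>v k\<close> of multiples of such operators is summed over the members of
  an almost disjoint family of sets of natural numbers, indexed by the reals. A nontrivial linear
  combination of these sums contains a fixed nonzero multiple of \<open>v k\<close> for infinitely many \<open>k\<close>, and
  a gliding hump argument shows that it is not \<open>p\<close>-summing.
\<close>

section \<open>Bounded functionals separate points\<close>

text \<open>The exponent \<open>p\<close> disappears early: differences of points of the unit ball
  have norm at most 2, so their \<open>p\<close>-th powers are dominated by multiples of first
  powers, and a bound on \<open>p\<close>-summing norms becomes a lower l1-estimate on lists of
  differences. The functional obtained depends on the list and is large only on average over it.
  Unconditionality is what turns such averages into an l1-estimate for all coefficients: the good
  part of a long list is selected, the spreading property moves a given combination onto it, and
  suppression compares a part of the combination with the whole. This is why differences of a
  spreading sequence are used instead of the sequence itself. Real and complex scalars are treated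
  together through the real bilinear form \<open>inner (c * d) 1\<close>; passing between real and
  scalar functionals costs only factors depending on \<open>DIM('k)\<close>. Cluster points in
  products of balls take the place of limits along ultrafilters.\<close>

definition sublinear :: "('a::real_vector \<Rightarrow> real) \<Rightarrow> bool" where
  "sublinear q \<longleftrightarrow> (\<forall>x y. q (x + y) \<le> q x + q y) \<and> (\<forall>x t. t \<ge> 0 \<longrightarrow> q (t *\<^sub>R x) \<le> t * q x)"

lemma sublinear_scaleR:
  assumes "sublinear q" "t \<ge> 0" shows "q (t *\<^sub>R x) = t * q x"
proof (cases "t = 0")
  case True
  have "q (0 *\<^sub>R x) \<le> 0 * q x" "q (0 + 0) \<le> q 0 + q 0"
    using assms(1) unfolding sublinear_def by blast+
  then show ?thesis using True by simp
next
  case False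
  then have "q (inverse t *\<^sub>R (t *\<^sub>R x)) \<le> inverse t * q (t *\<^sub>R x)"
    using assms unfolding sublinear_def by (meson inverse_nonnegative_iff_nonnegative)
  then have "t * q x \<le> q (t *\<^sub>R x)"
    using False assms(2) by (simp add: field_simps)
  with assms show ?thesis unfolding sublinear_def by (meson order_antisym)
qed

lemma sublinear_zero: "sublinear q \<Longrightarrow> q 0 = 0"
  using sublinear_scaleR[of q 0 0] by simp

lemma sublinear_add: "sublinear q \<Longrightarrow> q (x + y) \<le> q x + q y"
  by (simp add: sublinear_def)

lemma sublinear_minus: "sublinear q \<Longrightarrow> - q (- x) \<le> q x"
  using sublinear_add[of q x "- x"] sublinear_zero[of q] by simp

text \<open>Replacing a sublinear \<open>q\<close> by \<open>sublinear_improve q y\<close> forces additivity in the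
  direction \<open>y\<close>; hence a minimal sublinear functional is linear.\<close>

definition sublinear_improve :: "('a::real_vector \<Rightarrow> real) \<Rightarrow> 'a \<Rightarrow> 'a \<Rightarrow> real" where
  "sublinear_improve q y x = (INF t\<in>{0..}. q (x + t *\<^sub>R y) - t * q y)"

text \<open>The bound is independent of \<open>t\<close>, so the infimum defining
  \<open>sublinear_improve\<close> is taken over a set bounded below.\<close>

lemma sublinear_improve_lower:
  assumes "sublinear q" "t \<ge> 0" shows "- q (- x) \<le> q (x + t *\<^sub>R y) - t * q y"
  using sublinear_add[OF assms(1), of "x + t *\<^sub>R y" "- x"] sublinear_scaleR[OF assms, of y] by simp

lemma sublinear_improve_le:
  assumes "sublinear q" "t \<ge> 0" shows "sublinear_improve q y x \<le> q (x + t *\<^sub>R y) - t * q y"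
  unfolding sublinear_improve_def
  by (rule cINF_lower) (use assms sublinear_improve_lower[OF assms(1)] in \<open>auto intro!: bdd_belowI2\<close>)

lemma sublinear_sublinear_improve:
  assumes q: "sublinear q" shows "sublinear (sublinear_improve q y)"
proof -
  have "sublinear_improve q y (a + b) \<le> sublinear_improve q y a + sublinear_improve q y b" for a b
  proof -
    \<comment> \<open>Parameters \<open>s\<close> and \<open>t\<close> chosen for the two summands
      add up to an admissible parameter for the sum.\<close>
    have *: "sublinear_improve q y (a + b) - (q (a + s *\<^sub>R y) - s * q y) \<le> q (b + t *\<^sub>R y) - t * q y"
      if "s \<ge> 0" "t \<ge> 0" for s t
    proof -
      have "sublinear_improve q y (a + b) \<le> q ((a + b) + (s + t) *\<^sub>R y) - (s + t) * q y"
        by (rule sublinear_improve_le[OF q]) (use that in simp)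
      also have "(a + b) + (s + t) *\<^sub>R y = (a + s *\<^sub>R y) + (b + t *\<^sub>R y)"
        by (simp add: algebra_simps)
      finally show ?thesis
        using sublinear_add[OF q, of "a + s *\<^sub>R y" "b + t *\<^sub>R y"] by (simp add: algebra_simps)
    qed
    have "sublinear_improve q y (a + b) - sublinear_improve q y b \<le> q (a + s *\<^sub>R y) - s * q y"
      if "s \<ge> 0" for s
    proof -
      have "sublinear_improve q y (a + b) - (q (a + s *\<^sub>R y) - s * q y) \<le> sublinear_improve q y b"
        unfolding sublinear_improve_def[of q y b] using *[OF that] by (intro cINF_greatest) auto
      then show ?thesis by simp
    qed
    then have "sublinear_improve q y (a + b) - sublinear_improve q y b \<le> sublinear_improve q y a"
      unfolding sublinear_improve_def[of q y a] by (intro cINF_greatest) auto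
    then show ?thesis by simp
  qed
  moreover have "sublinear_improve q y (r *\<^sub>R a) \<le> r * sublinear_improve q y a" if r: "r \<ge> 0" for r a
  proof (cases "r = 0")
    case True
    have "sublinear_improve q y 0 \<le> q (0 + 0 *\<^sub>R y) - 0 * q y"
      by (rule sublinear_improve_le[OF q]) simp
    then show ?thesis using True sublinear_zero[OF q] by simp
  next
    case False
    have "sublinear_improve q y (r *\<^sub>R a) / r \<le> q (a + t *\<^sub>R y) - t * q y" if "t \<ge> 0" for t
    proof -
      have "sublinear_improve q y (r *\<^sub>R a) \<le> q (r *\<^sub>R a + (r * t) *\<^sub>R y) - (r * t) * q y"
        by (rule sublinear_improve_le[OF q]) (use that r in simp)
      also have "r *\<^sub>R a + (r * t) *\<^sub>R y = r *\<^sub>R (a + t *\<^sub>R y)"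
        by (simp add: algebra_simps)
      finally show ?thesis
        using sublinear_scaleR[OF q r, of "a + t *\<^sub>R y"] r False by (simp add: field_simps)
    qed
    then have "sublinear_improve q y (r *\<^sub>R a) / r \<le> sublinear_improve q y a"
      unfolding sublinear_improve_def[of q y a] by (intro cINF_greatest) auto
    then show ?thesis using r False by (simp add: field_simps)
  qed
  ultimately show ?thesis unfolding sublinear_def by blast
qed

lemma sublinear_norm: "sublinear (norm :: 'a::real_normed_vector \<Rightarrow> real)"
  by (simp add: sublinear_def norm_triangle_ineq)

text \<open>Supplies the lower bounds of chains for Zorn's lemma. The infimum is finite because
  \<open>q <= norm\<close> gives \<open>q x >= - q (- x) >= - norm x\<close>, and subadditive
  because any two members are comparable.\<close>

lemma sublinear_chain_INF:
  fixes C :: "('a::real_normed_vector \<Rightarrow> real) set"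
  assumes C: "C \<noteq> {}" and sub: "\<And>q. q \<in> C \<Longrightarrow> sublinear q \<and> (\<forall>x. q x \<le> norm x)"
    and chain: "\<And>p q. p \<in> C \<Longrightarrow> q \<in> C \<Longrightarrow> p \<le> q \<or> q \<le> p"
  shows "sublinear (\<lambda>x. INF q\<in>C. q x)" and "\<And>q x. q \<in> C \<Longrightarrow> (INF q\<in>C. q x) \<le> q x"
proof -
  have bdd: "bdd_below ((\<lambda>q. q x) ` C)" for x
  proof (rule bdd_belowI2)
    fix q assume "q \<in> C"
    then have "q (- x) \<le> norm (- x)" "- q (- x) \<le> q x" using sub sublinear_minus by blast+
    then show "- norm x \<le> q x" by simp
  qed
  show le: "(INF q\<in>C. q x) \<le> q x" if "q \<in> C" for q x
    by (rule cINF_lower[OF bdd that])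
  have "(INF q\<in>C. q (x + y)) \<le> (INF q\<in>C. q x) + (INF q\<in>C. q y)" for x y
  proof -
    have *: "(INF q\<in>C. q (x + y)) - p x \<le> r y" if pr: "p \<in> C" "r \<in> C" for p r
    proof -
      obtain q where q: "q \<in> C" "q \<le> p" "q \<le> r"
        using chain[OF pr] pr by (metis order_refl)
      have "(INF q\<in>C. q (x + y)) \<le> q (x + y)" by (rule le[OF q(1)])
      also have "\<dots> \<le> q x + q y" using sub[OF q(1)] sublinear_add by blast
      also have "\<dots> \<le> p x + r y" using q by (simp add: le_fun_def add_mono)
      finally show ?thesis by simp
    qed
    have "(INF q\<in>C. q (x + y)) - (INF q\<in>C. q y) \<le> p x" if "p \<in> C" for p
    proof -
      have "(INF q\<in>C. q (x + y)) - p x \<le> (INF q\<in>C. q y)"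
        using *[OF that] C by (intro cINF_greatest) auto
      then show ?thesis by simp
    qed
    then have "(INF q\<in>C. q (x + y)) - (INF q\<in>C. q y) \<le> (INF q\<in>C. q x)"
      using C by (intro cINF_greatest) auto
    then show ?thesis by simp
  qed
  moreover have "(INF q\<in>C. q (t *\<^sub>R x)) \<le> t * (INF q\<in>C. q x)" if t: "t \<ge> 0" for t x
  proof (cases "t = 0")
    case True
    obtain q where "q \<in> C" using C by blast
    then show ?thesis using le[of q 0] sub[of q] sublinear_zero[of q] True by simp
  next
    case False
    have "(INF q\<in>C. q (t *\<^sub>R x)) / t \<le> (INF q\<in>C. q x)"
    proof (rule cINF_greatest[OF C])
      fix q assume "q \<in> C"
      then show "(INF q\<in>C. q (t *\<^sub>R x)) / t \<le> q x"
        using le[of q "t *\<^sub>R x"] sub[of q] sublinear_scaleR[of q t x] t False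
        by (simp add: field_simps)
    qed
    then show ?thesis using t False by (simp add: field_simps)
  qed
  ultimately show "sublinear (\<lambda>x. INF q\<in>C. q x)" unfolding sublinear_def by blast
qed

text \<open>A Hahn-Banach argument without extension steps: a minimal sublinear functional below the
  norm is linear, and a condition at \<open>- x0\<close>, inherited by all smaller functionals,
  makes it nonzero at \<open>x0\<close>.\<close>

lemma bounded_functional_nonzero_at:
  fixes x0 :: "'a::real_normed_vector"
  assumes "x0 \<noteq> 0"
  shows "\<exists>f :: 'a \<Rightarrow> real. bounded_linear f \<and> f x0 \<noteq> 0"
proof -
  define A where "A = {q :: 'a \<Rightarrow> real. sublinear q \<and> (\<forall>x. q x \<le> norm x) \<and> q (- x0) \<le> - norm x0}"
  have le_q: "sublinear_improve q y x \<le> q x" if "sublinear q" for q :: "'a \<Rightarrow> real" and x y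
    using sublinear_improve_le[OF that, of 0 y x] by simp
  define q0 where "q0 = sublinear_improve norm x0"
  have q0: "q0 \<in> A"
    unfolding A_def q0_def
    using sublinear_sublinear_improve[OF sublinear_norm] le_q[OF sublinear_norm]
      sublinear_improve_le[OF sublinear_norm, of 1 x0 "- x0"] by auto
  \<comment> \<open>Zorn's lemma is used with the order reversed, so that its maximal element is
    pointwise minimal.\<close>
  have "\<exists>m\<in>A. \<forall>a\<in>A. a \<le> m \<longrightarrow> a = m"
  proof (rule predicate_Zorn[where P = "\<lambda>m a. a \<le> m", simplified])
    show "partial_order_on A (relation_of (\<lambda>m a. a \<le> m) A)"
      by (rule partial_order_on_relation_ofI) auto
    fix C assume "C \<in> Chains (relation_of (\<lambda>m a. a \<le> m) A)"
    then have CA: "C \<subseteq> A" and chain: "\<And>p q. p \<in> C \<Longrightarrow> q \<in> C \<Longrightarrow> p \<le> q \<or> q \<le> p"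
      unfolding Chains_def relation_of_def by auto
    show "\<exists>u\<in>A. \<forall>a\<in>C. u \<le> a"
    proof (cases "C = {}")
      case True
      then show ?thesis using q0 by blast
    next
      case False
      then obtain p where p: "p \<in> C" by blast
      have s: "sublinear (\<lambda>x. INF q\<in>C. q x)" and l: "\<And>q x. q \<in> C \<Longrightarrow> (INF q\<in>C. q x) \<le> q x"
        using CA chain unfolding A_def
        by (auto intro!: sublinear_chain_INF[OF False] dest: subsetD)
      have "(\<lambda>x. INF q\<in>C. q x) \<in> A"
        unfolding A_def using s l[OF p] p CA unfolding A_def by (auto intro: order_trans)
      then show ?thesis using l by (intro bexI[of _ "\<lambda>x. INF q\<in>C. q x"]) (auto simp: le_fun_def)
    qed
  qed
  then obtain q where qA: "q \<in> A" and min: "\<And>a. a \<in> A \<Longrightarrow> a \<le> q \<Longrightarrow> a = q" by blast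
  have q: "sublinear q" "\<And>x. q x \<le> norm x" "q (- x0) \<le> - norm x0" using qA by (auto simp: A_def)
  have add: "q (x + y) = q x + q y" for x y
  proof -
    \<comment> \<open>Minimality makes \<open>q\<close> equal to its own improvement in every
      direction; \<open>t = 1\<close> then yields the missing half of additivity.\<close>
    have "sublinear_improve q y \<in> A"
      unfolding A_def using sublinear_sublinear_improve[OF q(1)] order_trans[OF le_q[OF q(1)]] q
      by blast
    then have "sublinear_improve q y = q"
      by (rule min) (simp add: le_fun_def le_q[OF q(1)])
    then have "q x \<le> q (x + 1 *\<^sub>R y) - 1 * q y"
      using sublinear_improve_le[OF q(1), of 1 y x] by simp
    then show ?thesis using sublinear_add[OF q(1), of x y] by simp
  qed
  have minus: "q (- x) = - q x" for x
    using add[of x "- x"] sublinear_zero[OF q(1)] by simp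
  have "bounded_linear q"
  proof (rule bounded_linear_intro[where K = 1])
    show "q (x + y) = q x + q y" for x y by (rule add)
    show "q (r *\<^sub>R x) = r *\<^sub>R q x" for r x
    proof (cases "r \<ge> 0")
      case True
      then show ?thesis using sublinear_scaleR[OF q(1)] by simp
    next
      case False
      then have "q ((- r) *\<^sub>R x) = - r * q x" by (intro sublinear_scaleR[OF q(1)]) simp
      then show ?thesis using minus[of "r *\<^sub>R x"] by simp
    qed
    show "norm (q x) \<le> norm x * 1" for x
      using q(2)[of x] q(2)[of "- x"] minus[of x] by simp
  qed
  moreover have "q x0 \<noteq> 0" using q(3) minus[of x0] assms by auto
  ultimately show ?thesis by blast
qed

section \<open>The Dvoretzky--Rogers lemma\<close>

text \<open>\<open>upper2 n f\<close>: the map sending the unit vectors of Euclidean space to \<open>f 0, ..., f (n - 1)\<close> is a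
  contraction.\<close>

definition upper2 :: "nat \<Rightarrow> (nat \<Rightarrow> 'v::real_normed_vector) \<Rightarrow> bool" where
  "upper2 n f \<longleftrightarrow> (\<forall>a. (norm (\<Sum>i<n. a i *\<^sub>R f i))\<^sup>2 \<le> (\<Sum>i<n. (a i)\<^sup>2))"

text \<open>The alternating \<open>n\<close>-form defined by \<open>n\<close> functionals: a volume
  for families of vectors in a space of any dimension, with no \<open>n\<close>-dimensional subspace
  singled out.\<close>

definition gdet :: "nat \<Rightarrow> (nat \<Rightarrow> 'v \<Rightarrow> real) \<Rightarrow> (nat \<Rightarrow> 'v) \<Rightarrow> real" where
  "gdet n G f = Determinant.det (mat n n (\<lambda>(i, j). G j (f i)))"

lemma permutes_nat_less: "p permutes {0..<n} \<Longrightarrow> i < n \<Longrightarrow> p i < (n::nat)"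
  using permutes_in_image[of p "{0..<n}" i] by simp

lemma gdet_leibniz:
  "gdet n G f = (\<Sum>p\<in>{p. p permutes {0..<n}}. signof p * (\<Prod>i=0..<n. G (p i) (f i)))"
proof -
  have "(\<Prod>i=0..<n. mat n n (\<lambda>(i, j). G j (f i)) $$ (i, p i)) = (\<Prod>i=0..<n. G (p i) (f i))"
    if "p permutes {0..<n}" for p
    using that by (intro prod.cong) (auto simp: permutes_nat_less)
  then show ?thesis by (auto simp: gdet_def Determinant.det_def intro!: sum.cong)
qed

lemma gdet_scaleR:
  assumes "\<And>j. j < n \<Longrightarrow> linear (G j)"
  shows "gdet n G (\<lambda>i. c i *\<^sub>R f i) = (\<Prod>i=0..<n. c i) * gdet n G f"
proof -
  have "(\<Prod>i=0..<n. G (p i) (c i *\<^sub>R f i)) = (\<Prod>i=0..<n. c i) * (\<Prod>i=0..<n. G (p i) (f i))"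
    if "p permutes {0..<n}" for p
    unfolding prod.distrib[symmetric]
    using that assms by (intro prod.cong) (auto simp: linear_cmul permutes_nat_less)
  then show ?thesis
    unfolding gdet_leibniz sum_distrib_left by (intro sum.cong) auto
qed

text \<open>Families with \<open>upper2\<close> lie in the unit ball, so this makes the supremum of
  their determinants finite.\<close>

lemma gdet_bounded:
  assumes "\<And>j. j < n \<Longrightarrow> bounded_linear (G j)"
  shows "\<exists>B. \<forall>f. (\<forall>i<n. norm (f i) \<le> 1) \<longrightarrow> \<bar>gdet n G f\<bar> \<le> B"
proof -
  define K where "K = (\<Sum>j<n. onorm (G j))"
  have K: "\<bar>G j x\<bar> \<le> K" if "j < n" "norm x \<le> 1" for j x
  proof -
    have "\<bar>G j x\<bar> \<le> onorm (G j) * norm x"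
      using onorm[OF assms[OF that(1)], of x] by simp
    also have "\<dots> \<le> onorm (G j) * 1"
      using that(2) onorm_pos_le[OF assms[OF that(1)]] by (intro mult_left_mono) auto
    also have "\<dots> \<le> K"
      unfolding K_def using that(1) onorm_pos_le[OF assms] by (simp, intro member_le_sum) auto
    finally show ?thesis .
  qed
  have "\<bar>gdet n G f\<bar> \<le> (\<Sum>p\<in>{p. p permutes {0..<n}}. K ^ n)"
    if f: "\<forall>i<n. norm (f i) \<le> 1" for f
    unfolding gdet_leibniz
  proof (rule sum_abs[THEN order_trans], rule sum_mono)
    fix p assume "p \<in> {p. p permutes {0..<n}}"
    then have "(\<Prod>i=0..<n. \<bar>G (p i) (f i)\<bar>) \<le> (\<Prod>i=0..<n. K)"
      using f K by (intro prod_mono) (auto simp: permutes_nat_less)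
    then show "\<bar>signof p * (\<Prod>i=0..<n. G (p i) (f i))\<bar> \<le> K ^ n"
      by (simp add: abs_mult abs_prod sign_def)
  qed
  then show ?thesis by blast
qed

text \<open>For \<open>w\<close> of squared length 2, subtracting \<open><a, w> w\<close> is the
  Householder reflection in the hyperplane orthogonal to \<open>w\<close>, an isometry of Euclidean
  space.\<close>

lemma sum_reflect_squares:
  fixes a w :: "nat \<Rightarrow> real"
  assumes "(\<Sum>i<n. (w i)\<^sup>2) = 2"
  shows "(\<Sum>i<n. (a i - (\<Sum>k<n. a k * w k) * w i)\<^sup>2) = (\<Sum>i<n. (a i)\<^sup>2)"
proof -
  define s where "s = (\<Sum>k<n. a k * w k)"
  have "(\<Sum>i<n. (a i - s * w i)\<^sup>2) = (\<Sum>i<n. (a i)\<^sup>2 - 2 * s * (a i * w i) + s\<^sup>2 * (w i)\<^sup>2)"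
    by (intro sum.cong) (auto simp: power2_eq_square algebra_simps)
  also have "\<dots> = (\<Sum>i<n. (a i)\<^sup>2) - 2 * s * s + s\<^sup>2 * 2"
    by (simp add: sum.distrib sum_subtractf sum_distrib_left[symmetric] s_def[symmetric] assms)
  finally show ?thesis by (simp add: s_def power2_eq_square)
qed

lemma upper2_reflect:
  fixes f :: "nat \<Rightarrow> 'v::real_normed_vector"
  assumes "upper2 n f" and w: "(\<Sum>i<n. (w i)\<^sup>2) = 2"
  shows "upper2 n (\<lambda>i. f i - w i *\<^sub>R (\<Sum>j<n. w j *\<^sub>R f j))"
  unfolding upper2_def
proof
  fix a :: "nat \<Rightarrow> real"
  define s where "s = (\<Sum>k<n. a k * w k)"
  define g where "g = (\<Sum>j<n. w j *\<^sub>R f j)"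
  have "(\<Sum>i<n. a i *\<^sub>R (f i - w i *\<^sub>R g)) = (\<Sum>i<n. a i *\<^sub>R f i) - s *\<^sub>R g"
    by (simp add: scaleR_diff_right sum_subtractf s_def scaleR_sum_left)
  also have "\<dots> = (\<Sum>i<n. (a i - s * w i) *\<^sub>R f i)"
    by (simp add: g_def scaleR_sum_right scaleR_diff_left sum_subtractf)
  finally have "(norm (\<Sum>i<n. a i *\<^sub>R (f i - w i *\<^sub>R g)))\<^sup>2 \<le> (\<Sum>i<n. (a i - s * w i)\<^sup>2)"
    using assms(1) by (simp add: upper2_def)
  then show "(norm (\<Sum>i<n. a i *\<^sub>R (f i - w i *\<^sub>R (\<Sum>j<n. w j *\<^sub>R f j))))\<^sup>2 \<le> (\<Sum>i<n. (a i)\<^sup>2)"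
    using sum_reflect_squares[OF w, of a] by (simp add: s_def g_def)
qed

text \<open>The matrix of the family is multiplied from the left by \<open>U = I - w w^T\<close>.
  Since \<open>w\<close> has squared length 2, \<open>U\<close> is an involution and its determinant
  is 1 or -1.\<close>

lemma gdet_reflect:
  fixes f :: "nat \<Rightarrow> 'v::real_vector"
  assumes lin: "\<And>j. j < n \<Longrightarrow> linear (G j)" and w: "(\<Sum>i<n. (w i)\<^sup>2) = 2"
  shows "\<bar>gdet n G (\<lambda>i. f i - w i *\<^sub>R (\<Sum>j<n. w j *\<^sub>R f j))\<bar> = \<bar>gdet n G f\<bar>"
proof -
  define \<delta> where "\<delta> = (\<lambda>i j :: nat. if i = j then 1 else 0 :: real)"
  define U where "U = mat n n (\<lambda>(i, j). \<delta> i j - w i * w j)"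
  define A where "A = mat n n (\<lambda>(i, j). G j (f i))"
  have carrier: "U \<in> carrier_mat n n" "A \<in> carrier_mat n n" by (auto simp: U_def A_def)
  have "U * U = 1\<^sub>m n"
  proof (rule eq_matI)
    fix i j assume ij: "i < dim_row (1\<^sub>m n :: real mat)" "j < dim_col (1\<^sub>m n :: real mat)"
    have "(U * U) $$ (i, j) = (\<Sum>k=0..<n. (\<delta> i k - w i * w k) * (\<delta> k j - w k * w j))"
      using ij by (simp add: U_def scalar_prod_def)
    also have "\<dots> = (\<Sum>k<n. \<delta> i k * \<delta> k j - \<delta> i k * (w k * w j) - (w i * w k) * \<delta> k j + w i * w j * (w k)\<^sup>2)"
      by (simp add: atLeast0LessThan algebra_simps power2_eq_square)
    also have "\<dots> = (\<Sum>k<n. \<delta> i k * \<delta> k j) - (\<Sum>k<n. \<delta> i k * (w k * w j)) - (\<Sum>k<n. (w i * w k) * \<delta> k j)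
        + w i * w j * (\<Sum>k<n. (w k)\<^sup>2)"
      by (simp add: sum.distrib sum_subtractf sum_distrib_left)
    also have "\<dots> = \<delta> i j"
      using ij w by (simp add: \<delta>_def if_distrib[of "\<lambda>x. x * _"] if_distrib[of "\<lambda>x. _ * x"] cong: if_cong)
    finally show "(U * U) $$ (i, j) = 1\<^sub>m n $$ (i, j)"
      using ij by (simp add: \<delta>_def)
  qed (use carrier in auto)
  then have "Determinant.det U * Determinant.det U = 1"
    using det_mult[OF carrier(1) carrier(1)] by simp
  then have "\<bar>Determinant.det U\<bar> = 1"
    using square_eq_1_iff by fastforce
  moreover have "mat n n (\<lambda>(i, j). G j (f i - w i *\<^sub>R (\<Sum>j<n. w j *\<^sub>R f j))) = U * A"
  proof (rule eq_matI)
    fix i j assume ij: "i < dim_row (U * A)" "j < dim_col (U * A)"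
    then have ij': "i < n" "j < n" using carrier by auto
    have "(U * A) $$ (i, j) = (\<Sum>k<n. \<delta> i k * G j (f k) - w i * (w k * G j (f k)))"
      using ij' by (simp add: U_def A_def scalar_prod_def atLeast0LessThan algebra_simps)
    also have "\<dots> = G j (f i) - w i * (\<Sum>k<n. w k * G j (f k))"
      using ij' by (simp add: sum_subtractf sum_distrib_left \<delta>_def if_distrib[of "\<lambda>x. x * _"] cong: if_cong)
    also have "\<dots> = G j (f i - w i *\<^sub>R (\<Sum>j<n. w j *\<^sub>R f j))"
      using lin[OF ij'(2)] by (simp add: linear_diff linear_cmul linear_sum mult.assoc sum_distrib_left)
    finally show "mat n n (\<lambda>(i, j). G j (f i - w i *\<^sub>R (\<Sum>j<n. w j *\<^sub>R f j))) $$ (i, j) = (U * A) $$ (i, j)"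
      using ij' by simp
  qed (use carrier in auto)
  ultimately show ?thesis
    using det_mult[OF carrier] by (simp add: gdet_def A_def abs_mult)
qed

text \<open>The reflection that interchanges the \<open>m\<close>-th unit vector with
  \<open>a\<close>. Its normal direction is \<open>e_m - a\<close>, which vanishes in the
  coordinates below \<open>m\<close>, so the vectors already treated stay fixed.\<close>

lemma upper2_rotate:
  fixes f :: "nat \<Rightarrow> 'v::real_normed_vector"
  assumes f: "upper2 n f" and m: "m < n" and a: "(\<Sum>j<n. (a j)\<^sup>2) = 1" "\<And>j. j < m \<Longrightarrow> a j = 0"
    and lin: "\<And>j. j < n \<Longrightarrow> linear (G j)"
  shows "\<exists>f'. upper2 n f' \<and> \<bar>gdet n G f'\<bar> = \<bar>gdet n G f\<bar> \<and> (\<forall>i<m. f' i = f i)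
    \<and> f' m = (\<Sum>j<n. a j *\<^sub>R f j)"
proof (cases "a m = 1")
  case True
  have "(\<Sum>j\<in>{..<n} - {m}. (a j)\<^sup>2) = 0"
    using sum.remove[of "{..<n}" m "\<lambda>j. (a j)\<^sup>2"] m a(1) True by simp
  then have *: "a j = 0" if "j < n" "j \<noteq> m" for j
    using that by (subst (asm) sum_nonneg_eq_0_iff) auto
  have "(\<Sum>j<n. a j *\<^sub>R f j) = (\<Sum>j<n. if j = m then f j else 0)"
    by (rule sum.cong) (auto simp: * True)
  then show ?thesis using f m by (intro exI[of _ f]) simp
next
  case False
  have "(a m)\<^sup>2 \<le> 1"
    using member_le_sum[of m "{..<n}" "\<lambda>j. (a j)\<^sup>2"] m a(1) by simp
  then have am: "1 - a m > 0" using False by (simp add: abs_square_le_1 abs_le_iff)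
  \<comment> \<open>The vector \<open>e_m - a\<close> has squared length
    \<open>2 * (1 - a m)\<close>; dividing by \<open>sqrt (1 - a m)\<close> gives the length
    required of \<open>w\<close>.\<close>
  define e where "e = (\<lambda>j. if j = m then 1 - a j else - a j)"
  define w where "w = (\<lambda>j. e j / sqrt (1 - a m))"
  have "(\<Sum>j<n. (e j)\<^sup>2) = (\<Sum>j<n. (a j)\<^sup>2 + (if j = m then 1 - 2 * a m else 0))"
    by (rule sum.cong) (auto simp: e_def power2_eq_square algebra_simps)
  also have "\<dots> = 2 * (1 - a m)" using m a(1) by (simp add: sum.distrib)
  finally have "(\<Sum>j<n. (w j)\<^sup>2) = 2"
    using am by (simp add: w_def power_divide sum_divide_distrib[symmetric] field_simps)
  note w2 = this
  define f' where "f' = (\<lambda>i. f i - w i *\<^sub>R (\<Sum>j<n. w j *\<^sub>R f j))"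
  have "f' i = f i" if "i < m" for i
    using that a(2)[of i] by (simp add: f'_def w_def e_def)
  moreover have "f' m = (\<Sum>j<n. a j *\<^sub>R f j)"
  proof -
    have "w m * w j = e j" for j
      using am by (simp add: w_def e_def[of] field_simps)
    then have "f' m = f m - (\<Sum>j<n. e j *\<^sub>R f j)"
      by (simp add: f'_def scaleR_sum_right)
    also have "(\<Sum>j<n. e j *\<^sub>R f j) = (\<Sum>j<n. (if j = m then f j else 0) - a j *\<^sub>R f j)"
      by (rule sum.cong) (auto simp: e_def algebra_simps)
    also have "\<dots> = f m - (\<Sum>j<n. a j *\<^sub>R f j)" using m by (simp add: sum_subtractf)
    finally show ?thesis by simp
  qed
  ultimately show ?thesis
    using upper2_reflect[OF f w2] gdet_reflect[of n G, OF lin w2] by (intro exI[of _ f']) (simp add: f'_def)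
qed

lemma upper2_norm_le_1:
  assumes "upper2 n f" "i < n" shows "norm (f i) \<le> 1"
proof -
  have "(norm (\<Sum>j<n. (if j = i then 1 else 0) *\<^sub>R f j))\<^sup>2 \<le> (\<Sum>j<n. (if j = i then 1 else 0 :: real)\<^sup>2)"
    using assms(1) unfolding upper2_def by (rule spec)
  also have "(\<Sum>j<n. (if j = i then 1 else 0) *\<^sub>R f j) = (\<Sum>j<n. if j = i then f j else 0)"
    by (rule sum.cong) auto
  also have "(\<Sum>j<n. (if j = i then 1 else 0 :: real)\<^sup>2) = (\<Sum>j<n. if j = i then 1 else 0)"
    by (rule sum.cong) auto
  finally show ?thesis using assms(2) by (simp add: abs_square_le_1)
qed

text \<open>By Cauchy-Schwarz a small multiple of any family has the upper estimate, and the
  determinant only changes by a nonzero factor.\<close>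

lemma upper2_exists_nondegenerate:
  fixes v :: "nat \<Rightarrow> 'v::real_normed_vector"
  assumes lin: "\<And>j. j < n \<Longrightarrow> linear (G j)" and v: "gdet n G v \<noteq> 0"
  shows "\<exists>f. upper2 n f \<and> gdet n G f \<noteq> 0"
proof -
  define R where "R = L2_set (\<lambda>i. norm (v i)) {..<n}"
  define t where "t = 1 / (1 + R)"
  have R: "R \<ge> 0" by (simp add: R_def)
  then have t: "t > 0" "t * R \<le> 1" by (simp_all add: t_def field_simps)
  have "(norm (\<Sum>i<n. a i *\<^sub>R (t *\<^sub>R v i)))\<^sup>2 \<le> (\<Sum>i<n. (a i)\<^sup>2)" for a
  proof -
    have "norm (\<Sum>i<n. a i *\<^sub>R (t *\<^sub>R v i)) = t * norm (\<Sum>i<n. a i *\<^sub>R v i)"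
      using t by (simp only: scaleR_left_commute[of _ t] scaleR_sum_right[symmetric] norm_scaleR abs_of_pos)
    also have "\<dots> \<le> t * (\<Sum>i<n. \<bar>a i\<bar> * \<bar>norm (v i)\<bar>)"
      using t by (intro mult_left_mono order_trans[OF norm_sum]) auto
    also have "\<dots> \<le> t * (L2_set a {..<n} * R)"
      unfolding R_def using t by (intro mult_left_mono L2_set_mult_ineq) auto
    also have "\<dots> = (t * R) * L2_set a {..<n}" by simp
    also have "\<dots> \<le> 1 * L2_set a {..<n}" using t by (intro mult_right_mono) auto
    finally have "(norm (\<Sum>i<n. a i *\<^sub>R (t *\<^sub>R v i)))\<^sup>2 \<le> (L2_set a {..<n})\<^sup>2"
      by (intro power_mono) auto
    then show ?thesis by (simp add: L2_set_def sum_nonneg)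
  qed
  then have "upper2 n (\<lambda>i. t *\<^sub>R v i)" by (simp add: upper2_def)
  moreover have "gdet n G (\<lambda>i. t *\<^sub>R v i) \<noteq> 0"
    using gdet_scaleR[of n G "\<lambda>_. t" v, OF lin] t v by simp
  ultimately show ?thesis by blast
qed

text \<open>A family with an upper 2-estimate that almost maximises the determinant is rotated until
  its first half consists of long vectors: if all vectors orthogonal to the first \<open>m\<close> coordinates
  were short, doubling these coordinates would increase the determinant too much.\<close>

lemma dvoretzky_rogers_even:
  fixes v :: "nat \<Rightarrow> 'v::real_normed_vector"
  assumes h: "h \<ge> 3" and n: "n = 2 * h" and G: "\<And>j. j < n \<Longrightarrow> bounded_linear (G j)"
    and v: "gdet n G v \<noteq> 0"
  shows "\<exists>f :: nat \<Rightarrow> 'v. upper2 n f \<and> (\<forall>i<h. 1 / 4 \<le> norm (f i))"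
proof -
  have lin: "linear (G j)" if "j < n" for j using G[OF that] by (rule bounded_linear.linear)
  define S where "S = (\<lambda>f. \<bar>gdet n G f\<bar>) ` {f. upper2 n f}"
  obtain B where B: "\<And>f. (\<forall>i<n. norm (f i) \<le> 1) \<Longrightarrow> \<bar>gdet n G f\<bar> \<le> B"
    using gdet_bounded[of n G, OF G] by blast
  have bdd: "bdd_above S"
    unfolding S_def by (rule bdd_aboveI2[where M = B]) (use B upper2_norm_le_1 in blast)
  obtain f0 :: "nat \<Rightarrow> 'v" where f0: "upper2 n f0" "gdet n G f0 \<noteq> 0"
    using upper2_exists_nondegenerate[of n G, OF lin v] by blast
  have le_Sup: "\<bar>gdet n G f\<bar> \<le> Sup S" if "upper2 n f" for f
    by (rule cSup_upper[OF _ bdd]) (use that in \<open>auto simp: S_def\<close>)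
  have pos: "Sup S > 0" using le_Sup[OF f0(1)] f0(2) by auto
  \<comment> \<open>The supremum need not be attained, so only more than half of it is asked for.
    Rotations preserve the determinant, hence this bound survives the induction.\<close>
  have "\<exists>f :: nat \<Rightarrow> 'v. upper2 n f \<and> \<bar>gdet n G f\<bar> > Sup S / 2 \<and> (\<forall>i<m. 1 / 4 \<le> norm (f i))" if "m \<le> h" for m
    using that
  proof (induction m)
    case 0
    have "Sup S / 2 < Sup S" using pos by simp
    then obtain s where "s \<in> S" "Sup S / 2 < s"
      using less_cSup_iff[of S "Sup S / 2"] bdd f0(1) unfolding S_def by blast
    then show ?case by (auto simp: S_def)
  next
    case (Suc m)
    then obtain f where f: "upper2 n f" "\<bar>gdet n G f\<bar> > Sup S / 2" "\<forall>i<m. 1 / 4 \<le> norm (f i)" by auto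
    have mn: "m < n" using Suc.prems h n by simp
    show ?case
    proof (cases "\<exists>a. (\<Sum>j<n. (a j)\<^sup>2) = 1 \<and> (\<forall>j<m. a j = 0) \<and> norm (\<Sum>j<n. a j *\<^sub>R f j) \<ge> 1 / 4")
      case True
      then obtain a where a: "(\<Sum>j<n. (a j)\<^sup>2) = 1" "\<And>j. j < m \<Longrightarrow> a j = 0"
        "norm (\<Sum>j<n. a j *\<^sub>R f j) \<ge> 1 / 4" by blast
      obtain f' where f': "upper2 n f'" "\<bar>gdet n G f'\<bar> = \<bar>gdet n G f\<bar>" "\<forall>i<m. f' i = f i"
        "f' m = (\<Sum>j<n. a j *\<^sub>R f j)"
        using upper2_rotate[of n f m a G, OF f(1) mn a(1,2) lin] by blast
      then show ?thesis using f a by (intro exI[of _ f']) (auto simp: less_Suc_eq)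
    next
      case False
      have short: "norm (\<Sum>j<n. a j *\<^sub>R f j) \<le> 1 / 4 * L2_set a {..<n}" if "\<forall>j<m. a j = 0" for a
      proof (cases "L2_set a {..<n} = 0")
        case True
        then have "a j = 0" if "j < n" for j using that by (simp add: L2_set_eq_0_iff)
        then show ?thesis using True by simp
      next
        case F: False
        define r where "r = L2_set a {..<n}"
        have r: "r > 0" using F L2_set_nonneg[of a "{..<n}"] by (simp add: r_def less_le)
        have r2: "r\<^sup>2 = (\<Sum>j<n. (a j)\<^sup>2)" by (simp add: r_def L2_set_def sum_nonneg)
        have "norm (\<Sum>j<n. (a j / r) *\<^sub>R f j) < 1 / 4"
        proof -
          have "(\<Sum>j<n. (a j / r)\<^sup>2) = (\<Sum>j<n. (a j)\<^sup>2) / r\<^sup>2"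
            by (simp add: power_divide sum_divide_distrib)
          then have "(\<Sum>j<n. (a j / r)\<^sup>2) = 1" using r by (simp flip: r2)
          moreover have "\<forall>j<m. a j / r = 0" using that by simp
          ultimately have "\<not> 1 / 4 \<le> norm (\<Sum>j<n. (a j / r) *\<^sub>R f j)"
            using spec[OF False[unfolded not_ex], of "\<lambda>j. a j / r"] by blast
          then show ?thesis by simp
        qed
        also have "(\<Sum>j<n. (a j / r) *\<^sub>R f j) = (1 / r) *\<^sub>R (\<Sum>j<n. a j *\<^sub>R f j)"
          by (simp add: scaleR_sum_right)
        finally show ?thesis using r by (simp add: r_def[symmetric] field_simps)
      qed
      \<comment> \<open>All coordinates are scaled by 4/5 and those from \<open>m\<close> on are
        doubled as well. With short vectors of norm below 1/4 the upper estimate becomes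
        \<open>4/5 * (1 + 1/4) = 1\<close>, which fixes the constant 4/5.\<close>
      define c where "c = (\<lambda>i. if i < m then 4 / 5 else 8 / 5 :: real)"
      have "upper2 n (\<lambda>i. c i *\<^sub>R f i)"
        unfolding upper2_def
      proof
        fix a :: "nat \<Rightarrow> real"
        define a' where "a' = (\<lambda>i. if i < m then 0 else a i)"
        have "(\<Sum>i<n. a i *\<^sub>R c i *\<^sub>R f i) = (\<Sum>i<n. (4 / 5) *\<^sub>R (a i *\<^sub>R f i + a' i *\<^sub>R f i))"
          by (rule sum.cong) (auto simp: c_def a'_def scaleR_add_right simp flip: scaleR_add_left)
        also have "\<dots> = (4 / 5) *\<^sub>R ((\<Sum>i<n. a i *\<^sub>R f i) + (\<Sum>i<n. a' i *\<^sub>R f i))"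
          by (simp add: scaleR_sum_right[symmetric] sum.distrib)
        finally have "norm (\<Sum>i<n. a i *\<^sub>R c i *\<^sub>R f i)
            \<le> 4 / 5 * (norm (\<Sum>i<n. a i *\<^sub>R f i) + norm (\<Sum>i<n. a' i *\<^sub>R f i))"
          using norm_triangle_ineq[of "\<Sum>i<n. a i *\<^sub>R f i" "\<Sum>i<n. a' i *\<^sub>R f i"] by simp
        also have "norm (\<Sum>i<n. a i *\<^sub>R f i) \<le> L2_set a {..<n}"
          unfolding L2_set_def by (rule real_le_rsqrt) (use f(1) in \<open>simp add: upper2_def\<close>)
        also have "norm (\<Sum>i<n. a' i *\<^sub>R f i) \<le> 1 / 4 * L2_set a' {..<n}"
          by (rule short) (simp add: a'_def)
        also have "L2_set a' {..<n} \<le> L2_set a {..<n}"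
          unfolding L2_set_def by (intro real_sqrt_le_mono sum_mono) (simp add: a'_def)
        finally have "norm (\<Sum>i<n. a i *\<^sub>R c i *\<^sub>R f i) \<le> L2_set a {..<n}" by simp
        then have "(norm (\<Sum>i<n. a i *\<^sub>R c i *\<^sub>R f i))\<^sup>2 \<le> (L2_set a {..<n})\<^sup>2"
          by (intro power_mono) auto
        then show "(norm (\<Sum>i<n. a i *\<^sub>R c i *\<^sub>R f i))\<^sup>2 \<le> (\<Sum>i<n. (a i)\<^sup>2)"
          by (simp add: L2_set_def sum_nonneg)
      qed
      then have "\<bar>gdet n G (\<lambda>i. c i *\<^sub>R f i)\<bar> \<le> Sup S" by (rule le_Sup)
      moreover have "gdet n G (\<lambda>i. c i *\<^sub>R f i) = (\<Prod>i=0..<n. c i) * gdet n G f"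
        by (rule gdet_scaleR[OF lin])
      moreover have "(\<Prod>i=0..<n. c i) \<ge> 2"
      proof -
        \<comment> \<open>The factor 32/25 pairs one 4/5 with one 8/5; its cube exceeds 2, which is
          where \<open>h >= 3\<close> comes from.\<close>
        have "(32 / 25) ^ 3 \<le> (32 / 25 :: real) ^ h" using h by (intro power_increasing) auto
        also have "\<dots> = (4 / 5) ^ h * (8 / 5) ^ (n - h)"
          using n by (simp flip: power_mult_distrib)
        also have "\<dots> = (\<Prod>i=0..<h. 4 / 5) * (\<Prod>i=h..<n. 8 / 5)" by simp
        also have "\<dots> \<le> (\<Prod>i=0..<h. c i) * (\<Prod>i=h..<n. c i)"
          using Suc.prems by (intro mult_mono prod_mono prod_nonneg) (auto simp: c_def)
        also have "\<dots> = (\<Prod>i=0..<n. c i)" using n by (intro prod.atLeastLessThan_concat) auto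
        finally show ?thesis by (simp add: power3_eq_cube)
      qed
      ultimately have "2 * \<bar>gdet n G f\<bar> \<le> Sup S"
        using mult_right_mono[of 2 "\<Prod>i=0..<n. c i" "\<bar>gdet n G f\<bar>"] by (simp add: abs_mult)
      then show ?thesis using f(2) by simp
    qed
  qed
  from this[OF order_refl] show ?thesis by blast
qed

lemma upper2_subfamily:
  assumes "upper2 n f" "m \<le> n" shows "upper2 m f"
  unfolding upper2_def
proof
  fix a :: "nat \<Rightarrow> real"
  define a' where "a' = (\<lambda>i. if i < m then a i else 0)"
  have "(\<Sum>i<m. a i *\<^sub>R f i) = (\<Sum>i<n. a' i *\<^sub>R f i)" "(\<Sum>i<m. (a i)\<^sup>2) = (\<Sum>i<n. (a' i)\<^sup>2)"
    using assms(2) by (auto intro!: sum.mono_neutral_cong_left simp: a'_def split: if_splits)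
  then show "(norm (\<Sum>i<m. a i *\<^sub>R f i))\<^sup>2 \<le> (\<Sum>i<m. (a i)\<^sup>2)"
    using assms(1) by (simp add: upper2_def)
qed

lemma dvoretzky_rogers:
  assumes "\<And>n. \<exists>G (v :: nat \<Rightarrow> 'v::real_normed_vector). (\<forall>j<n. bounded_linear (G j)) \<and> gdet n G v \<noteq> 0"
  shows "\<exists>f :: nat \<Rightarrow> 'v. upper2 n f \<and> (\<forall>i<n. 1 / 4 \<le> norm (f i))"
proof -
  \<comment> \<open>Provides both \<open>h >= 3\<close> and \<open>n <= h\<close>.\<close>
  define h where "h = n + 3"
  obtain G and v :: "nat \<Rightarrow> 'v" where "\<forall>j<2 * h. bounded_linear (G j)" "gdet (2 * h) G v \<noteq> 0"
    using assms by blast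
  then obtain f :: "nat \<Rightarrow> 'v" where "upper2 (2 * h) f" "\<forall>i<h. 1 / 4 \<le> norm (f i)"
    using dvoretzky_rogers_even[of h "2 * h" G v] by (auto simp: h_def)
  then show ?thesis using upper2_subfamily[of "2 * h" f n] by (auto simp: h_def)
qed

text \<open>Half of a biorthogonal system is enough: triangularity with unit diagonal already makes
  the determinant 1, and no control of norms is required.\<close>

lemma triangular_functionals:
  assumes "\<forall>S :: 'v::real_normed_vector set. finite S \<longrightarrow> span S \<noteq> UNIV"
  shows "\<exists>(b :: nat \<Rightarrow> 'v) g. (\<forall>i<n. bounded_linear (g i) \<and> g i (b i) = (1::real))
    \<and> (\<forall>j<n. \<forall>i<j. g i (b j) = 0)"
proof (induction n)
  case 0
  then show ?case by simp
next
  case (Suc n)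
  then obtain b :: "nat \<Rightarrow> 'v" and g where
    bg: "\<forall>i<n. bounded_linear (g i) \<and> g i (b i) = (1::real)" "\<forall>j<n. \<forall>i<j. g i (b j) = 0" by blast
  have lin: "linear (g i)" if "i < n" for i using bg that bounded_linear.linear by blast
  \<comment> \<open>Correcting by a multiple of \<open>b m\<close> does not disturb the functionals
    \<open>g i\<close> with \<open>i < m\<close>, since these vanish at \<open>b m\<close>.\<close>
  have decomp: "\<exists>y\<in>span (b ` {..<m}). \<forall>i<m. g i (x - y) = 0" if "m \<le> n" for m x
    using that
  proof (induction m)
    case 0
    then show ?case by (auto intro: bexI[of _ 0] simp: span_zero)
  next
    case (Suc m)
    then obtain y where y: "y \<in> span (b ` {..<m})" "\<forall>i<m. g i (x - y) = 0" by auto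
    define y' where "y' = y + g m (x - y) *\<^sub>R b m"
    have "span (b ` {..<m}) \<subseteq> span (b ` {..<Suc m})" by (intro span_mono image_mono) auto
    then have "y' \<in> span (b ` {..<Suc m})"
      unfolding y'_def using y(1) by (intro span_add span_scale span_base[of "b m"]) auto
    moreover have "g i (x - y') = 0" if "i < Suc m" for i
    proof -
      have "g i (x - y') = g i (x - y) - g m (x - y) * g i (b m)"
        using lin[of i] that Suc.prems by (simp add: y'_def linear_diff linear_add linear_cmul)
      then show ?thesis using that y(2) bg Suc.prems by (cases "i = m") auto
    qed
    ultimately show ?case by blast
  qed
  have "span (b ` {..<n}) \<noteq> UNIV" using assms by simp
  then obtain x where x: "x \<notin> span (b ` {..<n})" by blast
  obtain y where y: "y \<in> span (b ` {..<n})" "\<forall>i<n. g i (x - y) = 0" using decomp[of n x] by blast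
  have "x - y \<noteq> 0" using x y(1) by auto
  then obtain f where f: "bounded_linear f" "f (x - y) \<noteq> (0::real)"
    using bounded_functional_nonzero_at by blast
  define f' where "f' = (\<lambda>z. f z / f (x - y))"
  have "bounded_linear f'" unfolding f'_def by (rule bounded_linear_divide[THEN bounded_linear_compose]) (rule f)
  then show ?case
    using bg y f
    by (intro exI[of _ "b(n := x - y)"] exI[of _ "g(n := f')"]) (auto simp: less_Suc_eq f'_def)
qed

lemma dvoretzky_rogers_space:
  assumes "\<forall>S :: 'v::real_normed_vector set. finite S \<longrightarrow> span S \<noteq> UNIV"
  shows "\<exists>f :: nat \<Rightarrow> 'v. upper2 n f \<and> (\<forall>i<n. 1 / 4 \<le> norm (f i))"
proof (rule dvoretzky_rogers)
  fix n
  obtain b :: "nat \<Rightarrow> 'v" and g where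
    bg: "\<forall>i<n. bounded_linear (g i) \<and> g i (b i) = (1::real)" "\<forall>j<n. \<forall>i<j. g i (b j) = 0"
    using triangular_functionals[OF assms] by blast
  have "gdet n g b = prod_list (diag_mat (mat n n (\<lambda>(i, j). g j (b i))))"
    unfolding gdet_def by (rule det_upper_triangular[where n = n]) (use bg in \<open>auto simp: upper_triangular_def\<close>)
  also have "diag_mat (mat n n (\<lambda>(i, j). g j (b i))) = replicate n 1"
    using bg by (auto simp: diag_mat_def intro!: nth_equalityI)
  finally show "\<exists>G (v :: nat \<Rightarrow> 'v). (\<forall>j<n. bounded_linear (G j)) \<and> gdet n G v \<noteq> 0"
    using bg(1) by (intro exI[of _ g] exI[of _ b]) auto
qed

text \<open>In the dual the roles are exchanged: the \<open>g i\<close> become the vectors and the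
  evaluations at the \<open>b j\<close> the functionals, so the triangular matrix is
  transposed.\<close>

lemma dvoretzky_rogers_dual:
  assumes "\<forall>S :: 'v::real_normed_vector set. finite S \<longrightarrow> span S \<noteq> UNIV"
  shows "\<exists>f :: nat \<Rightarrow> ('v \<Rightarrow>\<^sub>L real). upper2 n f \<and> (\<forall>i<n. 1 / 4 \<le> norm (f i))"
proof (rule dvoretzky_rogers)
  fix n
  obtain b :: "nat \<Rightarrow> 'v" and g where
    bg: "\<forall>i<n. bounded_linear (g i) \<and> g i (b i) = (1::real)" "\<forall>j<n. \<forall>i<j. g i (b j) = 0"
    using triangular_functionals[OF assms] by blast
  define G where "G = (\<lambda>j (f :: 'v \<Rightarrow>\<^sub>L real). blinfun_apply f (b j))"
  define v where "v = (\<lambda>i. Blinfun (g i))"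
  have v: "blinfun_apply (v i) = g i" if "i < n" for i
    using bg(1) that by (simp add: v_def bounded_linear_Blinfun_apply)
  have "gdet n G v = prod_list (diag_mat (mat n n (\<lambda>(i, j). G j (v i))))"
    unfolding gdet_def by (rule det_lower_triangular[where n = n]) (use bg v in \<open>auto simp: G_def\<close>)
  also have "diag_mat (mat n n (\<lambda>(i, j). G j (v i))) = replicate n 1"
    using bg v by (auto simp: diag_mat_def G_def intro!: nth_equalityI)
  finally show "\<exists>G (v :: nat \<Rightarrow> ('v \<Rightarrow>\<^sub>L real)). (\<forall>j<n. bounded_linear (G j)) \<and> gdet n G v \<noteq> 0"
    by (intro exI[of _ G] exI[of _ v]) (auto simp: G_def blinfun.bounded_linear_left)
qed

section \<open>Summing norms and finite rank operators\<close>

definition pnorm :: "real \<Rightarrow> nat \<Rightarrow> (nat \<Rightarrow> 'v::real_normed_vector) \<Rightarrow> real" where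
  "pnorm p m y = (\<Sum>i<m. norm (y i) powr p) powr (1 / p)"

lemma pnorm_nonneg [simp]: "pnorm p m y \<ge> 0"
  by (simp add: pnorm_def)

lemma pnorm_powr: "p \<ge> 1 \<Longrightarrow> pnorm p m y powr p = (\<Sum>i<m. norm (y i) powr p)"
  by (simp add: pnorm_def powr_powr sum_nonneg)

lemma pnorm_mono:
  assumes "p \<ge> 1" "c \<ge> 0" "\<And>i. i < m \<Longrightarrow> norm (y i) \<le> c * norm (z i)"
  shows "pnorm p m y \<le> c * pnorm p m z"
proof -
  have "(\<Sum>i<m. norm (y i) powr p) \<le> (\<Sum>i<m. (c * norm (z i)) powr p)"
    using assms by (intro sum_mono powr_mono2) auto
  also have "\<dots> = c powr p * (\<Sum>i<m. norm (z i) powr p)"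
    using assms(2) by (simp add: powr_mult sum_distrib_left)
  finally have "pnorm p m y \<le> (c powr p * (\<Sum>i<m. norm (z i) powr p)) powr (1 / p)"
    unfolding pnorm_def using assms(1) by (intro powr_mono2) (auto intro: sum_nonneg)
  also have "\<dots> = c * pnorm p m z"
    using assms(1,2) by (simp add: powr_mult sum_nonneg powr_powr pnorm_def)
  finally show ?thesis .
qed

lemma pnorm_cmult:
  assumes "p \<ge> 1" "c \<ge> 0" "\<And>i. i < m \<Longrightarrow> norm (y i) = c * norm (z i)"
  shows "pnorm p m y = c * pnorm p m z"
proof (cases "c = 0")
  case True
  have "pnorm p m y \<le> c * pnorm p m z" using assms by (intro pnorm_mono) auto
  then show ?thesis using True pnorm_nonneg[of p m y] by simp
next
  case False
  have "pnorm p m z \<le> (1 / c) * pnorm p m y"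
    using assms False by (intro pnorm_mono) (auto simp: field_simps)
  then have "c * pnorm p m z \<le> pnorm p m y" using False assms(2) by (simp add: field_simps)
  moreover have "pnorm p m y \<le> c * pnorm p m z" using assms by (intro pnorm_mono) auto
  ultimately show ?thesis by simp
qed

lemma pnorm_eq_0:
  assumes "p \<ge> 1" "pnorm p m y = 0" "i < m" shows "y i = 0"
proof -
  have "(\<Sum>i<m. norm (y i) powr p) = 0" using pnorm_powr[OF assms(1), of m y] assms(1,2) by simp
  then have "norm (y i) powr p = 0" using assms(3) by (subst (asm) sum_nonneg_eq_0_iff) auto
  then show ?thesis using assms(1) by simp
qed

text \<open>When one argument is 0 the inequality reduces to \<open>t powr p <= t\<close> on the
  unit interval; otherwise it is convexity on the positive reals.\<close>

lemma powr_convex_nonneg: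
  assumes "p \<ge> 1" "x \<ge> 0" "y \<ge> 0" "0 \<le> t" "t \<le> (1::real)"
  shows "((1 - t) * x + t * y) powr p \<le> (1 - t) * x powr p + t * y powr p"
proof -
  have le: "s powr p \<le> s" if "0 \<le> s" "s \<le> 1" for s
    using powr_mono'[of 1 p s] that assms(1) by simp
  show ?thesis
  proof (cases "x = 0 \<or> y = 0")
    case True
    then show ?thesis
    proof
      assume "x = 0"
      then show ?thesis
        using assms le[of t] by (simp add: powr_mult mult_right_mono)
    next
      assume "y = 0"
      then show ?thesis
        using assms le[of "1 - t"] by (simp add: powr_mult mult_right_mono)
    qed
  next
    case False
    then show ?thesis
      using convex_onD[OF powr_convex[OF assms(1)] assms(4,5), of x y] assms(2,3) by simp
  qed
qed

text \<open>Minkowski's inequality: both families are normalised, and convexity of the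
  \<open>p\<close>-th power is applied with the weights \<open>A / (A + B)\<close> and
  \<open>B / (A + B)\<close>.\<close>

lemma pnorm_triangle:
  fixes y z :: "nat \<Rightarrow> 'v::real_normed_vector"
  assumes p: "p \<ge> 1"
  shows "pnorm p m (\<lambda>i. y i + z i) \<le> pnorm p m y + pnorm p m z"
proof -
  define A B where "A = pnorm p m y" and "B = pnorm p m z"
  show ?thesis
  proof (cases "A = 0 \<or> B = 0")
    case True
    then show ?thesis
    proof
      assume "A = 0"
      then have "pnorm p m (\<lambda>i. y i + z i) \<le> 1 * pnorm p m z"
        using pnorm_eq_0[OF p, of m y] by (intro pnorm_mono p) (auto simp: A_def)
      then show ?thesis using \<open>A = 0\<close> by (simp add: A_def)
    next
      assume "B = 0"
      then have "pnorm p m (\<lambda>i. y i + z i) \<le> 1 * pnorm p m y"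
        using pnorm_eq_0[OF p, of m z] by (intro pnorm_mono p) (auto simp: B_def)
      then show ?thesis using \<open>B = 0\<close> by (simp add: B_def)
    qed
  next
    case False
    then have A: "A > 0" and B: "B > 0"
      using pnorm_nonneg[of p m y] pnorm_nonneg[of p m z] by (auto simp: A_def B_def less_le)
    define t where "t = B / (A + B)"
    have t: "0 \<le> t" "t \<le> 1" "1 - t = A / (A + B)" using A B by (auto simp: t_def field_simps)
    have "norm (y i + z i) powr p \<le> (A + B) powr p * ((1 - t) * (norm (y i) / A) powr p + t * (norm (z i) / B) powr p)"
      for i
    proof -
      have "(1 - t) * (norm (y i) / A) + t * (norm (z i) / B) = (norm (y i) + norm (z i)) / (A + B)"
        using A B unfolding t(3) unfolding t_def by (simp add: add_divide_distrib)
      then have "norm (y i + z i) \<le> (A + B) * ((1 - t) * (norm (y i) / A) + t * (norm (z i) / B))"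
        using A B norm_triangle_ineq[of "y i" "z i"] by simp
      then have "norm (y i + z i) powr p \<le> ((A + B) * ((1 - t) * (norm (y i) / A) + t * (norm (z i) / B))) powr p"
        using p by (intro powr_mono2) auto
      also have "\<dots> = (A + B) powr p * ((1 - t) * (norm (y i) / A) + t * (norm (z i) / B)) powr p"
        using A B t by (intro powr_mult) 
      also have "\<dots> \<le> (A + B) powr p * ((1 - t) * (norm (y i) / A) powr p + t * (norm (z i) / B) powr p)"
        using A B t p by (intro mult_left_mono powr_convex_nonneg) auto
      finally show ?thesis .
    qed
    then have "(\<Sum>i<m. norm (y i + z i) powr p)
        \<le> (\<Sum>i<m. (A + B) powr p * ((1 - t) * (norm (y i) / A) powr p + t * (norm (z i) / B) powr p))"
      by (intro sum_mono) auto
    also have "\<dots> = (A + B) powr p * ((1 - t) * ((\<Sum>i<m. norm (y i) powr p) / A powr p)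
        + t * ((\<Sum>i<m. norm (z i) powr p) / B powr p))"
      using A B by (simp add: sum.distrib powr_divide flip: sum_distrib_left sum_divide_distrib)
    also have "\<dots> = (A + B) powr p"
      using A B unfolding pnorm_powr[OF p, symmetric] A_def[symmetric] B_def[symmetric] by simp
    finally have "pnorm p m (\<lambda>i. y i + z i) \<le> ((A + B) powr p) powr (1 / p)"
      unfolding pnorm_def using p by (intro powr_mono2) (auto intro: sum_nonneg)
    then show ?thesis using A B p by (simp add: powr_powr A_def B_def)
  qed
qed

lemma pnorm_zero [simp]: "pnorm p m (\<lambda>i. 0) = 0"
  by (simp add: pnorm_def)

lemma pnorm_sum:
  assumes "p \<ge> 1" "finite I"
  shows "pnorm p m (\<lambda>i. \<Sum>j\<in>I. y j i) \<le> (\<Sum>j\<in>I. pnorm p m (y j))"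
  using assms(2)
proof induction
  case (insert j I)
  then show ?case
    using pnorm_triangle[OF assms(1), of m "y j" "\<lambda>i. \<Sum>j\<in>I. y j i"] by simp
qed simp

text \<open>The weak \<open>p\<close>-norm of a finite family; \<open>p\<close>-summing operators
  bound strong norms of images by weak norms.\<close>

definition wnorm ::
    "real \<Rightarrow> ('k::{real_normed_field,euclidean_space} \<Rightarrow> 'a::banach \<Rightarrow> 'a) \<Rightarrow> nat \<Rightarrow> (nat \<Rightarrow> 'a) \<Rightarrow> real" where
  "wnorm p s m x = (SUP \<psi>\<in>dual_ball s. pnorm p m (\<lambda>i. \<psi> (x i)))"

lemma summing_ops_iff:
  "T \<in> summing_ops p sE sF \<longleftrightarrow> T \<in> bounded_ops sE sF
     \<and> (\<exists>C. \<forall>m x. pnorm p m (\<lambda>i. blinfun_apply T (x i)) \<le> C * wnorm p sE m x)"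
  by (simp add: summing_ops_def pnorm_def wnorm_def)

locale kbanach_pair = E: kbanach sE + F: kbanach sF
  for sE :: "'k::{real_normed_field,euclidean_space} \<Rightarrow> 'a::banach \<Rightarrow> 'a"
    and sF :: "'k \<Rightarrow> 'b::banach \<Rightarrow> 'b"

context kbanach
begin

lemma linear_functional_iff:
  "Vector_Spaces.linear scale (*) \<phi> \<longleftrightarrow>
     (\<forall>x y. \<phi> (x + y) = \<phi> x + \<phi> y) \<and> (\<forall>c x. \<phi> (scale c x) = c * \<phi> x)"
proof -
  have "vector_space ((*) :: 'k \<Rightarrow> 'k \<Rightarrow> 'k)"
    by unfold_locales (simp_all add: algebra_simps)
  then show ?thesis
    using vector_space_axioms
    by (auto simp: Vector_Spaces.linear_iff)
qed

lemma dual_ball_iff: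
  "\<psi> \<in> dual_ball scale \<longleftrightarrow> (\<forall>x y. \<psi> (x + y) = \<psi> x + \<psi> y)
     \<and> (\<forall>c x. \<psi> (scale c x) = c * \<psi> x) \<and> (\<forall>x. norm (\<psi> x) \<le> norm x)"
  by (simp add: dual_ball_def linear_functional_iff)

lemma zero_in_dual_ball: "(\<lambda>x. 0) \<in> dual_ball scale"
  by (simp add: dual_ball_iff)

lemma wnorm_bdd:
  assumes "p \<ge> 1"
  shows "bdd_above ((\<lambda>\<psi>. pnorm p m (\<lambda>i. \<psi> (x i))) ` dual_ball scale)"
proof (rule bdd_aboveI2)
  fix \<psi> assume "\<psi> \<in> dual_ball scale"
  then have "pnorm p m (\<lambda>i. \<psi> (x i)) \<le> 1 * pnorm p m x"
    by (intro pnorm_mono assms) (auto simp: dual_ball_iff)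
  then show "pnorm p m (\<lambda>i. \<psi> (x i)) \<le> pnorm p m x" by simp
qed

lemma wnorm_upper:
  "p \<ge> 1 \<Longrightarrow> \<psi> \<in> dual_ball scale \<Longrightarrow> pnorm p m (\<lambda>i. \<psi> (x i)) \<le> wnorm p scale m x"
  unfolding wnorm_def by (rule cSUP_upper[OF _ wnorm_bdd])

lemma wnorm_nonneg: "p \<ge> 1 \<Longrightarrow> wnorm p scale m x \<ge> 0"
  using wnorm_upper[OF _ zero_in_dual_ball, of p m x] by simp

lemma wnorm_less_obtain:
  assumes "p \<ge> 1" "c < wnorm p scale m x"
  obtains \<psi> where "\<psi> \<in> dual_ball scale" "c < pnorm p m (\<lambda>i. \<psi> (x i))"
proof -
  have "dual_ball scale \<noteq> {}" using zero_in_dual_ball by blast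
  then have "\<exists>\<psi>\<in>dual_ball scale. c < pnorm p m (\<lambda>i. \<psi> (x i))"
    using assms(2) less_cSUP_iff[OF _ wnorm_bdd[OF assms(1)]] unfolding wnorm_def by blast
  then show ?thesis using that by blast
qed

lemma norm_functional_le_wnorm:
  assumes p: "p \<ge> 1" and \<phi>: "Vector_Spaces.linear scale (*) \<phi>" and B: "\<And>x. norm (\<phi> x) \<le> B * norm x" "B > 0"
  shows "pnorm p m (\<lambda>i. \<phi> (x i)) \<le> B * wnorm p scale m x"
proof -
  define \<psi> where "\<psi> = (\<lambda>x. \<phi> x / of_real B)"
  have "norm (\<psi> x) \<le> norm x" for x
    using B(1)[of x] B(2) by (simp add: \<psi>_def norm_divide pos_divide_le_eq mult.commute)
  then have "\<psi> \<in> dual_ball scale"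
    using \<phi> by (simp add: dual_ball_iff linear_functional_iff \<psi>_def add_divide_distrib)
  then have "pnorm p m (\<lambda>i. \<psi> (x i)) \<le> wnorm p scale m x" by (rule wnorm_upper[OF p])
  moreover have "pnorm p m (\<lambda>i. \<phi> (x i)) = B * pnorm p m (\<lambda>i. \<psi> (x i))"
    using B(2) by (intro pnorm_cmult p) (auto simp: \<psi>_def norm_divide)
  ultimately show ?thesis using B(2) by simp
qed

lemma bounded_linear_scale_left: "bounded_linear (\<lambda>c. scale c y)"
proof (rule bounded_linear_intro[where K = "norm y"])
  show "scale (c + d) y = scale c y + scale d y" for c d by (rule scale_left_distrib)
  show "scale (r *\<^sub>R c) y = r *\<^sub>R scale c y" for r c
    by (simp only: scaleR_conv_of_real scale_scale[symmetric] scale_of_real)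
  show "norm (scale c y) \<le> norm c * norm y" for c by (simp add: norm_scale)
qed

lemma linear_functional_scaleR:
  "Vector_Spaces.linear scale (*) \<phi> \<Longrightarrow> \<phi> (r *\<^sub>R x) = r *\<^sub>R \<phi> x"
  using scale_of_real[of r x] by (metis linear_functional_iff scaleR_conv_of_real)

end

section \<open>Finite rank operators and their operator norm limits\<close>

context kbanach_pair
begin

text \<open>Generation by rank one summands lets compactness and summability be proved by induction.
  The new operator \<open>S\<close> is described by its values, so that a rank one summand need not
  be packed as an element of the operator type.\<close>

inductive_set fin_ops :: "('a \<Rightarrow>\<^sub>L 'b) set" where
  zero: "0 \<in> fin_ops"
| add: "\<lbrakk>T \<in> fin_ops; Vector_Spaces.linear sE (*) \<phi>; \<And>x. norm (\<phi> x) \<le> B * norm x;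
    \<And>x. blinfun_apply S x = blinfun_apply T x + sF (\<phi> x) y\<rbrakk> \<Longrightarrow> S \<in> fin_ops"

lemma fin_ops_add: "S \<in> fin_ops \<Longrightarrow> T \<in> fin_ops \<Longrightarrow> T + S \<in> fin_ops"
proof (induction rule: fin_ops.induct)
  case (add S' \<phi> B S y)
  show ?case
    by (rule fin_ops.add[of "T + S'" \<phi> B _ y]) (use add in \<open>auto simp: blinfun.add_left add.assoc\<close>)
qed simp

lemma fin_ops_op_scale: "T \<in> fin_ops \<Longrightarrow> op_scale sF c T \<in> fin_ops"
proof (induction rule: fin_ops.induct)
  case zero
  have "op_scale sF c 0 = (0 :: 'a \<Rightarrow>\<^sub>L 'b)"
    by (rule blinfun_eqI) (simp add: F.op_scale_apply)
  then show ?case by (simp add: fin_ops.zero)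
next
  case (add T \<phi> B S y)
  show ?case
    by (rule fin_ops.add[of "op_scale sF c T" \<phi> B _ "sF c y"])
      (use add in \<open>auto simp: F.op_scale_apply F.scale_right_distrib mult.commute\<close>)
qed

lemma op_scale_of_real: "op_scale sF (of_real r) T = r *\<^sub>R (T :: 'a \<Rightarrow>\<^sub>L 'b)"
  by (rule blinfun_eqI) (simp only: F.op_scale_apply F.scale_of_real blinfun.scaleR_left)

lemma fin_ops_scaleR: "T \<in> fin_ops \<Longrightarrow> r *\<^sub>R T \<in> fin_ops"
  using fin_ops_op_scale[of T "of_real r"] by (simp add: op_scale_of_real)

lemma fin_ops_sum:
  "(\<And>j. j \<in> I \<Longrightarrow> T j \<in> fin_ops) \<Longrightarrow> (\<Sum>j\<in>I. T j) \<in> fin_ops"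
proof (induction I rule: infinite_finite_induct)
  case (insert j I)
  then show ?case using fin_ops_add[of "\<Sum>j\<in>I. T j" "T j"] by simp
qed (auto simp: fin_ops.zero)

lemma fin_ops_finite_sum:
  fixes \<phi> :: "nat \<Rightarrow> 'a \<Rightarrow> 'k"
  assumes "\<And>i. i < n \<Longrightarrow> Vector_Spaces.linear sE (*) (\<phi> i)"
    and "\<And>i x. i < n \<Longrightarrow> norm (\<phi> i x) \<le> B * norm x"
  shows "\<exists>T\<in>fin_ops. \<forall>x. blinfun_apply T x = (\<Sum>i<n. sF (\<phi> i x) (y i))"
  using assms
proof (induction n)
  case 0
  then show ?case using fin_ops.zero by force
next
  case (Suc n)
  then obtain T where T: "T \<in> fin_ops" "\<And>x. blinfun_apply T x = (\<Sum>i<n. sF (\<phi> i x) (y i))"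
    by (metis less_SucI)
  have bl: "bounded_linear (\<phi> n)"
    using Suc.prems(1)[of n] Suc.prems(2)[of n] E.linear_functional_scaleR
    by (intro bounded_linear_intro[where K = B]) (auto simp: E.linear_functional_iff mult.commute)
  have "bounded_linear (\<lambda>x. sF (\<phi> n x) (y n))"
    by (rule bounded_linear_compose[OF F.bounded_linear_scale_left bl])
  then have "bounded_linear (\<lambda>x. blinfun_apply T x + sF (\<phi> n x) (y n))"
    by (intro bounded_linear_add blinfun.bounded_linear_right)
  then have S: "blinfun_apply (Blinfun (\<lambda>x. blinfun_apply T x + sF (\<phi> n x) (y n))) x
      = blinfun_apply T x + sF (\<phi> n x) (y n)" for x
    by (simp add: bounded_linear_Blinfun_apply)
  have "Blinfun (\<lambda>x. blinfun_apply T x + sF (\<phi> n x) (y n)) \<in> fin_ops"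
    by (rule fin_ops.add[OF T(1) _ _ S]) (use Suc.prems in auto)
  then show ?case using S T(2) by (intro bexI) auto
qed

lemma bounded_ops_iff:
  "T \<in> bounded_ops sE sF \<longleftrightarrow> (\<forall>c x. blinfun_apply T (sE c x) = sF c (blinfun_apply T x))"
  using E.vector_space_axioms F.vector_space_axioms
  by (auto simp: bounded_ops_def Vector_Spaces.linear_iff blinfun.add_right)

lemma fin_ops_bounded_ops: "T \<in> fin_ops \<Longrightarrow> T \<in> bounded_ops sE sF"
proof (induction rule: fin_ops.induct)
  case (add T \<phi> B S y)
  then show ?case by (auto simp: bounded_ops_iff E.linear_functional_iff F.scale_right_distrib)
qed (simp add: bounded_ops_iff)

lemma closed_bounded_ops: "closed (bounded_ops sE sF)"
proof -
  have "bounded_ops sE sF = (\<Inter>c. \<Inter>x. {T. blinfun_apply T (sE c x) = sF c (blinfun_apply T x)})"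
    by (auto simp: bounded_ops_iff)
  moreover have "closed {T. blinfun_apply T (sE c x) = sF c (blinfun_apply T x)}" for c x
    by (intro closed_Collect_eq bounded_linear.continuous_on[OF F.bounded_linear_scale] continuous_intros)
  ultimately show ?thesis by (auto intro!: closed_INT)
qed

lemma fin_ops_compact_image: "T \<in> fin_ops \<Longrightarrow> \<exists>K. compact K \<and> blinfun_apply T ` cball 0 1 \<subseteq> K"
proof (induction rule: fin_ops.induct)
  case zero
  show ?case by (rule exI[of _ "{0}"]) auto
next
  case (add T \<phi> B S y)
  then obtain K where K: "compact K" "blinfun_apply T ` cball 0 1 \<subseteq> K" by blast
  define L where "L = (\<lambda>c. sF c y) ` cball 0 \<bar>B\<bar>"
  have "compact L" unfolding L_def
    by (intro compact_continuous_image bounded_linear.continuous_on[OF F.bounded_linear_scale_left] continuous_intros)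
      (simp add: compact_cball)
  then have "compact {a + b |a b. a \<in> K \<and> b \<in> L}" by (rule compact_sums[OF K(1)])
  moreover have "blinfun_apply S ` cball 0 1 \<subseteq> {a + b |a b. a \<in> K \<and> b \<in> L}"
  proof (rule image_subsetI)
    fix x :: 'a assume x: "x \<in> cball 0 1"
    have "norm (\<phi> x) \<le> B * norm x" by (rule add.hyps)
    also have "\<dots> \<le> \<bar>B\<bar> * 1" using x by (intro mult_mono) auto
    finally have "\<phi> x \<in> cball 0 \<bar>B\<bar>" by simp
    then have "sF (\<phi> x) y \<in> L" unfolding L_def by (rule imageI)
    moreover have "blinfun_apply T x \<in> K" using K(2) x by blast
    ultimately show "blinfun_apply S x \<in> {a + b |a b. a \<in> K \<and> b \<in> L}"
      unfolding add.hyps(4)[of x] by blast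
  qed
  ultimately show ?case by blast
qed

lemma closure_fin_ops_compact: "closure fin_ops \<subseteq> compact_ops sE sF"
proof
  fix T assume T: "T \<in> closure fin_ops"
  have "T \<in> bounded_ops sE sF"
    using closure_minimal[OF _ closed_bounded_ops, of fin_ops] fin_ops_bounded_ops T by blast
  moreover have "\<exists>k. finite k \<and> closure (blinfun_apply T ` cball 0 1) \<subseteq> (\<Union>x\<in>k. ball x e)" if "e > 0" for e
  proof -
    have "e / 4 > 0" using that by simp
    then obtain S where S: "S \<in> fin_ops" "norm (S - T) < e / 4"
      using T unfolding closure_approachable dist_norm by blast
    obtain K where K: "compact K" "blinfun_apply S ` cball 0 1 \<subseteq> K"
      using fin_ops_compact_image[OF S(1)] by blast
    obtain k where k: "finite k" "K \<subseteq> (\<Union>x\<in>k. ball x (e / 4))"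
      using K(1) \<open>e / 4 > 0\<close> unfolding compact_eq_totally_bounded by blast
    \<comment> \<open>Closed balls of half the radius are used because they also cover the closure,
      and they lie in the open balls of radius \<open>e\<close>.\<close>
    have "blinfun_apply T ` cball 0 1 \<subseteq> (\<Union>x\<in>k. cball x (e / 2))"
    proof safe
      fix x :: 'a assume x: "x \<in> cball 0 1"
      then obtain z where z: "z \<in> k" "dist z (blinfun_apply S x) < e / 4" using K k by fastforce
      have "norm (blinfun_apply (S - T) x) \<le> norm (S - T) * norm x" by (rule norm_blinfun)
      also have "\<dots> \<le> (e / 4) * 1" using S x that by (intro mult_mono) auto
      finally have "dist (blinfun_apply S x) (blinfun_apply T x) \<le> e / 4"
        by (simp add: dist_norm blinfun.diff_left)
      then have "dist z (blinfun_apply T x) \<le> e / 2"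
        using z dist_triangle[of z "blinfun_apply T x" "blinfun_apply S x"] by simp
      then show "blinfun_apply T x \<in> (\<Union>x\<in>k. cball x (e / 2))" using z by auto
    qed
    then have "closure (blinfun_apply T ` cball 0 1) \<subseteq> (\<Union>x\<in>k. cball x (e / 2))"
      using k by (intro closure_minimal closed_UN) auto
    also have "\<dots> \<subseteq> (\<Union>x\<in>k. ball x e)" using that by fastforce
    finally show ?thesis using k by blast
  qed
  ultimately show "T \<in> compact_ops sE sF"
    by (auto simp: compact_ops_def compact_eq_totally_bounded complete_eq_closed)
qed

lemma fin_ops_summing:
  assumes p: "p \<ge> 1"
  shows "T \<in> fin_ops \<Longrightarrow> \<exists>K\<ge>0. \<forall>m x. pnorm p m (\<lambda>i. blinfun_apply T (x i)) \<le> K * wnorm p sE m x"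
proof (induction rule: fin_ops.induct)
  case zero
  show ?case by (rule exI[of _ 0]) simp
next
  case (add T \<phi> B S y)
  then obtain K where K: "K \<ge> 0" "\<And>m x. pnorm p m (\<lambda>i. blinfun_apply T (x i)) \<le> K * wnorm p sE m x" by blast
  \<comment> \<open>The bound \<open>B\<close> may be zero or negative, whereas
    \<open>norm_functional_le_wnorm\<close> divides by its bound.\<close>
  define B' where "B' = \<bar>B\<bar> + 1"
  have B': "norm (\<phi> x) \<le> B' * norm x" "B' > 0" for x
    using order_trans[OF add.hyps(3)[of x] mult_right_mono[of B B' "norm x"]] by (auto simp: B'_def)
  have "pnorm p m (\<lambda>i. blinfun_apply S (x i)) \<le> (K + norm y * B') * wnorm p sE m x" for m x
  proof -
    have "pnorm p m (\<lambda>i. sF (\<phi> (x i)) y) = norm y * pnorm p m (\<lambda>i. \<phi> (x i))"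
      by (intro pnorm_cmult p) (auto simp: F.norm_scale)
    also have "\<dots> \<le> norm y * (B' * wnorm p sE m x)"
      by (intro mult_left_mono E.norm_functional_le_wnorm p add.hyps B') auto
    finally show ?thesis
      using pnorm_triangle[OF p, of m "\<lambda>i. blinfun_apply T (x i)" "\<lambda>i. sF (\<phi> (x i)) y"] K(2)[of m x]
      by (simp add: add.hyps algebra_simps)
  qed
  then show ?case using K(1) B' by (intro exI[of _ "K + norm y * B'"]) auto
qed

end

section \<open>The gliding hump\<close>

text \<open>Different reals have only finitely many dyadic approximations in common.\<close>

definition reals_code :: "real \<Rightarrow> nat set" where
  "reals_code t = range (\<lambda>n::nat. to_nat (n, \<lfloor>2 ^ n * t\<rfloor>))"

lemma infinite_reals_code: "infinite (reals_code t)"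
proof -
  have "inj (\<lambda>n::nat. to_nat (n, \<lfloor>2 ^ n * t\<rfloor>))" by (auto simp: inj_def)
  then show ?thesis unfolding reals_code_def by (simp add: finite_image_iff)
qed

text \<open>A code carries its precision \<open>n\<close>, so a common element means equal rounding
  at the same precision, which is impossible once \<open>2 ^ n * (t - s) > 1\<close>.\<close>

lemma finite_reals_code_Int:
  assumes "s < t" shows "finite (reals_code s \<inter> reals_code t)"
proof -
  obtain N :: nat where N: "1 / (t - s) < 2 ^ N" using real_arch_pow[of 2] by auto
  have "n < N" if "\<lfloor>2 ^ n * s\<rfloor> = \<lfloor>2 ^ n * t\<rfloor>" for n :: nat
  proof (rule ccontr)
    assume "\<not> n < N"
    then have "(2::real) ^ N \<le> 2 ^ n" by (intro power_increasing) auto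
    then have "1 / (t - s) < 2 ^ n" using N by (rule less_le_trans[rotated])
    then have "1 < 2 ^ n * t - 2 ^ n * s" using assms by (simp add: field_simps)
    then show False using that by linarith
  qed
  then have "reals_code s \<inter> reals_code t \<subseteq> (\<lambda>n::nat. to_nat (n, \<lfloor>2 ^ n * s\<rfloor>)) ` {..<N}"
    by (fastforce simp: reals_code_def)
  then show ?thesis by (rule finite_subset) simp
qed

text \<open>At such an index \<open>k\<close>, a combination of the sums indexed by \<open>I\<close>
  contains \<open>v k\<close> with the coefficient of \<open>t\<close> alone.\<close>

lemma infinite_reals_code_only:
  assumes "finite I" "t \<in> I"
  shows "infinite {k. \<forall>s\<in>I. k \<in> reals_code s \<longleftrightarrow> s = t}"
proof -
  have "finite (reals_code s \<inter> reals_code t)" if "s \<noteq> t" for s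
    using finite_reals_code_Int[of s t] finite_reals_code_Int[of t s] that
    by (cases s t rule: linorder_cases) (auto simp: Int_commute)
  then have "finite (\<Union>s\<in>I - {t}. reals_code s \<inter> reals_code t)"
    using assms(1) by (intro finite_UN_I) auto
  then have "infinite (reals_code t - (\<Union>s\<in>I - {t}. reals_code s \<inter> reals_code t))"
    using infinite_reals_code by (rule Diff_infinite_finite)
  moreover have "reals_code t - (\<Union>s\<in>I - {t}. reals_code s \<inter> reals_code t)
      \<subseteq> {k. \<forall>s\<in>I. k \<in> reals_code s \<longleftrightarrow> s = t}"
    using assms(2) by auto
  ultimately show ?thesis using finite_subset by blast
qed

context kbanach_pair
begin

text \<open>Each \<open>v k\<close> comes with a test family \<open>x k\<close> on which it beats
  the summing constants \<open>K j\<close> of all earlier operators, while it is itself negligible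
  on the earlier test families. Earlier terms are thus controlled by their summing constants and
  later ones by their norms.\<close>

lemma gliding_hump_sequence:
  assumes p: "p \<ge> 1"
    and unbdd: "\<And>C. \<exists>T\<in>fin_ops. norm T \<le> 1 \<and>
      (\<exists>m x. C * wnorm p sE m x < pnorm p m (\<lambda>i. blinfun_apply T (x i)))"
  obtains v m x K where
    "\<And>k. v k \<in> fin_ops" "\<And>k. norm (v k) \<le> (1 / 2) ^ k"
    "\<And>k j. j < k \<Longrightarrow> norm (v k) * pnorm p (m j) (x j) \<le> (1 / 2) ^ k * wnorm p sE (m j) (x j)"
    "\<And>k. K k \<ge> (0::real)"
    "\<And>k n y. pnorm p n (\<lambda>i. blinfun_apply (v k) (y i)) \<le> K k * wnorm p sE n y"
    "\<And>k. wnorm p sE (m k) (x k) > 0"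
    "\<And>k. real (Suc k) * (1 + (\<Sum>j<k. K j)) * wnorm p sE (m k) (x k)
      < pnorm p (m k) (\<lambda>i. blinfun_apply (v k) (x k i))"
proof -
  define P :: "(nat \<Rightarrow> ('a \<Rightarrow>\<^sub>L 'b) \<times> nat \<times> (nat \<Rightarrow> 'a) \<times> real) \<Rightarrow> nat
      \<Rightarrow> ('a \<Rightarrow>\<^sub>L 'b) \<times> nat \<times> (nat \<Rightarrow> 'a) \<times> real \<Rightarrow> bool" where
    "P = (\<lambda>f k (v, m, x, K). v \<in> fin_ops \<and> norm v \<le> (1 / 2) ^ k
      \<and> (\<forall>j<k. norm v * pnorm p (fst (snd (f j))) (fst (snd (snd (f j))))
           \<le> (1 / 2) ^ k * wnorm p sE (fst (snd (f j))) (fst (snd (snd (f j)))))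
      \<and> K \<ge> 0 \<and> (\<forall>n y. pnorm p n (\<lambda>i. blinfun_apply v (y i)) \<le> K * wnorm p sE n y)
      \<and> wnorm p sE m x > 0
      \<and> real (Suc k) * (1 + (\<Sum>j<k. snd (snd (snd (f j))))) * wnorm p sE m x
          < pnorm p m (\<lambda>i. blinfun_apply v (x i)))"
  have "\<exists>f. \<forall>k. P f k (f k)"
  proof (rule dependent_wellorder_choice)
    fix r and f g :: "nat \<Rightarrow> ('a \<Rightarrow>\<^sub>L 'b) \<times> nat \<times> (nat \<Rightarrow> 'a) \<times> real" and k :: nat
    assume "\<And>j. j < k \<Longrightarrow> f j = g j"
    then show "P f k r = P g k r" by (simp add: P_def)
  next
    fix k :: nat and f :: "nat \<Rightarrow> ('a \<Rightarrow>\<^sub>L 'b) \<times> nat \<times> (nat \<Rightarrow> 'a) \<times> real"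
    assume hist: "\<And>j. j < k \<Longrightarrow> P f j (f j)"
    define m where "m = (\<lambda>j. fst (snd (f j)))"
    define x where "x = (\<lambda>j. fst (snd (snd (f j))))"
    define K where "K = (\<lambda>j. snd (snd (snd (f j))))"
    have wpos: "wnorm p sE (m j) (x j) > 0" and Kpos: "K j \<ge> 0" if "j < k" for j
      using hist[OF that] by (auto simp: P_def m_def x_def K_def split: prod.splits)
    \<comment> \<open>The finitely many smallness conditions on the \<open>k\<close>-th operator;
      the summand 1 in the denominators avoids division by zero.\<close>
    define D where "D = insert ((1 / 2) ^ k) ((\<lambda>j. (1 / 2) ^ k * wnorm p sE (m j) (x j) / (1 + pnorm p (m j) (x j))) ` {..<k})"
    define c where "c = Min D"
    have D: "finite D" "D \<noteq> {}" by (auto simp: D_def)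
    have "d > 0" if "d \<in> D" for d
      using that wpos by (auto simp: D_def intro!: divide_pos_pos mult_pos_pos add_pos_nonneg)
    then have c0: "c > 0" unfolding c_def using D by simp
    have c1: "c \<le> (1 / 2) ^ k" unfolding c_def using D by (intro Min_le) (auto simp: D_def)
    have c2: "c * pnorm p (m j) (x j) \<le> (1 / 2) ^ k * wnorm p sE (m j) (x j)" if "j < k" for j
    proof -
      have "c \<le> (1 / 2) ^ k * wnorm p sE (m j) (x j) / (1 + pnorm p (m j) (x j))"
        unfolding c_def using D that by (intro Min_le) (auto simp: D_def)
      then have "c * (1 + pnorm p (m j) (x j)) \<le> (1 / 2) ^ k * wnorm p sE (m j) (x j)"
        by (subst (asm) pos_le_divide_eq) (auto intro: add_pos_nonneg)
      then show ?thesis using c0 by (simp add: algebra_simps)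
    qed
    \<comment> \<open>Division by \<open>c\<close> compensates in advance for shrinking the operator
      by the factor \<open>c\<close>.\<close>
    define C where "C = real (Suc k) * (1 + (\<Sum>j<k. K j)) / c"
    obtain T n y where T: "T \<in> fin_ops" "norm T \<le> 1"
      "C * wnorm p sE n y < pnorm p n (\<lambda>i. blinfun_apply T (y i))"
      using unbdd[of C] by blast
    define v where "v = c *\<^sub>R T"
    have v: "v \<in> fin_ops" unfolding v_def by (rule fin_ops_scaleR[OF T(1)])
    obtain L where L: "L \<ge> 0" "\<And>n y. pnorm p n (\<lambda>i. blinfun_apply v (y i)) \<le> L * wnorm p sE n y"
      using fin_ops_summing[OF p v] by blast
    have vc: "norm v \<le> c" using T(2) c0 by (simp add: v_def mult_left_le)
    have big: "real (Suc k) * (1 + (\<Sum>j<k. K j)) * wnorm p sE n y < pnorm p n (\<lambda>i. blinfun_apply v (y i))"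
    proof -
      have "pnorm p n (\<lambda>i. blinfun_apply v (y i)) = c * pnorm p n (\<lambda>i. blinfun_apply T (y i))"
        using c0 by (intro pnorm_cmult p) (auto simp: v_def blinfun.scaleR_left)
      then show ?thesis using mult_strict_left_mono[OF T(3) c0] c0 by (simp add: C_def)
    qed
    \<comment> \<open>A test family of weak norm 0 would be mapped to 0 by the finite summing norm
      of \<open>v\<close>, against the strict inequality \<open>big\<close>.\<close>
    have "wnorm p sE n y \<noteq> 0"
    proof
      assume 0: "wnorm p sE n y = 0"
      show False using L(2)[of n y] big 0 by simp
    qed
    then have w: "wnorm p sE n y > 0" using E.wnorm_nonneg[OF p, of n y] by simp
    have "norm v * pnorm p (m j) (x j) \<le> (1 / 2) ^ k * wnorm p sE (m j) (x j)" if "j < k" for j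
      by (rule order_trans[OF mult_right_mono[OF vc] c2[OF that]]) simp
    then have "P f k (v, n, y, L)"
      using v vc c1 L w big by (auto simp: P_def m_def x_def K_def)
    then show "\<exists>r. P f k r" by blast
  qed
  then obtain f where f: "\<And>k. P f k (f k)" by blast
  show ?thesis
    by (rule that[of "\<lambda>k. fst (f k)" "\<lambda>k. fst (snd (f k))" "\<lambda>k. fst (snd (snd (f k)))" "\<lambda>k. snd (snd (snd (f k)))"])
      (use f[unfolded P_def case_prod_unfold] in \<open>blast+\<close>)
qed

lemma lineable_of_unbounded:
  assumes p: "p \<ge> 1"
    and unbdd: "\<And>C. \<exists>T\<in>fin_ops. norm T \<le> 1 \<and>
      (\<exists>m x. C * wnorm p sE m x < pnorm p m (\<lambda>i. blinfun_apply T (x i)))"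
  shows "lineable (op_scale sF) (UNIV :: real set) (compact_ops sE sF - summing_ops p sE sF)"
proof -
  obtain v m x K where v: "\<And>k. v k \<in> fin_ops" "\<And>k. norm (v k) \<le> (1 / 2) ^ k"
    and small: "\<And>k j. j < k \<Longrightarrow> norm (v k) * pnorm p (m j) (x j) \<le> (1 / 2) ^ k * wnorm p sE (m j) (x j)"
    and K: "\<And>k. K k \<ge> (0::real)" "\<And>k n y. pnorm p n (\<lambda>i. blinfun_apply (v k) (y i)) \<le> K k * wnorm p sE n y"
    and w: "\<And>k. wnorm p sE (m k) (x k) > 0"
    and big: "\<And>k. real (Suc k) * (1 + (\<Sum>j<k. K j)) * wnorm p sE (m k) (x k)
      < pnorm p (m k) (\<lambda>i. blinfun_apply (v k) (x k i))"
    using gliding_hump_sequence[OF p unbdd] by metis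
  interpret V: vector_space "op_scale sF :: 'k \<Rightarrow> ('a \<Rightarrow>\<^sub>L 'b) \<Rightarrow> _" by (rule F.vector_space_op_scale)
  define u where "u = (\<lambda>A j. if j \<in> A then v j else 0)"
  define T where "T = (\<lambda>A. \<Sum>j. u A j)"
  have u_le: "norm (u A j) \<le> norm (v j)" for A j by (simp add: u_def)
  have summ: "summable (u A)" for A
  proof (rule summable_comparison_test)
    show "\<exists>N. \<forall>n\<ge>N. norm (u A n) \<le> (1 / 2) ^ n" using u_le v(2) order_trans by blast
    show "summable (\<lambda>n. (1 / 2 :: real) ^ n)" by (rule summable_geometric) simp
  qed
  have lim: "(\<lambda>n. \<Sum>j<n. u A j) \<longlonglongrightarrow> T A" for A
    unfolding T_def by (rule summable_LIMSEQ[OF summ])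
  have u_fin: "u A j \<in> fin_ops" for A j using v(1) fin_ops.zero by (simp add: u_def)
  have T_closure: "T A \<in> closure fin_ops" for A
    unfolding closure_sequential using lim[of A] fin_ops_sum[of _ "u A"] u_fin
    by (intro exI[of _ "\<lambda>n. \<Sum>j<n. u A j"]) auto
  \<comment> \<open>On the \<open>k\<close>-th test family the operators with index
    \<open>j > k\<close> contribute at most \<open>(1/2)^j\<close> times its weak norm, and these
    factors sum to at most 1.\<close>
  have tail: "norm (T A - (\<Sum>j<Suc k. u A j)) * pnorm p (m k) (x k) \<le> wnorm p sE (m k) (x k)" for A k
  proof (rule LIMSEQ_le_const2)
    show "(\<lambda>n. norm ((\<Sum>j<n. u A j) - (\<Sum>j<Suc k. u A j)) * pnorm p (m k) (x k))
        \<longlonglongrightarrow> norm (T A - (\<Sum>j<Suc k. u A j)) * pnorm p (m k) (x k)"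
      by (intro tendsto_intros lim)
    have "norm ((\<Sum>j<n. u A j) - (\<Sum>j<Suc k. u A j)) * pnorm p (m k) (x k) \<le> wnorm p sE (m k) (x k)"
      if n: "n \<ge> Suc k" for n
    proof -
      have "(\<Sum>j<n. u A j) - (\<Sum>j<Suc k. u A j) = (\<Sum>j=Suc k..<n. u A j)"
        using n by (metis atLeast0LessThan sum_diff_nat_ivl zero_le)
      then have "norm ((\<Sum>j<n. u A j) - (\<Sum>j<Suc k. u A j)) * pnorm p (m k) (x k)
          \<le> (\<Sum>j=Suc k..<n. norm (v j)) * pnorm p (m k) (x k)"
        using u_le by (intro mult_right_mono) (auto intro!: sum_norm_le)
      also have "\<dots> \<le> (\<Sum>j=Suc k..<n. (1 / 2) ^ j * wnorm p sE (m k) (x k))"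
        unfolding sum_distrib_right by (intro sum_mono small) auto
      also have "\<dots> = (\<Sum>j=Suc k..<n. (1 / 2) ^ j) * wnorm p sE (m k) (x k)"
        by (simp add: sum_distrib_right)
      also have "(\<Sum>j=Suc k..<n. (1 / 2 :: real) ^ j) \<le> 1"
      proof -
        have "(\<Sum>j=Suc k..<n. (1 / 2 :: real) ^ j) \<le> (\<Sum>j=1..<n. (1 / 2) ^ j)"
          by (intro sum_mono2) auto
        also have "\<dots> \<le> 1"
        proof -
          have "(\<Sum>j=1..<n. (1 / 2 :: real) ^ j) = 1 - 2 * (1 / 2) ^ n" if "n \<ge> 1" for n :: nat
            using that by (induction n rule: dec_induct) auto
          then show ?thesis by (cases "n \<ge> 1") auto
        qed
        finally show ?thesis .
      qed
      finally show ?thesis using w[of k] by simp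
    qed
    then show "\<exists>N. \<forall>n\<ge>N. norm ((\<Sum>j<n. u A j) - (\<Sum>j<Suc k. u A j)) * pnorm p (m k) (x k)
        \<le> wnorm p sE (m k) (x k)" by blast
  qed
  \<comment> \<open>Serves twice: as 0 is summing it gives linear independence of the sums, and it
    shows that no nonzero element of their span is summing.\<close>
  have key: "r t = 0" if I: "finite I" "t \<in> I"
    and S: "(\<Sum>s\<in>I. op_scale sF (r s) (T (reals_code s))) \<in> summing_ops p sE sF" for I r t
  proof (rule ccontr)
    assume rt: "r t \<noteq> 0"
    define S where "S = (\<Sum>s\<in>I. op_scale sF (r s) (T (reals_code s)))"
    define M where "M = (\<Sum>s\<in>I. norm (r s))"
    obtain C where C: "\<And>n y. pnorm p n (\<lambda>i. blinfun_apply S (y i)) \<le> C * wnorm p sE n y"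
      using S unfolding summing_ops_iff S_def by blast
    have M: "M \<ge> 0" by (simp add: M_def sum_nonneg)
    \<comment> \<open>Infinitely many indices isolate \<open>t\<close>, so one may be taken beyond
      any bound; this bound is the one contradicted at the end.\<close>
    obtain k where k: "\<forall>s\<in>I. k \<in> reals_code s \<longleftrightarrow> s = t" "(\<bar>C\<bar> + 2 * M) / norm (r t) < real k"
    proof -
      obtain N :: nat where N: "(\<bar>C\<bar> + 2 * M) / norm (r t) < real N" using reals_Archimedean2 by blast
      obtain k where "k \<ge> N" "\<forall>s\<in>I. k \<in> reals_code s \<longleftrightarrow> s = t"
        using infinite_reals_code_only[OF I] unfolding infinite_nat_iff_unbounded_le by blast
      then show ?thesis using that[of k] N by simp
    qed
    let ?w = "wnorm p sE (m k) (x k)"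
    define Q where "Q = (\<lambda>i. \<Sum>s\<in>I. sF (r s) (blinfun_apply (T (reals_code s) - (\<Sum>j<Suc k. u (reals_code s) j)) (x k i)))"
    define R where "R = (\<lambda>i. \<Sum>s\<in>I. sF (r s) (blinfun_apply (\<Sum>j<k. u (reals_code s) j) (x k i)))"
    \<comment> \<open>The combination is cut at \<open>k\<close>: the isolated term, the tails
      \<open>Q\<close> beyond \<open>k\<close>, and the heads \<open>R\<close> below
      \<open>k\<close>.\<close>
    have split: "sF (r t) (blinfun_apply (v k) (x k i)) = blinfun_apply S (x k i) + (- 1) *\<^sub>R (Q i + R i)" for i
    proof -
      have "(\<Sum>s\<in>I. sF (r s) (blinfun_apply (u (reals_code s) k) (x k i)))
          = (\<Sum>s\<in>I. if s = t then sF (r t) (blinfun_apply (v k) (x k i)) else 0)"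
        by (rule sum.cong) (use k(1) in \<open>auto simp: u_def\<close>)
      also have "\<dots> = sF (r t) (blinfun_apply (v k) (x k i))" using I by simp
      finally have *: "(\<Sum>s\<in>I. sF (r s) (blinfun_apply (u (reals_code s) k) (x k i)))
          = sF (r t) (blinfun_apply (v k) (x k i))" .
      have "blinfun_apply S (x k i) = (\<Sum>s\<in>I. sF (r s) (blinfun_apply (T (reals_code s)) (x k i)))"
        by (simp add: S_def blinfun.sum_left F.op_scale_apply)
      also have "\<dots> = (\<Sum>s\<in>I. sF (r s) (blinfun_apply (u (reals_code s) k) (x k i))
          + (sF (r s) (blinfun_apply (T (reals_code s) - (\<Sum>j<Suc k. u (reals_code s) j)) (x k i))
          + sF (r s) (blinfun_apply (\<Sum>j<k. u (reals_code s) j) (x k i))))"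
        by (intro sum.cong refl, subst F.scale_right_distrib[symmetric], subst F.scale_right_distrib[symmetric])
          (simp add: blinfun.diff_left blinfun.add_left)
      also have "\<dots> = sF (r t) (blinfun_apply (v k) (x k i)) + (Q i + R i)"
        by (simp add: sum.distrib * Q_def R_def)
      finally show ?thesis by simp
    qed
    have Q: "pnorm p (m k) Q \<le> M * ?w"
    proof -
      have "pnorm p (m k) Q \<le> (\<Sum>s\<in>I. pnorm p (m k)
          (\<lambda>i. sF (r s) (blinfun_apply (T (reals_code s) - (\<Sum>j<Suc k. u (reals_code s) j)) (x k i))))"
        unfolding Q_def by (rule pnorm_sum[OF p I(1)])
      also have "\<dots> \<le> (\<Sum>s\<in>I. norm (r s) * ?w)"
      proof (rule sum_mono)
        fix s
        let ?D = "T (reals_code s) - (\<Sum>j<Suc k. u (reals_code s) j)"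
        have "pnorm p (m k) (\<lambda>i. sF (r s) (blinfun_apply ?D (x k i)))
            \<le> (norm (r s) * norm ?D) * pnorm p (m k) (x k)"
          by (intro pnorm_mono p) (auto simp: F.norm_scale mult.assoc intro!: mult_left_mono norm_blinfun)
        also have "\<dots> \<le> norm (r s) * ?w"
          using mult_left_mono[OF tail[of "reals_code s" k], of "norm (r s)"] by (simp add: mult.assoc)
        finally show "pnorm p (m k) (\<lambda>i. sF (r s) (blinfun_apply ?D (x k i))) \<le> norm (r s) * ?w" .
      qed
      finally show ?thesis by (simp add: M_def sum_distrib_right)
    qed
    have R: "pnorm p (m k) R \<le> M * ((\<Sum>j<k. K j) * ?w)"
    proof -
      have "pnorm p (m k) R \<le> (\<Sum>s\<in>I. pnorm p (m k)
          (\<lambda>i. sF (r s) (blinfun_apply (\<Sum>j<k. u (reals_code s) j) (x k i))))"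
        unfolding R_def by (rule pnorm_sum[OF p I(1)])
      also have "\<dots> \<le> (\<Sum>s\<in>I. norm (r s) * ((\<Sum>j<k. K j) * ?w))"
      proof (rule sum_mono)
        fix s
        have "pnorm p (m k) (\<lambda>i. sF (r s) (blinfun_apply (\<Sum>j<k. u (reals_code s) j) (x k i)))
            = norm (r s) * pnorm p (m k) (\<lambda>i. \<Sum>j<k. blinfun_apply (u (reals_code s) j) (x k i))"
          by (intro pnorm_cmult p) (auto simp: F.norm_scale blinfun.sum_left)
        also have "pnorm p (m k) (\<lambda>i. \<Sum>j<k. blinfun_apply (u (reals_code s) j) (x k i))
            \<le> (\<Sum>j<k. pnorm p (m k) (\<lambda>i. blinfun_apply (u (reals_code s) j) (x k i)))"
          by (rule pnorm_sum[OF p]) simp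
        also have "\<dots> \<le> (\<Sum>j<k. K j * ?w)"
          using K w[of k] by (intro sum_mono) (auto simp: u_def)
        finally show "pnorm p (m k) (\<lambda>i. sF (r s) (blinfun_apply (\<Sum>j<k. u (reals_code s) j) (x k i)))
            \<le> norm (r s) * ((\<Sum>j<k. K j) * ?w)"
          by (simp add: sum_distrib_right mult_left_mono)
      qed
      finally show ?thesis by (simp add: M_def sum_distrib_right)
    qed
    have "norm (r t) * pnorm p (m k) (\<lambda>i. blinfun_apply (v k) (x k i))
        = pnorm p (m k) (\<lambda>i. sF (r t) (blinfun_apply (v k) (x k i)))"
      by (rule pnorm_cmult[OF p, symmetric]) (auto simp: F.norm_scale)
    also have "\<dots> \<le> pnorm p (m k) (\<lambda>i. blinfun_apply S (x k i)) + pnorm p (m k) (\<lambda>i. (- 1) *\<^sub>R (Q i + R i))"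
      unfolding split by (rule pnorm_triangle[OF p])
    also have "pnorm p (m k) (\<lambda>i. (- 1) *\<^sub>R (Q i + R i)) = 1 * pnorm p (m k) (\<lambda>i. Q i + R i)"
      by (rule pnorm_cmult[OF p]) (simp_all only: norm_scaleR abs_minus_cancel abs_one zero_le_one)
    also have "\<dots> \<le> pnorm p (m k) Q + pnorm p (m k) R"
      using pnorm_triangle[OF p, of "m k" Q R] by simp
    also have "\<dots> \<le> M * ?w + M * ((\<Sum>j<k. K j) * ?w)" by (rule add_mono[OF Q R])
    also have "pnorm p (m k) (\<lambda>i. blinfun_apply S (x k i)) \<le> \<bar>C\<bar> * ?w"
      using order_trans[OF C[of "m k" "x k"] mult_right_mono[of C "\<bar>C\<bar>" ?w]] w[of k] by simp
    finally have 1: "norm (r t) * pnorm p (m k) (\<lambda>i. blinfun_apply (v k) (x k i))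
        \<le> (\<bar>C\<bar> + M + M * (\<Sum>j<k. K j)) * ?w" by (simp add: algebra_simps)
    define \<Sigma> where "\<Sigma> = (\<Sum>j<k. K j)"
    have \<Sigma>: "\<Sigma> \<ge> 0" using K(1) by (simp add: \<Sigma>_def sum_nonneg)
    \<comment> \<open>The cost of the earlier terms enters both sides through the factor
      \<open>1 + \<Sigma>\<close>; what is left after cancelling it bounds \<open>Suc k\<close>,
      against the choice of \<open>k\<close>.\<close>
    have "norm (r t) * (real (Suc k) * (1 + \<Sigma>) * ?w) < (\<bar>C\<bar> + M + M * \<Sigma>) * ?w"
      using less_le_trans[OF mult_strict_left_mono[OF big[of k], of "norm (r t)"] 1] rt by (simp add: \<Sigma>_def)
    then have "norm (r t) * (real (Suc k) * (1 + \<Sigma>)) < \<bar>C\<bar> + M + M * \<Sigma>"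
      using w[of k] by (simp add: mult.assoc[symmetric])
    also have "\<dots> \<le> (\<bar>C\<bar> + 2 * M) * (1 + \<Sigma>)" using M \<Sigma> by (simp add: algebra_simps)
    finally have "norm (r t) * real (Suc k) < \<bar>C\<bar> + 2 * M"
      using \<Sigma> by (simp add: mult.assoc[symmetric])
    moreover have "\<bar>C\<bar> + 2 * M < norm (r t) * real k"
      using k(2) rt by (simp add: field_simps)
    ultimately show False using norm_ge_zero[of "r t"] by (simp add: algebra_simps)
  qed
  define G where "G = (\<lambda>s. T (reals_code s))"
  have zero: "0 \<in> summing_ops p sE sF"
    unfolding summing_ops_iff using fin_ops_bounded_ops[OF fin_ops.zero] by (auto intro: exI[of _ 0])
  \<comment> \<open>Two equal sums would give a vanishing, hence summing, combination with
    coefficients 1 and -1.\<close>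
  have inj: "inj G"
  proof (rule injI, rule ccontr)
    fix s t assume st: "G s = G t" "s \<noteq> t"
    define r where "r = (\<lambda>q. if q = s then 1 else (- 1 :: 'k))"
    have "(\<Sum>q\<in>{s, t}. op_scale sF (r q) (T (reals_code q))) = op_scale sF 1 (G t) + op_scale sF (- 1) (G t)"
      using st by (simp add: r_def G_def)
    also have "\<dots> = 0" by simp
    finally have "r s = 0" using key[of "{s, t}" s r] zero by simp
    then show False by (simp add: r_def)
  qed
  have comb: "\<forall>s\<in>I. r s = 0" if "finite I" "(\<Sum>s\<in>I. op_scale sF (r s) (G s)) \<in> summing_ops p sE sF" for I r
    using key[OF that(1) _ that(2)[unfolded G_def]] by blast
  have indep: "\<not> module.dependent (op_scale sF) (range G)"
  proof
    assume "module.dependent (op_scale sF) (range G)"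
    then obtain H h where H: "finite H" "H \<subseteq> range G" "(\<Sum>a\<in>H. op_scale sF (h a) a) = 0" "\<exists>a\<in>H. h a \<noteq> 0"
      unfolding V.dependent_explicit by blast
    define I where "I = G -` H"
    have I: "H = G ` I" "finite I"
      using H(2) finite_vimageI[OF H(1) inj] by (auto simp: I_def)
    have "(\<Sum>s\<in>I. op_scale sF (h (G s)) (G s)) = 0"
      using H(3) unfolding I(1) by (subst (asm) sum.reindex) (auto intro: inj_on_subset[OF inj])
    then have "\<forall>s\<in>I. h (G s) = 0" using comb[OF I(2), of "\<lambda>s. h (G s)"] zero by simp
    then show False using H(4) I(1) by blast
  qed
  \<comment> \<open>Once the closure is a subspace, the whole span lies in it and therefore consists
    of compact operators.\<close>
  have sub: "V.subspace (closure fin_ops)"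
    unfolding V.subspace_def
  proof (intro conjI ballI allI)
    show "0 \<in> closure fin_ops" using fin_ops.zero closure_subset by blast
  next
    fix X Y assume XY: "X \<in> closure fin_ops" "Y \<in> closure fin_ops"
    obtain f g where fg: "\<And>n. f n \<in> fin_ops" "f \<longlonglongrightarrow> X" "\<And>n. g n \<in> fin_ops" "g \<longlonglongrightarrow> Y"
      using XY unfolding closure_sequential by blast
    show "X + Y \<in> closure fin_ops"
      unfolding closure_sequential
      by (rule exI[of _ "\<lambda>n. f n + g n"]) (use fg fin_ops_add tendsto_add in blast)
  next
    fix c X assume X: "X \<in> closure fin_ops"
    obtain f where f: "\<And>n. f n \<in> fin_ops" "f \<longlonglongrightarrow> X" using X unfolding closure_sequential by blast
    have "norm (op_scale sF c Y) \<le> norm c * norm Y" for Y :: "'a \<Rightarrow>\<^sub>L 'b"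
      by (rule norm_blinfun_bound)
        (auto simp: F.op_scale_apply F.norm_scale mult.assoc intro!: mult_left_mono norm_blinfun)
    then have "bounded_linear (\<lambda>Y :: 'a \<Rightarrow>\<^sub>L 'b. op_scale sF c Y)"
    proof (intro bounded_linear_intro[where K = "norm c"])
      fix r and Y :: "'a \<Rightarrow>\<^sub>L 'b"
      show "op_scale sF c (r *\<^sub>R Y) = r *\<^sub>R op_scale sF c Y"
        by (simp only: op_scale_of_real[symmetric] V.scale_scale mult.commute)
    qed (auto simp: V.scale_right_distrib mult.commute)
    then have "(\<lambda>n. op_scale sF c (f n)) \<longlonglongrightarrow> op_scale sF c X"
      using f(2) by (rule bounded_linear.tendsto)
    moreover have "\<forall>n. op_scale sF c (f n) \<in> fin_ops" using f(1) fin_ops_op_scale by blast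
    ultimately show "op_scale sF c X \<in> closure fin_ops"
      unfolding closure_sequential by (intro exI[of _ "\<lambda>n. op_scale sF c (f n)"] conjI)
  qed
  have span_sub: "V.span (range G) \<subseteq> compact_ops sE sF"
    using V.span_minimal[OF _ sub, of "range G"] T_closure closure_fin_ops_compact by (auto simp: G_def)
  have span_ns: "X = 0" if X: "X \<in> V.span (range G)" "X \<in> summing_ops p sE sF" for X
  proof -
    obtain H h where H: "finite H" "H \<subseteq> range G" "X = (\<Sum>a\<in>H. op_scale sF (h a) a)"
      using X(1) unfolding V.span_explicit by blast
    define I where "I = G -` H"
    have I: "H = G ` I" "finite I"
      using H(2) finite_vimageI[OF H(1) inj] by (auto simp: I_def)
    have "X = (\<Sum>s\<in>I. op_scale sF (h (G s)) (G s))"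
      using H(3) unfolding I(1) by (subst (asm) sum.reindex) (auto intro: inj_on_subset[OF inj])
    then show ?thesis using comb[OF I(2), of "\<lambda>s. h (G s)"] X(2) by simp
  qed
  have "\<not> fin_dim (op_scale sF) (V.span (range G))"
  proof
    assume "fin_dim (op_scale sF) (V.span (range G))"
    then obtain S where S: "finite S" "V.span (range G) \<subseteq> V.span S" unfolding fin_dim_def by blast
    then have "range G \<subseteq> V.span S" using V.span_superset by blast
    then have "finite (range G)" using V.independent_span_bound[OF S(1) indep] by blast
    then show False using inj infinite_UNIV_char_0[where 'a = real] finite_imageD by blast
  qed
  moreover have "range G \<approx> (UNIV :: real set)"
    using inj by (metis eqpoll_sym inj_on_image_eqpoll_self)
  ultimately show ?thesis
    unfolding lineable_def
    using indep span_sub span_ns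
    by (intro exI[of _ "V.span (range G)"] exI[of _ "range G"]) auto
qed

end

section \<open>Separated points\<close>

text \<open>The real bilinear form \<open>inner (c * d) 1\<close> is nondegenerate, as seen by
  taking \<open>d\<close> inverse to \<open>c\<close>, and \<open>'k\<close> has finite real
  dimension. For complex scalars the form is the real part of the product.\<close>

lemma representing_scalar:
  fixes g :: "'k::{real_normed_field,euclidean_space} \<Rightarrow> real"
  assumes "linear g"
  shows "\<exists>c. \<forall>d. inner (c * d) 1 = g d"
proof -
  define r where "r = (\<lambda>c :: 'k. \<Sum>b\<in>Basis. inner (c * b) 1 *\<^sub>R b)"
  have ext: "h = h'" if "linear h" "linear h'" "\<And>b. b \<in> Basis \<Longrightarrow> h b = h' b" for h h' :: "'k \<Rightarrow> real"
    using linear_eq_stdbasis[OF that] .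
  have lin: "linear (\<lambda>d. inner (c * d) 1)" for c :: 'k
    by (rule linearI) (auto simp: inner_add_left ring_distribs)
  have "linear r"
    by (rule linearI) (auto simp: r_def inner_add_left ring_distribs scaleR_add_left sum.distrib scaleR_sum_right)
  have r_comp: "inner (r c) b = inner (c * b) 1" if "b \<in> Basis" for c b
    using that by (simp add: r_def inner_sum_left inner_Basis if_distrib[of "\<lambda>x. _ * x"] cong: if_cong)
  have "inj r"
    unfolding linear_injective_0[OF \<open>linear r\<close>]
  proof (intro allI impI, rule ccontr)
    fix c assume c: "r c = 0" "c \<noteq> 0"
    have "(\<lambda>d. inner (c * d) 1) = (\<lambda>d. 0)"
      by (rule ext[OF lin]) (use r_comp[of _ c] c(1) in \<open>auto intro: linearI\<close>)
    from fun_cong[OF this, of "inverse c"] c(2) have "inner (1::'k) 1 = 0" by simp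
    then show False by (simp add: inner_eq_zero_iff)
  qed
  then have "surj r" using linear_inj_imp_surj[OF \<open>linear r\<close>] by blast
  then obtain c where c: "r c = (\<Sum>b\<in>Basis. g b *\<^sub>R b)" by (metis surjD)
  have "(\<lambda>d. inner (c * d) 1) = g"
  proof (rule ext[OF lin assms])
    fix b :: 'k assume b: "b \<in> Basis"
    then show "inner (c * b) 1 = g b"
      using r_comp[OF b, of c] by (simp add: c inner_sum_left inner_Basis if_distrib[of "\<lambda>x. _ * x"] cong: if_cong)
  qed
  then show ?thesis by (intro exI[of _ c]) (auto dest: fun_cong)
qed

lemma representing_scalar_unique:
  fixes c :: "'k::{real_normed_field,euclidean_space}"
  assumes "\<And>d. inner (c * d) 1 = inner (c' * d) 1"
  shows "c = c'"
proof (rule ccontr)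
  assume "c \<noteq> c'"
  moreover have "inner ((c - c') * inverse (c - c')) 1 = 0"
    using assms[of "inverse (c - c')"] by (simp add: left_diff_distrib inner_diff_left)
  ultimately have "inner (1::'k) 1 = 0" by simp
  then show False by (simp add: inner_eq_zero_iff)
qed

text \<open>Turns a coordinate of a scalar functional at \<open>x\<close> into a value of its real
  counterpart at a multiple of \<open>x\<close> that is no longer than \<open>x\<close>.\<close>

lemma inner_eq_inner_mult_1:
  fixes b :: "'k::{real_normed_field,euclidean_space}"
  assumes "norm b \<le> 1"
  shows "\<exists>d. norm d \<le> 1 \<and> (\<forall>c. inner c b = inner (c * d) 1)"
proof -
  have "linear (\<lambda>c. inner c b)" by (rule linearI) (auto simp: inner_add_left)
  from representing_scalar[OF this] obtain d where d: "\<And>c. inner (d * c) 1 = inner c b" by blast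
  have "norm d \<le> 1"
  proof (cases "d = 0")
    case False
    have "1 = inner (d * inverse d) 1" using False by (simp add: dot_square_norm)
    also have "\<dots> \<le> norm (inverse d) * norm b" unfolding d by (rule norm_cauchy_schwarz)
    also have "\<dots> \<le> norm (inverse d) * 1" using assms by (intro mult_left_mono) auto
    finally have "1 \<le> inverse (norm d)" by (simp add: norm_inverse)
    then show ?thesis using False by (simp add: inverse_eq_divide pos_le_divide_eq)
  qed simp
  then show ?thesis using d by (intro exI[of _ d]) (simp add: mult.commute)
qed

lemma norm_square_basis: "(norm (x :: 'k::euclidean_space))\<^sup>2 = (\<Sum>b\<in>Basis. (inner x b)\<^sup>2)"
  using power2_norm_eq_inner[of x] euclidean_inner[of x x] by (simp add: power2_eq_square)

text \<open>The adjoint of a contraction from Euclidean space into the dual: the estimate is tested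
  with the coefficients \<open>f i x\<close> themselves.\<close>

lemma upper2_dual:
  fixes f :: "nat \<Rightarrow> ('a::real_normed_vector \<Rightarrow>\<^sub>L real)"
  assumes "upper2 n f"
  shows "(\<Sum>i<n. (blinfun_apply (f i) x)\<^sup>2) \<le> (norm x)\<^sup>2"
proof -
  define S where "S = (\<Sum>i<n. (blinfun_apply (f i) x)\<^sup>2)"
  have S0: "S \<ge> 0" by (simp add: S_def sum_nonneg)
  define g where "g = (\<Sum>i<n. blinfun_apply (f i) x *\<^sub>R f i)"
  have "(norm g)\<^sup>2 \<le> S"
    using assms[unfolded upper2_def, rule_format, of "\<lambda>i. blinfun_apply (f i) x"] by (simp add: S_def g_def)
  moreover have "S \<le> norm g * norm x"
  proof -
    have "S = blinfun_apply g x"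
      by (simp add: S_def g_def blinfun.sum_left blinfun.scaleR_left power2_eq_square)
    then show ?thesis using norm_blinfun[of g x] by simp
  qed
  then have "S\<^sup>2 \<le> (norm g)\<^sup>2 * (norm x)\<^sup>2"
    using S0 by (metis power_mono power_mult_distrib)
  ultimately have "S * S \<le> S * (norm x)\<^sup>2"
    by (metis mult_right_mono order_trans power2_eq_square zero_le_power2)
  then show ?thesis using S0 by (cases "S = 0") (auto simp: S_def[symmetric])
qed

context kbanach
begin

text \<open>For complex scalars this is the classical formula
  \<open>\<phi> x = f x - i f (i x)\<close>, stated so that it covers both fields.\<close>

lemma extend_real_functional:
  assumes "bounded_linear f"
  shows "\<exists>\<phi>. Vector_Spaces.linear scale (*) \<phi> \<and> (\<forall>x d. inner (\<phi> x * d) 1 = f (scale d x))"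
proof -
  have lin: "linear f" using assms by (rule bounded_linear.linear)
  have "\<exists>c. \<forall>d. inner (c * d) 1 = f (scale d x)" for x
  proof (rule representing_scalar)
    show "linear (\<lambda>d. f (scale d x))"
      using linear_compose[OF bounded_linear.linear[OF bounded_linear_scale_left] lin] by (simp add: o_def)
  qed
  then obtain \<phi> where \<phi>: "\<And>x d. inner (\<phi> x * d) 1 = f (scale d x)" by metis
  have "\<phi> (x + y) = \<phi> x + \<phi> y" for x y
    by (rule representing_scalar_unique)
      (simp add: \<phi> ring_distribs inner_add_left scale_right_distrib linear_add[OF lin])
  moreover have "\<phi> (scale c x) = c * \<phi> x" for c x
  proof (rule representing_scalar_unique)
    fix d
    have "c * \<phi> x * d = \<phi> x * (d * c)" by (simp add: mult_ac)
    then show "inner (\<phi> (scale c x) * d) 1 = inner (c * \<phi> x * d) 1" by (simp only: \<phi> scale_scale)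
  qed
  ultimately show ?thesis using \<phi> linear_functional_iff by blast
qed

text \<open>The real estimate is applied once for each of the \<open>DIM('k)\<close> coordinate
  directions.\<close>

lemma sum_square_functionals_le:
  fixes f :: "nat \<Rightarrow> ('a \<Rightarrow>\<^sub>L real)"
  assumes "upper2 n f" and \<phi>: "\<And>i x d. inner (\<phi> i x * d) (1::'k) = blinfun_apply (f i) (scale d x)"
  shows "(\<Sum>i<n. (norm (\<phi> i x))\<^sup>2) \<le> real DIM('k) * (norm x)\<^sup>2"
proof -
  have "(\<Sum>i<n. (inner (\<phi> i x) b)\<^sup>2) \<le> (norm x)\<^sup>2" if b: "b \<in> Basis" for b :: 'k
  proof -
    obtain d :: 'k where d: "norm d \<le> 1" "\<And>c. inner c b = inner (c * d) 1"
      using inner_eq_inner_mult_1[OF eq_refl[OF norm_Basis[OF b]]] by blast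
    have "(\<Sum>i<n. (inner (\<phi> i x) b)\<^sup>2) = (\<Sum>i<n. (blinfun_apply (f i) (scale d x))\<^sup>2)"
      by (simp add: d(2) \<phi>)
    also have "\<dots> \<le> (norm (scale d x))\<^sup>2" by (rule upper2_dual[OF assms(1)])
    also have "\<dots> \<le> (norm x)\<^sup>2"
      using d(1) by (intro power_mono) (auto simp: norm_scale mult_left_le_one_le)
    finally show ?thesis .
  qed
  then have "(\<Sum>b\<in>(Basis::'k set). \<Sum>i<n. (inner (\<phi> i x) b)\<^sup>2) \<le> (\<Sum>b\<in>(Basis::'k set). (norm x)\<^sup>2)"
    by (rule sum_mono)
  then show ?thesis by (subst (asm) sum.swap) (simp add: norm_square_basis)
qed

lemma norm_sum_scale_upper2:
  assumes "upper2 n y"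
  shows "norm (\<Sum>i<n. scale (c i) (y i)) \<le> real DIM('k) * L2_set (\<lambda>i. norm (c i)) {..<n}"
proof -
  have "scale (c i) (y i) = (\<Sum>b\<in>Basis. scale b (inner (c i) b *\<^sub>R y i))" for i
  proof -
    have "scale (c i) (y i) = scale (\<Sum>b\<in>Basis. inner (c i) b *\<^sub>R b) (y i)"
      by (simp add: euclidean_representation)
    also have "\<dots> = (\<Sum>b\<in>Basis. scale (b * of_real (inner (c i) b)) (y i))"
      by (simp add: scale_sum_left scaleR_conv_of_real mult.commute)
    also have "\<dots> = (\<Sum>b\<in>Basis. scale b (inner (c i) b *\<^sub>R y i))"
      by (simp only: scale_scale[symmetric] scale_of_real)
    finally show ?thesis .
  qed
  then have "(\<Sum>i<n. scale (c i) (y i)) = (\<Sum>i<n. \<Sum>b\<in>Basis. scale b (inner (c i) b *\<^sub>R y i))" by simp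
  also have "\<dots> = (\<Sum>b\<in>Basis. scale b (\<Sum>i<n. inner (c i) b *\<^sub>R y i))"
    by (subst sum.swap) (simp add: scale_sum_right)
  finally have "norm (\<Sum>i<n. scale (c i) (y i)) \<le> (\<Sum>b\<in>(Basis::'k set). norm (scale b (\<Sum>i<n. inner (c i) b *\<^sub>R y i)))"
    by (simp add: norm_sum)
  also have "\<dots> \<le> (\<Sum>b\<in>(Basis::'k set). L2_set (\<lambda>i. norm (c i)) {..<n})"
  proof (rule sum_mono)
    fix b :: 'k assume b: "b \<in> Basis"
    have "norm (scale b (\<Sum>i<n. inner (c i) b *\<^sub>R y i)) = norm (\<Sum>i<n. inner (c i) b *\<^sub>R y i)"
      using b by (simp add: norm_scale)
    also have "\<dots> \<le> sqrt (\<Sum>i<n. (inner (c i) b)\<^sup>2)"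
      by (rule real_le_rsqrt) (use assms in \<open>simp add: upper2_def\<close>)
    also have "\<dots> \<le> L2_set (\<lambda>i. norm (c i)) {..<n}"
      unfolding L2_set_def
    proof (intro real_sqrt_le_mono sum_mono)
      fix i show "(inner (c i) b)\<^sup>2 \<le> (norm (c i))\<^sup>2"
        using Basis_le_norm[OF b, of "c i"] by (simp add: abs_le_square_iff[symmetric])
    qed
    finally show "norm (scale b (\<Sum>i<n. inner (c i) b *\<^sub>R y i)) \<le> L2_set (\<lambda>i. norm (c i)) {..<n}" .
  qed
  finally show ?thesis by simp
qed

end

text \<open>Subsets are paired by inserting \<open>i\<close>; each pair contains a member with value
  at least \<open>c\<close>, so the average is at least \<open>c / 2\<close>.\<close>

lemma sum_sign_flip:
  fixes g :: "nat set \<Rightarrow> real"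
  assumes "i < n" and low: "\<And>A. g A \<ge> 0" "\<And>A. i \<notin> A \<Longrightarrow> g A \<ge> c \<or> g (insert i A) \<ge> c"
  shows "(\<Sum>A\<in>Pow {..<n}. g A) \<ge> real (card (Pow {..<n})) * c / 2"
proof -
  define B where "B = Pow ({..<n} - {i})"
  have B: "finite B" "\<And>A. A \<in> B \<Longrightarrow> i \<notin> A" by (auto simp: B_def)
  have "{..<n} = insert i ({..<n} - {i})" using assms(1) by auto
  then have P: "Pow {..<n} = B \<union> insert i ` B" using Pow_insert[of i "{..<n} - {i}"] by (simp add: B_def)
  have inj: "inj_on (insert i) B" using B(2) unfolding inj_on_def by (metis insert_ident)
  have disj: "B \<inter> insert i ` B = {}" using B(2) by auto
  have "(\<Sum>A\<in>Pow {..<n}. g A) = (\<Sum>A\<in>B. g A + g (insert i A))"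
    unfolding P using B(1) disj inj by (simp add: sum.union_disjoint sum.reindex sum.distrib)
  also have "\<dots> \<ge> (\<Sum>A\<in>B. c)"
  proof (rule sum_mono)
    fix A assume "A \<in> B"
    then have "g A \<ge> c \<or> g (insert i A) \<ge> c" using low(2) B(2) by blast
    then show "c \<le> g A + g (insert i A)" using low(1)[of A] low(1)[of "insert i A"] by linarith
  qed
  finally have "real (card B) * c \<le> (\<Sum>A\<in>Pow {..<n}. g A)" by simp
  moreover have "card (Pow {..<n}) = 2 * card B"
    unfolding P using B(1) disj inj by (simp add: card_Un_disjoint card_image)
  ultimately show ?thesis by simp
qed

context kbanach_pair
begin

text \<open>The operators factor through Euclidean space with the signs acting diagonally, so
  \<open>n\<close> and the signs do not enter the norm bound. One factor \<open>DIM('k)\<close>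
  comes from the functionals, the other from the vectors \<open>y i\<close>.\<close>

lemma dvoretzky_rogers_operators:
  assumes E: "\<forall>S :: 'a set. finite S \<longrightarrow> span S \<noteq> UNIV" and F: "\<forall>S :: 'b set. finite S \<longrightarrow> span S \<noteq> UNIV"
  shows "\<exists>\<phi> (y :: nat \<Rightarrow> 'b) z. (\<forall>i<n. Vector_Spaces.linear sE (*) (\<phi> i) \<and> norm (z i) \<le> 1
      \<and> 1 / 8 \<le> norm (\<phi> i (z i)) \<and> 1 / 4 \<le> norm (y i))
    \<and> (\<forall>x. (\<Sum>i<n. (norm (\<phi> i x))\<^sup>2) \<le> real DIM('k) * (norm x)\<^sup>2)
    \<and> (\<forall>\<epsilon> :: nat \<Rightarrow> real. (\<forall>i. \<bar>\<epsilon> i\<bar> \<le> 1) \<longrightarrow> (\<exists>u\<in>fin_ops. norm u \<le> (real DIM('k))\<^sup>2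
        \<and> (\<forall>x. blinfun_apply u x = (\<Sum>i<n. \<epsilon> i *\<^sub>R sF (\<phi> i x) (y i)))))"
proof -
  obtain f :: "nat \<Rightarrow> ('a \<Rightarrow>\<^sub>L real)" where f: "upper2 n f" "\<forall>i<n. 1 / 4 \<le> norm (f i)"
    using dvoretzky_rogers_dual[OF E] by blast
  obtain y :: "nat \<Rightarrow> 'b" where y: "upper2 n y" "\<forall>i<n. 1 / 4 \<le> norm (y i)"
    using dvoretzky_rogers_space[OF F] by blast
  have "\<exists>\<phi>. Vector_Spaces.linear sE (*) \<phi> \<and> (\<forall>x d. inner (\<phi> x * d) 1 = blinfun_apply (f i) (sE d x))" for i
    by (rule E.extend_real_functional) (rule blinfun.bounded_linear_right)
  then obtain \<phi> where \<phi>: "\<And>i. Vector_Spaces.linear sE (*) (\<phi> i)"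
    "\<And>i x d. inner (\<phi> i x * d) 1 = blinfun_apply (f i) (sE d x)" by metis
  have sq: "(\<Sum>i<n. (norm (\<phi> i x))\<^sup>2) \<le> real DIM('k) * (norm x)\<^sup>2" for x
    by (rule E.sum_square_functionals_le[OF f(1) \<phi>(2)])
  have "\<exists>z. norm z \<le> 1 \<and> 1 / 8 \<le> norm (\<phi> i z)" if "i < n" for i
  proof -
    \<comment> \<open>The norm need not be attained; 1/8 is strictly below 1/4, so a suitable vector
      exists.\<close>
    have "\<exists>x. norm (blinfun_apply (f i) x) > 1 / 8 * norm x"
    proof (rule ccontr)
      assume "\<not> ?thesis"
      then have "norm (f i) \<le> 1 / 8" by (intro norm_blinfun_bound) (auto simp: not_less)
      moreover have "1 / 4 \<le> norm (f i)" using f(2) that by blast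
      ultimately show False by simp
    qed
    then obtain x where x: "norm (blinfun_apply (f i) x) > 1 / 8 * norm x" by blast
    then have x0: "norm x > 0" using blinfun.zero_right[of "f i"] by (cases "x = 0") auto
    define z where "z = (1 / norm x) *\<^sub>R x"
    have "1 / 8 \<le> norm (blinfun_apply (f i) z)"
      using x x0 by (simp add: z_def blinfun.scaleR_right field_simps)
    also have "blinfun_apply (f i) z = inner (\<phi> i z) 1" using \<phi>(2)[of i z 1] by simp
    also have "norm \<dots> \<le> norm (\<phi> i z)" using Cauchy_Schwarz_ineq2[of "\<phi> i z" 1] by simp
    finally show ?thesis using x0 by (intro exI[of _ z]) (simp add: z_def)
  qed
  then obtain z where z: "\<And>i. i < n \<Longrightarrow> norm (z i) \<le> 1 \<and> 1 / 8 \<le> norm (\<phi> i (z i))" by metis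
  have "\<exists>u\<in>fin_ops. norm u \<le> (real DIM('k))\<^sup>2 \<and> (\<forall>x. blinfun_apply u x = (\<Sum>i<n. \<epsilon> i *\<^sub>R sF (\<phi> i x) (y i)))"
    if \<epsilon>: "\<forall>i. \<bar>\<epsilon> i\<bar> \<le> (1::real)" for \<epsilon>
  proof -
    define \<phi>' where "\<phi>' = (\<lambda>i x. of_real (\<epsilon> i) * \<phi> i x)"
    have lin: "Vector_Spaces.linear sE (*) (\<phi>' i)" for i
      using \<phi>(1)[of i] by (simp add: E.linear_functional_iff \<phi>'_def ring_distribs mult_ac)
    have le: "norm (\<phi>' i x) \<le> norm (\<phi> i x)" for i x
      using \<epsilon> by (simp add: \<phi>'_def norm_mult mult_left_le_one_le)
    have L2: "L2_set (\<lambda>i. norm (\<phi>' i x)) {..<n} \<le> real DIM('k) * norm x" for x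
    proof -
      have "(\<Sum>i<n. (norm (\<phi>' i x))\<^sup>2) \<le> (\<Sum>i<n. (norm (\<phi> i x))\<^sup>2)"
        using le by (intro sum_mono power_mono) auto
      also have "\<dots> \<le> real DIM('k) * (norm x)\<^sup>2" by (rule sq)
      also have "\<dots> \<le> (real DIM('k))\<^sup>2 * (norm x)\<^sup>2"
        using DIM_positive[where 'a = 'k] by (intro mult_right_mono) (auto simp: power2_eq_square)
      finally show ?thesis unfolding L2_set_def by (intro real_le_lsqrt) (auto simp: power_mult_distrib)
    qed
    have "norm (\<phi>' i x) \<le> real DIM('k) * norm x" if "i < n" for i x
      using member_le_L2_set[of "{..<n}" i "\<lambda>i. norm (\<phi>' i x)"] that L2[of x] by simp
    then obtain u where u: "u \<in> fin_ops" "\<And>x. blinfun_apply u x = (\<Sum>i<n. sF (\<phi>' i x) (y i))"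
      using fin_ops_finite_sum[of n \<phi>' "real DIM('k)" y] lin by blast
    have "norm u \<le> (real DIM('k))\<^sup>2"
    proof (rule norm_blinfun_bound)
      fix x
      have "norm (blinfun_apply u x) \<le> real DIM('k) * L2_set (\<lambda>i. norm (\<phi>' i x)) {..<n}"
        unfolding u(2) by (rule F.norm_sum_scale_upper2[OF y(1)])
      also have "\<dots> \<le> real DIM('k) * (real DIM('k) * norm x)" using L2 by (intro mult_left_mono) auto
      finally show "norm (blinfun_apply u x) \<le> (real DIM('k))\<^sup>2 * norm x" by (simp add: power2_eq_square mult.assoc)
    qed simp
    moreover have "sF (\<phi>' i x) (y i) = \<epsilon> i *\<^sub>R sF (\<phi> i x) (y i)" for i x
      by (simp only: \<phi>'_def F.scale_scale[symmetric] F.scale_of_real)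
    ultimately show ?thesis using u by (intro bexI[of _ u]) auto
  qed
  then show ?thesis using \<phi>(1) z y(2) sq by (intro exI[of _ \<phi>] exI[of _ y] exI[of _ z]) blast
qed

text \<open>Since the functionals have a bounded square sum at every point, Ramsey's theorem provides many
  points at which the functionals with smaller index are small. Flipping the sign of one summand
  of the operator shows that at least half of all sign choices separate a given pair.\<close>

lemma separated_points_operators:
  assumes E: "\<forall>S :: 'a set. finite S \<longrightarrow> span S \<noteq> UNIV" and F: "\<forall>S :: 'b set. finite S \<longrightarrow> span S \<noteq> UNIV"
    and p: "p \<ge> 1"
  shows "\<exists>z :: nat \<Rightarrow> 'a. (\<forall>i. norm (z i) \<le> 1)
    \<and> (\<forall>M a b. (\<forall>l<M. a l < b l \<and> b l < n) \<longrightarrow> (\<exists>u\<in>fin_ops. norm u \<le> (real DIM('k))\<^sup>2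
        \<and> (\<Sum>l<M. norm (blinfun_apply u (z (a l) - z (b l))) powr p) \<ge> real M * (1 / 64) powr p / 2))"
proof -
  \<comment> \<open>A clique with \<open>q + 2\<close> elements would give \<open>q + 1\<close>
    functionals exceeding 1/16 at the point of largest index, whose square sum exceeds
    \<open>DIM('k)\<close> because \<open>16^2 = 256\<close>.\<close>
  define q where "q = 256 * DIM('k)"
  obtain N where N: "\<And>(V :: nat set) E. finite V \<Longrightarrow> card V \<ge> N \<Longrightarrow>
    \<exists>R\<subseteq>V. card R = q + 2 \<and> clique R E \<or> card R = n \<and> indep R E"
    using ramsey2[of "q + 2" n] by metis
  obtain \<phi> and y :: "nat \<Rightarrow> 'b" and z where
    sys0: "\<forall>i<N. Vector_Spaces.linear sE (*) (\<phi> i) \<and> norm (z i) \<le> 1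
      \<and> 1 / 8 \<le> norm (\<phi> i (z i)) \<and> 1 / 4 \<le> norm (y i)"
    and sq0: "\<forall>x. (\<Sum>i<N. (norm (\<phi> i x))\<^sup>2) \<le> real DIM('k) * (norm x)\<^sup>2"
    and u: "\<forall>\<epsilon> :: nat \<Rightarrow> real. (\<forall>i. \<bar>\<epsilon> i\<bar> \<le> 1) \<longrightarrow> (\<exists>u\<in>fin_ops. norm u \<le> (real DIM('k))\<^sup>2
        \<and> (\<forall>x. blinfun_apply u x = (\<Sum>i<N. \<epsilon> i *\<^sub>R sF (\<phi> i x) (y i))))"
    using dvoretzky_rogers_operators[OF E F, of N] by (elim exE conjE) (rule that)
  have sys: "Vector_Spaces.linear sE (*) (\<phi> i)" "norm (z i) \<le> 1" "1 / 8 \<le> norm (\<phi> i (z i))"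
    "1 / 4 \<le> norm (y i)" if "i < N" for i using sys0 that by blast+
  have sq: "(\<Sum>i<N. (norm (\<phi> i x))\<^sup>2) \<le> real DIM('k) * (norm x)\<^sup>2" for x using sq0 by blast
  \<comment> \<open>The edges are the bad pairs, in which the functional of smaller index is not
    small at the later point. An independent set is wanted.\<close>
  define D where "D = {{i, j} |i j. i < j \<and> norm (\<phi> i (z j)) > 1 / 16}"
  obtain R where R: "R \<subseteq> {..<N}" "card R = q + 2 \<and> clique R D \<or> card R = n \<and> indep R D"
    using N[of "{..<N}" D] by auto
  have finR: "finite R" using R(1) finite_subset by blast
  have "\<not> (card R = q + 2 \<and> clique R D)"
  proof
    assume c: "card R = q + 2 \<and> clique R D"
    then have "R \<noteq> {}" by auto
    define j where "j = Max R"
    have j: "j \<in> R" "\<And>i. i \<in> R \<Longrightarrow> i \<le> j" using finR \<open>R \<noteq> {}\<close> by (auto simp: j_def)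
    have bad: "norm (\<phi> i (z j)) > 1 / 16" if "i \<in> R - {j}" for i
    proof -
      have "i < j" using that j(2)[of i] by auto
      have "{i, j} \<in> D" using c that j(1) by (auto simp: clique_def)
      then obtain i' j' where ij: "{i, j} = {i', j'}" "i' < j'" "norm (\<phi> i' (z j')) > 1 / 16"
        unfolding D_def by blast
      then have "i' = i" "j' = j" using \<open>i < j\<close> by (auto simp: doubleton_eq_iff)
      then show ?thesis using ij(3) by simp
    qed
    have "real (card (R - {j})) * (1 / 256) = (\<Sum>i\<in>R - {j}. (1 / 16 :: real)\<^sup>2)" by (simp add: power2_eq_square)
    also have "\<dots> \<le> (\<Sum>i\<in>R - {j}. (norm (\<phi> i (z j)))\<^sup>2)"
      using bad by (intro sum_mono power_mono) (auto intro: less_imp_le)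
    also have "\<dots> \<le> (\<Sum>i<N. (norm (\<phi> i (z j)))\<^sup>2)" using R(1) by (intro sum_mono2) auto
    also have "\<dots> \<le> real DIM('k) * (norm (z j))\<^sup>2" by (rule sq)
    also have "\<dots> \<le> real DIM('k) * 1" using sys(2)[of j] j(1) R(1) by (intro mult_left_mono) (auto simp: abs_square_le_1)
    finally have "real (card (R - {j})) \<le> real q" by (simp add: q_def)
    moreover have "card (R - {j}) = q + 1" using c j(1) finR by simp
    ultimately show False by simp
  qed
  then have Rn: "card R = n" "indep R D" using R(2) by auto
  obtain h where h: "bij_betw h {..<n} R" "strict_mono_on {..<n} h"
    using ex_bij_betw_strict_mono_card[OF finR] Rn(1) by metis
  define w where "w = (\<lambda>i. if i < n then z (h i) else 0)"
  have hR: "h i \<in> R" if "i < n" for i using h(1) that by (auto simp: bij_betw_def)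
  have hN: "h i < N" if "i < n" for i using hR[OF that] R(1) by auto
  \<comment> \<open>The value at the own point is at least 1/8, and at most 1/16 of it can be lost
    at the later point.\<close>
  have good: "norm (\<phi> (h i) (z (h i) - z (h j))) \<ge> 1 / 16" if "i < j" "j < n" for i j
  proof -
    have lt: "h i < h j" using h(2) that by (auto simp: strict_mono_on_def)
    have "{h i, h j} \<notin> D" using Rn(2) hR[of i] hR[of j] that lt by (auto simp: indep_def)
    then have "\<not> norm (\<phi> (h i) (z (h j))) > 1 / 16" using lt unfolding D_def by blast
    then have "norm (\<phi> (h i) (z (h j))) \<le> 1 / 16" by simp
    moreover have "\<phi> (h i) (z (h i)) = \<phi> (h i) (z (h i) - z (h j)) + \<phi> (h i) (z (h j))"
      using sys(1)[OF hN[of i]] that by (metis E.linear_functional_iff diff_add_cancel order_less_trans)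
    moreover have "1 / 8 \<le> norm (\<phi> (h i) (z (h i)))" using sys(3)[OF hN[of i]] that by simp
    ultimately show ?thesis
      using norm_triangle_ineq[of "\<phi> (h i) (z (h i) - z (h j))" "\<phi> (h i) (z (h j))"] by simp
  qed
  have "\<exists>u\<in>fin_ops. norm u \<le> (real DIM('k))\<^sup>2
        \<and> (\<Sum>l<M. norm (blinfun_apply u (w (a l) - w (b l))) powr p) \<ge> real M * (1 / 64) powr p / 2"
    if ab: "\<forall>l<M. a l < b l \<and> b l < n" for M a b
  proof -
    define \<epsilon> where "\<epsilon> = (\<lambda>A i :: nat. if i \<in> A then 1 else - 1 :: real)"
    have "\<exists>u\<in>fin_ops. norm u \<le> (real DIM('k))\<^sup>2
        \<and> (\<forall>x. blinfun_apply u x = (\<Sum>i<N. \<epsilon> A i *\<^sub>R sF (\<phi> i x) (y i)))" for A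
      by (rule u[rule_format]) (simp add: \<epsilon>_def)
    then obtain U where U: "\<And>A. U A \<in> fin_ops" "\<And>A. norm (U A) \<le> (real DIM('k))\<^sup>2"
      "\<And>A x. blinfun_apply (U A) x = (\<Sum>i<N. \<epsilon> A i *\<^sub>R sF (\<phi> i x) (y i))" by metis
    define G where "G = (\<lambda>A l. norm (blinfun_apply (U A) (w (a l) - w (b l))) powr p)"
    have "(\<Sum>A\<in>Pow {..<N}. G A l) \<ge> real (card (Pow {..<N})) * (1 / 64) powr p / 2" if l: "l < M" for l
    proof (rule sum_sign_flip)
      have al: "a l < b l" "b l < n" using ab l by auto
      show iN: "h (a l) < N" using hN[of "a l"] al by simp
      show "G A l \<ge> 0" for A by (simp add: G_def)
      fix A assume A: "h (a l) \<notin> A"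
      define d where "d = w (a l) - w (b l)"
      have d: "d = z (h (a l)) - z (h (b l))" using al by (simp add: d_def w_def)
      \<comment> \<open>Flipping one sign moves the image by twice a rank one term of norm at least
        \<open>1/16 * 1/4\<close>, so one of the two images has norm at least 1/64.\<close>
      have "blinfun_apply (U (insert (h (a l)) A)) d - blinfun_apply (U A) d
          = (\<Sum>i<N. if i = h (a l) then 2 *\<^sub>R sF (\<phi> i d) (y i) else 0)"
        unfolding U(3) sum_subtractf[symmetric] by (rule sum.cong) (use A in \<open>auto simp: \<epsilon>_def scaleR_2\<close>)
      also have "\<dots> = 2 *\<^sub>R sF (\<phi> (h (a l)) d) (y (h (a l)))" using iN by simp
      finally have "norm (blinfun_apply (U (insert (h (a l)) A)) d - blinfun_apply (U A) d)
          = 2 * (norm (\<phi> (h (a l)) d) * norm (y (h (a l))))" by (simp add: F.norm_scale)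
      also have "\<dots> \<ge> 2 * ((1 / 16) * (1 / 4))"
        using good[OF al] sys(4)[OF iN] unfolding d by (intro mult_left_mono mult_mono) auto
      finally have "1 / 64 \<le> norm (blinfun_apply (U (insert (h (a l)) A)) d) \<or> 1 / 64 \<le> norm (blinfun_apply (U A) d)"
        using norm_triangle_ineq4[of "blinfun_apply (U (insert (h (a l)) A)) d" "blinfun_apply (U A) d"] by linarith
      then show "(1 / 64) powr p \<le> G A l \<or> (1 / 64) powr p \<le> G (insert (h (a l)) A) l"
        using p unfolding G_def d_def[symmetric] by (auto intro: powr_mono2)
    qed
    then have "(\<Sum>l<M. real (card (Pow {..<N})) * (1 / 64) powr p / 2) \<le> (\<Sum>l<M. \<Sum>A\<in>Pow {..<N}. G A l)"
      by (intro sum_mono) auto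
    also have "\<dots> = (\<Sum>A\<in>Pow {..<N}. \<Sum>l<M. G A l)" by (rule sum.swap)
    finally have le: "(\<Sum>A\<in>Pow {..<N}. real M * (1 / 64) powr p / 2) \<le> (\<Sum>A\<in>Pow {..<N}. \<Sum>l<M. G A l)"
      by (simp add: mult_ac)
    \<comment> \<open>Some sign choice does at least as well as the average, simultaneously for the
      whole list.\<close>
    have "\<exists>A\<in>Pow {..<N}. real M * (1 / 64) powr p / 2 \<le> (\<Sum>l<M. G A l)"
    proof (rule ccontr)
      assume "\<not> ?thesis"
      then have "(\<Sum>A\<in>Pow {..<N}. \<Sum>l<M. G A l) < (\<Sum>A\<in>Pow {..<N}. real M * (1 / 64) powr p / 2)"
        by (intro sum_strict_mono) (auto simp: not_le)
      then show False using le by simp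
    qed
    then show ?thesis using U(1,2) unfolding G_def by blast
  qed
  moreover have "norm (w i) \<le> 1" for i using sys(2)[OF hN[of i]] by (simp add: w_def)
  ultimately show ?thesis by (intro exI[of _ w]) blast
qed

end

context kbanach
begin

text \<open>What boundedness of the summing norms leaves of the separation, in terms of \<open>E\<close> alone.\<close>

definition well_separated :: "real \<Rightarrow> nat \<Rightarrow> (nat \<Rightarrow> 'a) \<Rightarrow> bool" where
  "well_separated \<eta> q y \<longleftrightarrow> (\<forall>i. norm (y i) \<le> 1)
     \<and> (\<forall>M a b. (\<forall>l<M. a l < b l \<and> b l < q) \<longrightarrow>
          (\<exists>\<psi>\<in>dual_ball scale. 2 * \<eta> * real M \<le> (\<Sum>l<M. norm (\<psi> (y (a l) - y (b l))))))"

end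

context kbanach_pair
begin

text \<open>The separating operators are tested on the differences, and the summing bound converts
  their large strong norm into a functional with large \<open>p\<close>-norm on the list. Since its
  values are at most 2 in norm and \<open>p >= 1\<close>, each \<open>p\<close>-th power is at most
  \<open>2 powr p\<close> times the first power.\<close>

lemma well_separated_of_bounded:
  assumes E: "\<forall>S :: 'a set. finite S \<longrightarrow> span S \<noteq> UNIV" and F: "\<forall>S :: 'b set. finite S \<longrightarrow> span S \<noteq> UNIV"
    and p: "p \<ge> 1"
    and bdd: "\<And>T m x. T \<in> fin_ops \<Longrightarrow> norm T \<le> 1 \<Longrightarrow>
      pnorm p m (\<lambda>i. blinfun_apply T (x i)) \<le> C * wnorm p sE m x"
  shows "\<exists>\<eta>>0. \<forall>q. \<exists>y. E.well_separated \<eta> q y"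
proof -
  define B where "B = (real DIM('k))\<^sup>2 * \<bar>C\<bar> + 1"
  \<comment> \<open>The factor 2 keeps \<open>\<beta> * r\<close> strictly below the supremum
    \<open>wnorm\<close>, so that some functional exceeds it.\<close>
  define \<beta> where "\<beta> = (1 / 64) / (2 * B)"
  define \<eta> where "\<eta> = \<beta> powr p / (4 * 2 powr p)"
  have B: "B > 0" by (simp add: B_def add_nonneg_pos)
  have \<beta>: "\<beta> > 0" using B by (simp add: \<beta>_def)
  have \<eta>: "\<eta> > 0" using \<beta> by (simp add: \<eta>_def)
  have "\<exists>y. E.well_separated \<eta> q y" for q
  proof -
    obtain z :: "nat \<Rightarrow> 'a" where z: "\<forall>i. norm (z i) \<le> 1"
      and sep: "\<forall>M a b. (\<forall>l<M. a l < b l \<and> b l < q) \<longrightarrow> (\<exists>u\<in>fin_ops. norm u \<le> (real DIM('k))\<^sup>2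
        \<and> real M * (1 / 64) powr p / 2 \<le> (\<Sum>l<M. norm (blinfun_apply u (z (a l) - z (b l))) powr p))"
      using separated_points_operators[OF E F p, of q] by (elim exE conjE) (rule that)
    have "\<exists>\<psi>\<in>dual_ball sE. 2 * \<eta> * real M \<le> (\<Sum>l<M. norm (\<psi> (z (a l) - z (b l))))"
      if ab: "\<forall>l<M. a l < b l \<and> b l < q" for M a b
    proof (cases "M = 0")
      case True
      then show ?thesis using E.zero_in_dual_ball by (intro bexI[of _ "\<lambda>x. 0"]) auto
    next
      case False
      define x where "x = (\<lambda>l. z (a l) - z (b l))"
      obtain u where u: "u \<in> fin_ops" "norm u \<le> (real DIM('k))\<^sup>2"
        "real M * (1 / 64) powr p / 2 \<le> (\<Sum>l<M. norm (blinfun_apply u (x l)) powr p)"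
        using sep[rule_format, of M a b] ab unfolding x_def by blast
      define r where "r = (real M / 2) powr (1 / p)"
      have r: "r > 0" using False by (simp add: r_def)
      have rp: "r powr p = real M / 2" using p by (simp add: r_def powr_powr)
      have "(1 / 64) * r = (real M * (1 / 64) powr p / 2) powr (1 / p)"
        using p by (simp add: r_def powr_mult powr_divide powr_powr)
      also have "\<dots> \<le> pnorm p M (\<lambda>l. blinfun_apply u (x l))"
        unfolding pnorm_def using u(3) p by (intro powr_mono2) auto
      also have "\<dots> \<le> B * wnorm p sE M x"
      proof -
        define D where "D = (real DIM('k))\<^sup>2"
        have D: "D > 0" using DIM_positive[where 'a = 'k] by (simp add: D_def)
        define T where "T = (1 / D) *\<^sub>R u"
        have "norm T \<le> 1" using u(2) D by (simp add: T_def D_def[symmetric])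
        then have "pnorm p M (\<lambda>l. blinfun_apply T (x l)) \<le> C * wnorm p sE M x"
          using bdd fin_ops_scaleR[OF u(1)] by (simp add: T_def)
        moreover have "pnorm p M (\<lambda>l. blinfun_apply u (x l)) = D * pnorm p M (\<lambda>l. blinfun_apply T (x l))"
          using D by (intro pnorm_cmult p) (auto simp: T_def blinfun.scaleR_left)
        ultimately have "pnorm p M (\<lambda>l. blinfun_apply u (x l)) \<le> D * (C * wnorm p sE M x)"
          using D by (simp add: mult_left_mono)
        also have "\<dots> \<le> B * wnorm p sE M x"
        proof -
          have "D * C \<le> D * \<bar>C\<bar>" using D by (intro mult_left_mono) auto
          then have "D * C \<le> B" by (simp add: B_def D_def[symmetric])
          then show ?thesis using E.wnorm_nonneg[OF p, of M x] by (simp add: mult.assoc[symmetric] mult_right_mono)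
        qed
        finally show ?thesis .
      qed
      finally have "2 * \<beta> * r \<le> wnorm p sE M x" using B by (simp add: \<beta>_def field_simps)
      moreover have "\<beta> * r < 2 * \<beta> * r" using \<beta> r by simp
      ultimately have "\<beta> * r < wnorm p sE M x" by simp
      then obtain \<psi> where \<psi>: "\<psi> \<in> dual_ball sE" "\<beta> * r < pnorm p M (\<lambda>l. \<psi> (x l))"
        using E.wnorm_less_obtain[OF p] by blast
      have "\<beta> powr p * (real M / 2) = (\<beta> * r) powr p" using \<beta> r by (simp add: powr_mult rp)
      also have "\<dots> \<le> pnorm p M (\<lambda>l. \<psi> (x l)) powr p" using \<psi>(2) \<beta> r p by (intro powr_mono2) auto
      also have "\<dots> = (\<Sum>l<M. norm (\<psi> (x l)) powr p)" by (rule pnorm_powr[OF p])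
      also have "\<dots> \<le> (\<Sum>l<M. 2 powr p * norm (\<psi> (x l)))"
      proof (rule sum_mono)
        fix l
        have "norm (\<psi> (x l)) \<le> norm (x l)" using \<psi>(1) by (simp add: E.dual_ball_iff)
        also have "\<dots> \<le> 2" using norm_triangle_ineq4[of "z (a l)" "z (b l)"] spec[OF z, of "a l"] spec[OF z, of "b l"] by (simp add: x_def)
        finally have t: "norm (\<psi> (x l)) / 2 \<le> 1" by simp
        have "(norm (\<psi> (x l)) / 2) powr p \<le> (norm (\<psi> (x l)) / 2) powr 1"
          using t p by (intro powr_mono') auto
        then have "norm (\<psi> (x l)) powr p \<le> 2 powr p * (norm (\<psi> (x l)) / 2)"
          by (simp add: powr_divide field_simps)
        also have "\<dots> \<le> 2 powr p * norm (\<psi> (x l))" by (intro mult_left_mono) auto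
        finally show "norm (\<psi> (x l)) powr p \<le> 2 powr p * norm (\<psi> (x l))" .
      qed
      finally have "\<beta> powr p * (real M / 2) \<le> 2 powr p * (\<Sum>l<M. norm (\<psi> (x l)))"
        by (simp add: sum_distrib_left)
      then have "2 * \<eta> * real M \<le> (\<Sum>l<M. norm (\<psi> (x l)))"
        by (simp add: \<eta>_def field_simps)
      then show ?thesis using \<psi>(1) unfolding x_def by blast
    qed
    then show ?thesis unfolding E.well_separated_def using z by blast
  qed
  then show ?thesis using \<eta> by blast
qed

end

section \<open>Spreading limits\<close>

text \<open>Tychonoff compactness: by \<open>anti\<close> the closures of the sets of
  \<open>h\<close> with \<open>P A \<epsilon> h\<close> have the finite intersection property, and a
  common point serves as \<open>g\<close>. Applied to the spreading norms and later to evaluations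
  at unit vectors.\<close>

lemma cluster_function:
  fixes P :: "'c set \<Rightarrow> real \<Rightarrow> ('c \<Rightarrow> 'm::{heine_borel,real_normed_vector}) \<Rightarrow> bool"
  assumes ex: "\<And>A \<epsilon>. finite A \<Longrightarrow> \<epsilon> > 0 \<Longrightarrow> \<exists>h. P A \<epsilon> h \<and> (\<forall>c. norm (h c) \<le> B c)"
    and anti: "\<And>A A' \<epsilon> \<epsilon>' h. P A' \<epsilon>' h \<Longrightarrow> A \<subseteq> A' \<Longrightarrow> 0 < \<epsilon>' \<Longrightarrow> \<epsilon>' \<le> \<epsilon> \<Longrightarrow> P A \<epsilon> h"
  shows "\<exists>g. \<forall>A \<epsilon>. finite A \<longrightarrow> \<epsilon> > 0 \<longrightarrow> (\<exists>h. P A \<epsilon> h \<and> (\<forall>c\<in>A. norm (h c - g c) < \<epsilon>))"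
proof -
  define U where "U = {h :: 'c \<Rightarrow> 'm. \<forall>c. norm (h c) \<le> B c}"
  have "U = PiE UNIV (\<lambda>c. cball 0 (B c))" by (auto simp: U_def)
  moreover have "compactin (product_topology (\<lambda>c :: 'c. euclidean :: 'm topology) UNIV) (PiE UNIV (\<lambda>c. cball 0 (B c)))"
    unfolding compactin_PiE by auto
  ultimately have "compact U" by (simp add: euclidean_product_topology)
  define I :: "('c set \<times> real) set" where "I = {(A, \<epsilon>) |A \<epsilon>. finite A \<and> \<epsilon> > 0}"
  define S where "S = (\<lambda>(A, \<epsilon>). closure {h \<in> U. P A \<epsilon> h})"
  have "U \<inter> \<Inter> (S ` I) \<noteq> {}"
  proof (rule compact_imp_fip[OF \<open>compact U\<close>])
    show "closed T" if "T \<in> S ` I" for T using that by (auto simp: S_def)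
    fix F' assume F': "finite F'" "F' \<subseteq> S ` I"
    then obtain J where J: "J \<subseteq> I" "finite J" "F' = S ` J" using finite_subset_image by metis
    define A where "A = (\<Union>i\<in>J. fst i)"
    define \<epsilon> where "\<epsilon> = Min (insert 1 (snd ` J))"
    have "finite A" using J(1,2) by (auto simp: A_def I_def)
    moreover have "\<epsilon> > 0" using J(1,2) by (auto simp: \<epsilon>_def I_def)
    ultimately obtain h where h: "P A \<epsilon> h" "\<forall>c. norm (h c) \<le> B c" using ex by blast
    have "h \<in> S i" if i: "i \<in> J" for i
    proof -
      have "P (fst i) (snd i) h"
        by (rule anti[OF h(1) _ \<open>\<epsilon> > 0\<close>]) (use i J(2) in \<open>auto simp: A_def \<epsilon>_def\<close>)
      then have "h \<in> {h \<in> U. P (fst i) (snd i) h}" using h(2) by (simp add: U_def)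
      then have "h \<in> closure {h \<in> U. P (fst i) (snd i) h}" by (rule subsetD[OF closure_subset])
      then show ?thesis by (simp add: S_def case_prod_unfold)
    qed
    then show "U \<inter> \<Inter> F' \<noteq> {}" using h(2) J(3) by (auto simp: U_def)
  qed
  then obtain g where g: "\<And>A \<epsilon>. finite A \<Longrightarrow> \<epsilon> > 0 \<Longrightarrow> g \<in> closure {h \<in> U. P A \<epsilon> h}"
    by (auto simp: S_def I_def)
  have "\<exists>h. P A \<epsilon> h \<and> (\<forall>c\<in>A. norm (h c - g c) < \<epsilon>)" if A: "finite A" "\<epsilon> > 0" for A \<epsilon>
  proof -
    have "open (\<Inter>c\<in>A. {h. norm (h c - g c) < \<epsilon>})"
      using A(1) by (intro open_INT ballI open_Collect_less continuous_intros continuous_on_product_coordinates) auto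
    moreover have "g \<in> (\<Inter>c\<in>A. {h. norm (h c - g c) < \<epsilon>})" using A(2) by simp
    ultimately have "(\<Inter>c\<in>A. {h. norm (h c - g c) < \<epsilon>}) \<inter> {h \<in> U. P A \<epsilon> h} \<noteq> {}"
      using g[OF A] open_Int_closure_eq_empty by blast
    then show ?thesis by auto
  qed
  then show ?thesis by blast
qed

text \<open>An \<open>r\<close>-set is coloured by the tuple, over \<open>a\<close> in
  \<open>A\<close>, of its values rounded to multiples of \<open>\<epsilon>\<close>. There are
  finitely many such tuples, so one homogeneous set works for all \<open>a\<close> at once.\<close>

lemma ramsey_stable_values:
  fixes A :: "'c set" and B \<epsilon> :: real
  assumes "finite A" "\<epsilon> > 0"
  shows "\<exists>N. \<forall>V :: 'c \<Rightarrow> nat set \<Rightarrow> real. (\<forall>a\<in>A. \<forall>R. 0 \<le> V a R \<and> V a R \<le> B) \<longrightarrow>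
    (\<exists>H\<subseteq>{..<N}. card H = n \<and> (\<forall>a\<in>A. \<forall>R R'. R \<subseteq> H \<and> card R = r \<and> R' \<subseteq> H \<and> card R' = r
        \<longrightarrow> \<bar>V a R - V a R'\<bar> \<le> \<epsilon>))"
proof -
  define K where "K = nat \<lfloor>B / \<epsilon>\<rfloor>"
  define X where "X = PiE A (\<lambda>_. {..K})"
  have "finite X" using assms(1) by (simp add: X_def finite_PiE)
  then obtain e where e: "bij_betw e X {0..<card X}" using ex_bij_betw_finite_nat by blast
  obtain N :: nat where N: "partn_lst {..<N} (replicate (card X) n) r" using ramsey_full[of "replicate (card X) n" r] by blast
  have main: "\<exists>H\<subseteq>{..<N}. card H = n \<and> (\<forall>a\<in>A. \<forall>R R'. R \<subseteq> H \<and> card R = r \<and> R' \<subseteq> H \<and> card R' = r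
        \<longrightarrow> \<bar>V a R - V a R'\<bar> \<le> \<epsilon>)"
    if V: "\<forall>a\<in>A. \<forall>R. 0 \<le> V a R \<and> V a R \<le> B" for V :: "'c \<Rightarrow> nat set \<Rightarrow> real"
  proof -
    define c where "c = (\<lambda>R. \<lambda>a\<in>A. nat \<lfloor>V a R / \<epsilon>\<rfloor>)"
    have c: "c R \<in> X" for R
    proof -
      have "nat \<lfloor>V a R / \<epsilon>\<rfloor> \<le> K" if "a \<in> A" for a
        unfolding K_def using V that assms(2) by (intro nat_mono floor_mono divide_right_mono) auto
      then show ?thesis by (auto simp: c_def X_def)
    qed
    have "(e \<circ> c) \<in> nsets {..<N} r \<rightarrow> {..<card X}"
      using bij_betwE[OF e] c by auto
    then obtain i H where iH: "i < length (replicate (card X) n)" "H \<in> nsets {..<N} (replicate (card X) n ! i)"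
      "(e \<circ> c) ` nsets H r \<subseteq> {i}"
      by (rule partn_lstE[OF N]) auto
    then have H: "H \<subseteq> {..<N}" "card H = n" by (auto simp: nsets_def)
    have finH: "finite H" using H(1) finite_subset by blast
    have "\<bar>V a R - V a R'\<bar> \<le> \<epsilon>"
      if a: "a \<in> A" and R: "R \<subseteq> H" "card R = r" "R' \<subseteq> H" "card R' = r" for a R R'
    proof -
      have "R \<in> nsets H r" "R' \<in> nsets H r" using R finH by (auto simp: nsets_def intro: finite_subset)
      then have "e (c R) = e (c R')" using iH(3) by auto
      then have "c R = c R'" using e c by (auto simp: bij_betw_def inj_on_def)
      then have "nat \<lfloor>V a R / \<epsilon>\<rfloor> = nat \<lfloor>V a R' / \<epsilon>\<rfloor>" using a by (auto simp: c_def dest: fun_cong[where x = a])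
      moreover have "V a R / \<epsilon> \<ge> 0" "V a R' / \<epsilon> \<ge> 0" using V a assms(2) by auto
      ultimately have "\<lfloor>V a R / \<epsilon>\<rfloor> = \<lfloor>V a R' / \<epsilon>\<rfloor>" by (simp add: nat_eq_iff2)
      then have "\<bar>V a R / \<epsilon> - V a R' / \<epsilon>\<bar> \<le> 1" by linarith
      then have "\<bar>V a R - V a R'\<bar> / \<epsilon> \<le> 1" using assms(2) by (simp add: diff_divide_distrib[symmetric] abs_divide)
      then show ?thesis using assms(2) by (simp add: pos_divide_le_eq)
    qed
    then show ?thesis using H by (intro exI[of _ H]) blast
  qed
  show ?thesis by (rule exI[of _ N], intro allI impI, rule main)
qed

text \<open>Ramsey's theorem speaks of sets of positions, spreading of increasing maps; this
  translates between them.\<close>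

lemma sorted_list_of_strict_mono_image:
  fixes \<sigma> :: "nat \<Rightarrow> nat"
  assumes "strict_mono_on {..<r} \<sigma>" "i < r"
  shows "sorted_list_of_set (\<sigma> ` {..<r}) ! i = \<sigma> i"
proof -
  have "sorted (map \<sigma> [0..<r])"
    unfolding sorted_iff_nth_mono using assms(1) by (auto simp: strict_mono_on_def le_less)
  moreover have "distinct (map \<sigma> [0..<r])"
    using strict_mono_on_imp_inj_on[OF assms(1)] by (simp add: distinct_map atLeast0LessThan)
  ultimately have "sorted_list_of_set (set (map \<sigma> [0..<r])) = map \<sigma> [0..<r]"
    by (rule sorted_list_of_set.idem_if_sorted_distinct)
  then show ?thesis using assms(2) by (simp add: atLeast0LessThan)
qed

definition c00 :: "(nat \<Rightarrow> 'k::zero) set" where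
  "c00 = {a. \<exists>m. \<forall>i\<ge>m. a i = 0}"

context kbanach
begin

lemma well_separated_subsequence:
  assumes y: "well_separated \<eta> q y" and h: "strict_mono_on {..<n} h" "h ` {..<n} \<subseteq> {..<q}"
  shows "well_separated \<eta> n (\<lambda>i. if i < n then y (h i) else 0)"
  unfolding well_separated_def
proof (intro conjI allI impI)
  show "norm (if i < n then y (h i) else 0) \<le> 1" for i
    using y by (simp add: well_separated_def)
  fix M and a b :: "nat \<Rightarrow> nat"
  assume ab: "\<forall>l<M. a l < b l \<and> b l < n"
  then have an: "a l < n" "b l < n" if "l < M" for l using that by (auto dest!: spec[of _ l])
  have "\<forall>l<M. h (a l) < h (b l) \<and> h (b l) < q"
    using ab h(1) an h(2) unfolding strict_mono_on_def image_subset_iff lessThan_iff by blast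
  then obtain \<psi> where "\<psi> \<in> dual_ball scale" "2 * \<eta> * real M \<le> (\<Sum>l<M. norm (\<psi> (y (h (a l)) - y (h (b l)))))"
    using y[unfolded well_separated_def, THEN conjunct2, rule_format, of M "\<lambda>l. h (a l)" "\<lambda>l. h (b l)"] by blast
  then show "\<exists>\<psi>\<in>dual_ball scale. 2 * \<eta> * real M
      \<le> (\<Sum>l<M. norm (\<psi> ((if a l < n then y (h (a l)) else 0) - (if b l < n then y (h (b l)) else 0))))"
    using an by (intro bexI[of _ \<psi>]) (auto cong: sum.cong_simp)
qed

text \<open>By Ramsey's theorem and compactness, arbitrarily long well separated sequences have a
  limit in which the norm of a linear combination does not change when it is spread out.\<close>

lemma spreading_limit:
  assumes sep: "\<And>q. \<exists>y. well_separated \<eta> q y"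
  shows "\<exists>g :: (nat \<Rightarrow> 'k) \<Rightarrow> real. \<forall>A \<epsilon> L. finite A \<longrightarrow> A \<subseteq> c00 \<longrightarrow> \<epsilon> > 0 \<longrightarrow>
    (\<exists>r q y. well_separated \<eta> q y \<and> 2 * r + L \<le> q \<and> (\<forall>a\<in>A. \<forall>i\<ge>r. a i = 0)
      \<and> (\<forall>a\<in>A. \<forall>\<sigma>. strict_mono_on {..<r} \<sigma> \<longrightarrow> \<sigma> ` {..<r} \<subseteq> {..<q} \<longrightarrow>
          \<bar>norm (\<Sum>i<r. scale (a i) (y (\<sigma> i))) - g a\<bar> \<le> \<epsilon>))"
proof -
  \<comment> \<open>\<open>h\<close> records, up to \<open>\<epsilon>\<close>, the values on
    \<open>A\<close> of one well separated sequence. The term \<open>1 / \<epsilon>\<close> forces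
    spare length as \<open>\<epsilon>\<close> shrinks, and \<open>2 * r\<close> is reserved because
    \<open>r\<close> differences use \<open>2 * r\<close> points. Intersecting with
    \<open>c00\<close> is needed as \<open>cluster_function\<close> ranges over all finite
    sets.\<close>
  define P :: "(nat \<Rightarrow> 'k) set \<Rightarrow> real \<Rightarrow> ((nat \<Rightarrow> 'k) \<Rightarrow> real) \<Rightarrow> bool" where
    "P = (\<lambda>A \<epsilon> h. \<exists>r q y. well_separated \<eta> q y \<and> real (2 * r) + 1 / \<epsilon> \<le> real q
      \<and> (\<forall>a\<in>A \<inter> c00. \<forall>i\<ge>r. a i = 0)
      \<and> (\<forall>a\<in>A \<inter> c00. \<forall>\<sigma>. strict_mono_on {..<r} \<sigma> \<longrightarrow> \<sigma> ` {..<r} \<subseteq> {..<q} \<longrightarrow>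
          \<bar>norm (\<Sum>i<r. scale (a i) (y (\<sigma> i))) - h a\<bar> \<le> \<epsilon>))"
  \<comment> \<open>The sum over an infinite support is 0 by convention; this is consistent because
    the approximants vanish outside \<open>c00\<close>.\<close>
  define B where "B = (\<lambda>a :: nat \<Rightarrow> 'k. \<Sum>i\<in>{i. a i \<noteq> 0}. norm (a i))"
  have Bn: "B a \<ge> 0" for a by (simp add: B_def sum_nonneg)
  have "\<exists>g. \<forall>A \<epsilon>. finite A \<longrightarrow> \<epsilon> > 0 \<longrightarrow> (\<exists>h. P A \<epsilon> h \<and> (\<forall>c\<in>A. norm (h c - g c) < \<epsilon>))"
  proof (rule cluster_function)
    fix A A' \<epsilon> \<epsilon>' h
    assume P: "P A' \<epsilon>' h" and A: "A \<subseteq> A'" "0 < \<epsilon>'" "\<epsilon>' \<le> (\<epsilon> :: real)"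
    then have le: "1 / \<epsilon> \<le> 1 / \<epsilon>'" by (simp add: frac_le)
    obtain r q y where y: "well_separated \<eta> q y" and q: "real (2 * r) + 1 / \<epsilon>' \<le> real q"
      and r: "\<forall>a\<in>A' \<inter> c00. \<forall>i\<ge>r. a i = 0"
      and h: "\<forall>a\<in>A' \<inter> c00. \<forall>\<sigma>. strict_mono_on {..<r} \<sigma> \<longrightarrow> \<sigma> ` {..<r} \<subseteq> {..<q} \<longrightarrow>
          \<bar>norm (\<Sum>i<r. scale (a i) (y (\<sigma> i))) - h a\<bar> \<le> \<epsilon>'"
      using P unfolding P_def by (elim exE conjE) (rule that)
    show "P A \<epsilon> h"
      unfolding P_def
    proof (intro exI conjI ballI allI impI)
      show "well_separated \<eta> q y" by (rule y)
      show "real (2 * r) + 1 / \<epsilon> \<le> real q" using q le by linarith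
      show "a i = 0" if "a \<in> A \<inter> c00" "i \<ge> r" for a i using r A(1) that by blast
      fix a \<sigma> assume a: "a \<in> A \<inter> c00" "strict_mono_on {..<r} \<sigma>" "\<sigma> ` {..<r} \<subseteq> {..<q}"
      have "a \<in> A' \<inter> c00" using a(1) A(1) by blast
      from h[rule_format, OF this a(2,3)] A(3)
      show "\<bar>norm (\<Sum>i<r. scale (a i) (y (\<sigma> i))) - h a\<bar> \<le> \<epsilon>" by linarith
    qed
  next
    fix A :: "(nat \<Rightarrow> 'k) set" and \<epsilon> :: real assume A: "finite A" "\<epsilon> > 0"
    define A' where "A' = A \<inter> c00"
    have A': "finite A'" using A(1) by (simp add: A'_def)
    have "\<forall>a\<in>A'. \<exists>m. \<forall>i\<ge>m. a i = 0" by (simp add: A'_def c00_def)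
    then obtain m where m: "\<And>a i. a \<in> A' \<Longrightarrow> i \<ge> m a \<Longrightarrow> a i = 0" by metis
    define r where "r = (\<Sum>a\<in>A'. m a)"
    have r: "a i = 0" if "a \<in> A'" "i \<ge> r" for a i
      using m[OF that(1)] member_le_sum[of a A' m] that A' by (simp add: r_def)
    define n where "n = 2 * r + nat \<lceil>1 / \<epsilon>\<rceil>"
    define C where "C = (\<Sum>a\<in>A'. \<Sum>i<r. norm (a i))"
    obtain N where N: "\<forall>V :: (nat \<Rightarrow> 'k) \<Rightarrow> nat set \<Rightarrow> real. (\<forall>a\<in>A'. \<forall>R. 0 \<le> V a R \<and> V a R \<le> C) \<longrightarrow>
      (\<exists>H\<subseteq>{..<N}. card H = n \<and> (\<forall>a\<in>A'. \<forall>R R'. R \<subseteq> H \<and> card R = r \<and> R' \<subseteq> H \<and> card R' = r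
        \<longrightarrow> \<bar>V a R - V a R'\<bar> \<le> \<epsilon>))"
      using ramsey_stable_values[OF A' A(2), of C n r] by (rule exE)
    obtain y0 where y0: "well_separated \<eta> N y0" using sep by blast
    define V where "V = (\<lambda>a R. norm (\<Sum>i<r. scale (a i) (y0 (sorted_list_of_set R ! i))))"
    have le: "norm (\<Sum>i<r. scale (a i) (y i)) \<le> (\<Sum>i<r. norm (a i))"
      if "\<And>i. norm (y i) \<le> 1" for a and y :: "nat \<Rightarrow> 'a"
      using that by (intro sum_norm_le) (simp add: norm_scale mult_left_le)
    have y0_le: "norm (y0 i) \<le> 1" for i using y0 by (simp add: well_separated_def)
    have "\<forall>a\<in>A'. \<forall>R. 0 \<le> V a R \<and> V a R \<le> C"
    proof (intro ballI allI conjI)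
      fix a R assume a: "a \<in> A'"
      show "0 \<le> V a R" by (simp add: V_def)
      have "V a R \<le> (\<Sum>i<r. norm (a i))" unfolding V_def by (rule le) (rule y0_le)
      also have "\<dots> \<le> C" unfolding C_def using A' a by (intro member_le_sum) (auto intro: sum_nonneg)
      finally show "V a R \<le> C" .
    qed
    then have "\<exists>H\<subseteq>{..<N}. card H = n \<and> (\<forall>a\<in>A'. \<forall>R R'. R \<subseteq> H \<and> card R = r \<and> R' \<subseteq> H \<and> card R' = r
        \<longrightarrow> \<bar>V a R - V a R'\<bar> \<le> \<epsilon>)"
      by (rule N[THEN spec, THEN mp])
    then obtain H where H: "H \<subseteq> {..<N}" "card H = n"
      "\<And>a R R'. a \<in> A' \<Longrightarrow> R \<subseteq> H \<Longrightarrow> card R = r \<Longrightarrow> R' \<subseteq> H \<Longrightarrow> card R' = r \<Longrightarrow> \<bar>V a R - V a R'\<bar> \<le> \<epsilon>"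
      by blast
    have "finite H" using H(1) finite_subset by blast
    then obtain h where h: "bij_betw h {..<n} H" "strict_mono_on {..<n} h"
      using ex_bij_betw_strict_mono_card H(2) by metis
    define y where "y = (\<lambda>i. if i < n then y0 (h i) else 0)"
    have y: "well_separated \<eta> n y"
      unfolding y_def by (rule well_separated_subsequence[OF y0 h(2)]) (use h(1) H(1) in \<open>auto simp: bij_betw_def\<close>)
    define v where "v = (\<lambda>a. if a \<in> A' then norm (\<Sum>i<r. scale (a i) (y i)) else 0)"
    have val: "norm (\<Sum>i<r. scale (a i) (y (\<sigma> i))) = V a ((h \<circ> \<sigma>) ` {..<r})"
        "(h \<circ> \<sigma>) ` {..<r} \<subseteq> H" "card ((h \<circ> \<sigma>) ` {..<r}) = r"
      if \<sigma>: "strict_mono_on {..<r} \<sigma>" "\<sigma> ` {..<r} \<subseteq> {..<n}" for a \<sigma>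
    proof -
      have mono: "strict_mono_on {..<r} (h \<circ> \<sigma>)"
        using \<sigma> h(2) by (auto simp: strict_mono_on_def image_subset_iff)
      have "(\<Sum>i<r. scale (a i) (y (\<sigma> i))) = (\<Sum>i<r. scale (a i) (y0 (sorted_list_of_set ((h \<circ> \<sigma>) ` {..<r}) ! i)))"
        by (rule sum.cong) (use \<sigma>(2) sorted_list_of_strict_mono_image[OF mono] in \<open>auto simp: y_def\<close>)
      then show "norm (\<Sum>i<r. scale (a i) (y (\<sigma> i))) = V a ((h \<circ> \<sigma>) ` {..<r})" by (simp add: V_def)
      show "(h \<circ> \<sigma>) ` {..<r} \<subseteq> H" using \<sigma>(2) h(1) by (auto simp: bij_betw_def)
      show "card ((h \<circ> \<sigma>) ` {..<r}) = r"
        unfolding card_image[OF strict_mono_on_imp_inj_on[OF mono]] by simp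
    qed
    have id: "strict_mono_on {..<r} (\<lambda>i. i)" "(\<lambda>i. i) ` {..<r} \<subseteq> {..<n}"
      by (auto simp: strict_mono_on_def n_def)
    have "P A \<epsilon> v"
      unfolding P_def A'_def[symmetric]
    proof (intro exI conjI ballI allI impI)
      show "well_separated \<eta> n y" by (rule y)
      show "real (2 * r) + 1 / \<epsilon> \<le> real n" by (simp add: n_def) (use real_nat_ceiling_ge in blast)
      show "a i = 0" if "a \<in> A'" "i \<ge> r" for a i using r that .
      fix a \<sigma> assume a: "a \<in> A'" and \<sigma>: "strict_mono_on {..<r} \<sigma>" "\<sigma> ` {..<r} \<subseteq> {..<n}"
      show "\<bar>norm (\<Sum>i<r. scale (a i) (y (\<sigma> i))) - v a\<bar> \<le> \<epsilon>"
        using H(3)[OF a val(2,3)[OF \<sigma>] val(2,3)[OF id]] val(1)[OF \<sigma>, of a] val(1)[OF id, of a] a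
        by (simp add: v_def)
    qed
    moreover have "norm (v a) \<le> B a" for a
    proof (cases "a \<in> A'")
      case True
      have "norm (v a) \<le> (\<Sum>i<r. norm (a i))"
        using True le[of y a] y by (simp add: v_def well_separated_def)
      also have "\<dots> = B a"
        unfolding B_def using r[OF True] by (intro sum.mono_neutral_right) (auto simp: not_le[symmetric])
      finally show ?thesis .
    qed (simp add: v_def Bn)
    ultimately show "\<exists>h. P A \<epsilon> h \<and> (\<forall>c. norm (h c) \<le> B c)" by blast
  qed
  then obtain g where g: "\<And>A \<epsilon>. finite A \<Longrightarrow> \<epsilon> > 0 \<Longrightarrow> \<exists>h. P A \<epsilon> h \<and> (\<forall>c\<in>A. norm (h c - g c) < \<epsilon>)" by metis
  have "\<exists>r q y. well_separated \<eta> q y \<and> 2 * r + L \<le> q \<and> (\<forall>a\<in>A. \<forall>i\<ge>r. a i = 0)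
      \<and> (\<forall>a\<in>A. \<forall>\<sigma>. strict_mono_on {..<r} \<sigma> \<longrightarrow> \<sigma> ` {..<r} \<subseteq> {..<q} \<longrightarrow>
          \<bar>norm (\<Sum>i<r. scale (a i) (y (\<sigma> i))) - g a\<bar> \<le> \<epsilon>)"
    if A: "finite A" "A \<subseteq> c00" "\<epsilon> > 0" for A \<epsilon> and L :: nat
  proof -
    \<comment> \<open>The second term of the minimum turns the spare length
      \<open>1 / \<delta>\<close> into at least \<open>L\<close>.\<close>
    define \<delta> where "\<delta> = min (\<epsilon> / 2) (1 / (real L + 1))"
    have \<delta>: "\<delta> > 0" "\<delta> \<le> \<epsilon> / 2" "real L \<le> 1 / \<delta>"
    proof -
      show "\<delta> > 0" "\<delta> \<le> \<epsilon> / 2" using A(3) by (auto simp: \<delta>_def)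
      have "real L + 1 = 1 / (1 / (real L + 1))" by simp
      also have "\<dots> \<le> 1 / \<delta>" using \<open>\<delta> > 0\<close> by (intro frac_le) (auto simp: \<delta>_def)
      finally show "real L \<le> 1 / \<delta>" by simp
    qed
    obtain h where h: "P A \<delta> h" "\<forall>c\<in>A. norm (h c - g c) < \<delta>" using g[OF A(1) \<delta>(1)] by blast
    have "A \<inter> c00 = A" using A(2) by auto
    obtain r q y where rqy: "well_separated \<eta> q y" "real (2 * r) + 1 / \<delta> \<le> real q" "\<forall>a\<in>A. \<forall>i\<ge>r. a i = 0"
      "\<forall>a\<in>A. \<forall>\<sigma>. strict_mono_on {..<r} \<sigma> \<longrightarrow> \<sigma> ` {..<r} \<subseteq> {..<q} \<longrightarrow>
          \<bar>norm (\<Sum>i<r. scale (a i) (y (\<sigma> i))) - h a\<bar> \<le> \<delta>"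
      using h(1) unfolding P_def \<open>A \<inter> c00 = A\<close> by (elim exE conjE) (rule that)
    have "\<bar>norm (\<Sum>i<r. scale (a i) (y (\<sigma> i))) - g a\<bar> \<le> \<epsilon>"
      if "a \<in> A" "strict_mono_on {..<r} \<sigma>" "\<sigma> ` {..<r} \<subseteq> {..<q}" for a \<sigma>
    proof -
      have "\<bar>norm (\<Sum>i<r. scale (a i) (y (\<sigma> i))) - h a\<bar> \<le> \<delta>" using rqy(4) that by blast
      moreover have "\<bar>h a - g a\<bar> < \<delta>" using h(2) that(1) by simp
      ultimately show ?thesis using \<delta>(2) by linarith
    qed
    moreover have "2 * r + L \<le> q" using rqy(2) \<delta>(3) by linarith
    ultimately show ?thesis using rqy(1,3) by blast
  qed
  then show ?thesis by (intro exI[of _ g] allI impI)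
qed

end

section \<open>Differences of consecutive terms: suppression and the l1-estimates\<close>

lemma c00I: "(\<And>i. i \<ge> m \<Longrightarrow> a i = 0) \<Longrightarrow> a \<in> c00"
  by (auto simp: c00_def)

text \<open>The coefficients of \<open>y i\<close> when the combination of the differences
  \<open>y (2 * j) - y (2 * j + 1)\<close> with coefficients \<open>a j\<close> is expanded.\<close>

definition diff_coeffs :: "(nat \<Rightarrow> 'k::ab_group_add) \<Rightarrow> nat \<Rightarrow> 'k" where
  "diff_coeffs a i = (if even i then a (i div 2) else - a (i div 2))"

lemma diff_coeffs_c00: "a \<in> c00 \<Longrightarrow> diff_coeffs a \<in> c00"
proof -
  assume "a \<in> c00"
  then obtain m where "\<forall>i\<ge>m. a i = 0" by (auto simp: c00_def)
  then have "diff_coeffs a i = 0" if "i \<ge> 2 * m" for i using that by (simp add: diff_coeffs_def)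
  then show ?thesis by (rule c00I)
qed

lemma sum_pairs: "(\<Sum>i<2 * m. f i) = (\<Sum>j<m. f (2 * j) + f (Suc (2 * j)) :: 'v::comm_monoid_add)"
  by (induction m) (simp_all add: add.assoc)

text \<open>One real coordinate carries a \<open>DIM('k)\<close>-th share of the absolute values,
  and one sign in it at least half of that share. Suppression can handle restriction to a subset,
  but not multiplication by arbitrary phases.\<close>

lemma large_partial_sum:
  fixes b :: "'i \<Rightarrow> 'k::euclidean_space"
  assumes "finite I"
  shows "\<exists>J\<subseteq>I. (\<Sum>j\<in>I. norm (b j)) \<le> 2 * real DIM('k) * norm (\<Sum>j\<in>J. b j)"
proof -
  have "(\<Sum>j\<in>I. norm (b j)) \<le> (\<Sum>j\<in>I. \<Sum>e\<in>Basis. \<bar>inner (b j) e\<bar>)"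
    by (intro sum_mono norm_le_l1)
  also have "\<dots> = (\<Sum>e\<in>Basis. \<Sum>j\<in>I. \<bar>inner (b j) e\<bar>)" by (rule sum.swap)
  finally have le: "(\<Sum>j\<in>I. norm (b j)) \<le> (\<Sum>e\<in>Basis. \<Sum>j\<in>I. \<bar>inner (b j) e\<bar>)" .
  have "\<exists>e\<in>Basis. (\<Sum>j\<in>I. norm (b j)) \<le> real DIM('k) * (\<Sum>j\<in>I. \<bar>inner (b j) e\<bar>)"
  proof (rule ccontr)
    assume "\<not> ?thesis"
    then have "(\<Sum>e\<in>(Basis :: 'k set). \<Sum>j\<in>I. \<bar>inner (b j) e\<bar>)
        < (\<Sum>e\<in>(Basis :: 'k set). (\<Sum>j\<in>I. norm (b j)) / real DIM('k))"
      by (intro sum_strict_mono) (auto simp: not_le field_simps)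
    then show False using le by simp
  qed
  then obtain e :: 'k where e: "e \<in> Basis" "(\<Sum>j\<in>I. norm (b j)) \<le> real DIM('k) * (\<Sum>j\<in>I. \<bar>inner (b j) e\<bar>)"
    by blast
  define P where "P = {j \<in> I. inner (b j) e \<ge> 0}"
  define Q where "Q = I - P"
  have "(\<Sum>j\<in>I. \<bar>inner (b j) e\<bar>) = (\<Sum>j\<in>P. \<bar>inner (b j) e\<bar>) + (\<Sum>j\<in>Q. \<bar>inner (b j) e\<bar>)"
    unfolding Q_def using assms by (subst sum.subset_diff[of P I]) (auto simp: P_def)
  also have "(\<Sum>j\<in>P. \<bar>inner (b j) e\<bar>) = inner (\<Sum>j\<in>P. b j) e"
    by (simp add: inner_sum_left P_def)
  also have "(\<Sum>j\<in>Q. \<bar>inner (b j) e\<bar>) = - inner (\<Sum>j\<in>Q. b j) e"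
    by (auto simp: inner_sum_left Q_def P_def sum_negf[symmetric] intro!: sum.cong)
  finally have sum: "(\<Sum>j\<in>I. \<bar>inner (b j) e\<bar>) \<le> norm (\<Sum>j\<in>P. b j) + norm (\<Sum>j\<in>Q. b j)"
    using Basis_le_norm[OF e(1), of "\<Sum>j\<in>P. b j"] Basis_le_norm[OF e(1), of "\<Sum>j\<in>Q. b j"] by linarith
  define J where "J = (if norm (\<Sum>j\<in>P. b j) \<ge> norm (\<Sum>j\<in>Q. b j) then P else Q)"
  have "(\<Sum>j\<in>I. \<bar>inner (b j) e\<bar>) \<le> 2 * norm (\<Sum>j\<in>J. b j)" using sum by (simp add: J_def)
  then have "(\<Sum>j\<in>I. norm (b j)) \<le> real DIM('k) * (2 * norm (\<Sum>j\<in>J. b j))"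
    using e(2) by (meson mult_left_mono of_nat_0_le_iff order_trans)
  then show ?thesis by (intro exI[of _ J]) (auto simp: J_def P_def Q_def)
qed

lemma le_of_all_pos:
  fixes x y C :: real
  assumes "\<And>\<epsilon>. \<epsilon> > 0 \<Longrightarrow> x \<le> y + \<epsilon> * C" "C \<ge> 0"
  shows "x \<le> y"
proof (rule field_le_epsilon)
  fix e :: real assume "e > 0"
  then have "x \<le> y + e / (C + 1) * C" using assms by (intro assms(1)) auto
  also have "e / (C + 1) * C \<le> e" using \<open>e > 0\<close> assms(2) by (simp add: field_simps)
  finally show "x \<le> y + e" by simp
qed

context kbanach
begin

lemma well_separated_diff:
  assumes "well_separated \<eta> q y" shows "norm (y i - y j) \<le> 2"
proof -
  have "norm (y i) \<le> 1" "norm (y j) \<le> 1" using assms by (simp_all add: well_separated_def)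
  then show ?thesis using norm_triangle_ineq4[of "y i" "y j"] by linarith
qed

text \<open>\<open>N\<close> is the limit of the norms of the linear combinations of the differences of consecutive
  terms of well separated sequences.\<close>

definition difference_limit :: "real \<Rightarrow> ((nat \<Rightarrow> 'k) \<Rightarrow> real) \<Rightarrow> bool" where
  "difference_limit \<eta> N \<longleftrightarrow> (\<forall>A \<epsilon> L. finite A \<longrightarrow> A \<subseteq> c00 \<longrightarrow> \<epsilon> > 0 \<longrightarrow>
    (\<exists>m q y. well_separated \<eta> q y \<and> 2 * m + L \<le> q \<and> (\<forall>a\<in>A. \<forall>j\<ge>m. a j = 0)
      \<and> (\<forall>a\<in>A. \<forall>\<tau>. strict_mono_on {..<2 * m} \<tau> \<longrightarrow> \<tau> ` {..<2 * m} \<subseteq> {..<q} \<longrightarrow>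
          \<bar>norm (\<Sum>j<m. scale (a j) (y (\<tau> (2 * j)) - y (\<tau> (Suc (2 * j))))) - N a\<bar> \<le> \<epsilon>)))"

lemma difference_limit_exists:
  assumes "\<And>q. \<exists>y. well_separated \<eta> q y"
  shows "\<exists>N. difference_limit \<eta> N"
proof -
  obtain g :: "(nat \<Rightarrow> 'k) \<Rightarrow> real" where g: "\<forall>A \<epsilon> L. finite A \<longrightarrow> A \<subseteq> c00 \<longrightarrow> \<epsilon> > 0 \<longrightarrow>
    (\<exists>r q y. well_separated \<eta> q y \<and> 2 * r + L \<le> q \<and> (\<forall>a\<in>A. \<forall>i\<ge>r. a i = 0)
      \<and> (\<forall>a\<in>A. \<forall>\<sigma>. strict_mono_on {..<r} \<sigma> \<longrightarrow> \<sigma> ` {..<r} \<subseteq> {..<q} \<longrightarrow>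
          \<bar>norm (\<Sum>i<r. scale (a i) (y (\<sigma> i))) - g a\<bar> \<le> \<epsilon>))"
    using spreading_limit[OF assms] by (rule exE)
  have "difference_limit \<eta> (\<lambda>a. g (diff_coeffs a))"
    unfolding difference_limit_def
  proof (intro allI impI)
    fix A :: "(nat \<Rightarrow> 'k) set" and \<epsilon> :: real and L :: nat
    assume A: "finite A" "A \<subseteq> c00" "\<epsilon> > 0"
    have "finite (diff_coeffs ` A)" "diff_coeffs ` A \<subseteq> c00" using A diff_coeffs_c00 by auto
    from g[rule_format, OF this A(3), of L] obtain r q y where y: "well_separated \<eta> q y" "2 * r + L \<le> q"
      and r: "\<forall>a\<in>diff_coeffs ` A. \<forall>i\<ge>r. a i = 0"
      and val: "\<forall>a\<in>diff_coeffs ` A. \<forall>\<sigma>. strict_mono_on {..<r} \<sigma> \<longrightarrow> \<sigma> ` {..<r} \<subseteq> {..<q} \<longrightarrow>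
          \<bar>norm (\<Sum>i<r. scale (a i) (y (\<sigma> i))) - g a\<bar> \<le> \<epsilon>"
      by (elim exE conjE)
    show "\<exists>m q y. well_separated \<eta> q y \<and> 2 * m + L \<le> q \<and> (\<forall>a\<in>A. \<forall>j\<ge>m. a j = 0)
      \<and> (\<forall>a\<in>A. \<forall>\<tau>. strict_mono_on {..<2 * m} \<tau> \<longrightarrow> \<tau> ` {..<2 * m} \<subseteq> {..<q} \<longrightarrow>
          \<bar>norm (\<Sum>j<m. scale (a j) (y (\<tau> (2 * j)) - y (\<tau> (Suc (2 * j))))) - g (diff_coeffs a)\<bar> \<le> \<epsilon>)"
    proof (intro exI conjI ballI allI impI)
      show "well_separated \<eta> q y" "2 * r + L \<le> q" by (rule y)+
      show "a j = 0" if "a \<in> A" "j \<ge> r" for a j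
        using r[rule_format, of "diff_coeffs a" "2 * j"] that by (simp add: diff_coeffs_def)
      fix a \<tau> assume a: "a \<in> A" and \<tau>: "strict_mono_on {..<2 * r} \<tau>" "\<tau> ` {..<2 * r} \<subseteq> {..<q}"
      \<comment> \<open>The support bound \<open>r\<close> of the expanded coefficients also bounds
        the support of \<open>a\<close>, so \<open>m = r\<close> is taken and the terms from
        \<open>r\<close> to \<open>2 * r\<close> are zero.\<close>
      have "(\<Sum>i<r. scale (diff_coeffs a i) (y (\<tau> i))) = (\<Sum>i<2 * r. scale (diff_coeffs a i) (y (\<tau> i)))"
        using r a by (intro sum.mono_neutral_left) auto
      also have "\<dots> = (\<Sum>j<r. scale (a j) (y (\<tau> (2 * j)) - y (\<tau> (Suc (2 * j)))))"
        unfolding sum_pairs by (intro sum.cong) (auto simp: diff_coeffs_def scale_right_diff_distrib)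
      finally have eq: "(\<Sum>i<r. scale (diff_coeffs a i) (y (\<tau> i)))
          = (\<Sum>j<r. scale (a j) (y (\<tau> (2 * j)) - y (\<tau> (Suc (2 * j)))))" .
      have "{..<r} \<subseteq> {..<2 * r}" by auto
      from val[rule_format, OF imageI[OF a] monotone_on_subset[OF \<tau>(1) this]
          order_trans[OF image_mono[OF this] \<tau>(2)]]
      show "\<bar>norm (\<Sum>j<r. scale (a j) (y (\<tau> (2 * j)) - y (\<tau> (Suc (2 * j))))) - g (diff_coeffs a)\<bar> \<le> \<epsilon>"
        by (simp only: eq)
    qed
  qed
  then show ?thesis by (rule exI[of _ "\<lambda>a. g (diff_coeffs a)"])
qed

lemma difference_limitE:
  assumes "difference_limit \<eta> N" "finite A" "A \<subseteq> c00" "\<epsilon> > 0"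
  obtains m q y where "well_separated \<eta> q y" "2 * m + L \<le> q" "\<And>a j. a \<in> A \<Longrightarrow> j \<ge> m \<Longrightarrow> a j = 0"
    "\<And>a \<tau>. a \<in> A \<Longrightarrow> strict_mono_on {..<2 * m} \<tau> \<Longrightarrow> \<tau> ` {..<2 * m} \<subseteq> {..<q} \<Longrightarrow>
          \<bar>norm (\<Sum>j<m. scale (a j) (y (\<tau> (2 * j)) - y (\<tau> (Suc (2 * j))))) - N a\<bar> \<le> \<epsilon>"
proof -
  from assms(1)[unfolded difference_limit_def, rule_format, OF assms(2-4), of L]
  obtain m q y where "well_separated \<eta> q y" "2 * m + L \<le> q" "\<forall>a\<in>A. \<forall>j\<ge>m. a j = 0"
      "\<forall>a\<in>A. \<forall>\<tau>. strict_mono_on {..<2 * m} \<tau> \<longrightarrow> \<tau> ` {..<2 * m} \<subseteq> {..<q} \<longrightarrow>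
          \<bar>norm (\<Sum>j<m. scale (a j) (y (\<tau> (2 * j)) - y (\<tau> (Suc (2 * j))))) - N a\<bar> \<le> \<epsilon>"
    by (elim exE conjE)
  then show ?thesis by (intro that[of q y m]) (auto simp only:)
qed

text \<open>With \<open>\<tau>\<close> the identity, one family of vectors realises \<open>N\<close>
  up to \<open>\<epsilon>\<close> on finitely many sequences; properties of norms thereby pass to
  \<open>N\<close>.\<close>

lemma difference_limit_approx:
  assumes "difference_limit \<eta> N" "finite A" "A \<subseteq> c00" "\<epsilon> > 0"
  obtains m d where "\<And>j. norm (d j :: 'a) \<le> 2" "\<And>a j. a \<in> A \<Longrightarrow> j \<ge> m \<Longrightarrow> a j = 0"
    "\<And>a. a \<in> A \<Longrightarrow> \<bar>norm (\<Sum>j<m. scale (a j) (d j)) - N a\<bar> \<le> \<epsilon>"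
proof -
  obtain m q y where y: "well_separated \<eta> q y" "2 * m + 0 \<le> q" "\<And>a j. a \<in> A \<Longrightarrow> j \<ge> m \<Longrightarrow> a j = 0"
    "\<And>a \<tau>. a \<in> A \<Longrightarrow> strict_mono_on {..<2 * m} \<tau> \<Longrightarrow> \<tau> ` {..<2 * m} \<subseteq> {..<q} \<Longrightarrow>
          \<bar>norm (\<Sum>j<m. scale (a j) (y (\<tau> (2 * j)) - y (\<tau> (Suc (2 * j))))) - N a\<bar> \<le> \<epsilon>"
    by (rule difference_limitE[OF assms, where L = 0]) (rule that)
  show ?thesis
  proof (rule that)
    show "norm (y (2 * j) - y (Suc (2 * j))) \<le> 2" for j
      by (rule well_separated_diff[OF y(1)])
    show "a j = 0" if "a \<in> A" "j \<ge> m" for a j by (rule y(3)[OF that])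
    show "\<bar>norm (\<Sum>j<m. scale (a j) (y (2 * j) - y (Suc (2 * j)))) - N a\<bar> \<le> \<epsilon>" if "a \<in> A" for a
      using y(4)[OF that, of "\<lambda>i. i"] y(2) by (auto simp: strict_mono_on_def)
  qed
qed

lemma difference_limit_add:
  assumes N: "difference_limit \<eta> N" and ab: "a \<in> c00" "b \<in> c00"
  shows "N (\<lambda>i. a i + b i) \<le> N a + N b"
proof (rule le_of_all_pos[where C = 3])
  fix \<epsilon> :: real assume \<epsilon>: "\<epsilon> > 0"
  have "(\<lambda>i. a i + b i) \<in> c00"
  proof -
    obtain m n where "\<forall>i\<ge>m. a i = 0" "\<forall>i\<ge>n. b i = 0" using ab by (auto simp: c00_def)
    then show ?thesis by (intro c00I[of "max m n"]) simp
  qed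
  then have A: "finite {a, b, \<lambda>i. a i + b i}" "{a, b, \<lambda>i. a i + b i} \<subseteq> c00" using ab by auto
  obtain m d where "\<And>j. norm (d j :: 'a) \<le> 2" "\<And>c j. c \<in> {a, b, \<lambda>i. a i + b i} \<Longrightarrow> j \<ge> m \<Longrightarrow> c j = 0"
    and d: "\<And>c. c \<in> {a, b, \<lambda>i. a i + b i} \<Longrightarrow> \<bar>norm (\<Sum>j<m. scale (c j) (d j)) - N c\<bar> \<le> \<epsilon>"
    by (rule difference_limit_approx[OF N A \<epsilon>]) (rule that)
  have "(\<Sum>j<m. scale (a j + b j) (d j)) = (\<Sum>j<m. scale (a j) (d j)) + (\<Sum>j<m. scale (b j) (d j))"
    by (simp add: scale_left_distrib sum.distrib)
  then have "norm (\<Sum>j<m. scale (a j + b j) (d j)) \<le> norm (\<Sum>j<m. scale (a j) (d j)) + norm (\<Sum>j<m. scale (b j) (d j))"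
    using norm_triangle_ineq by metis
  then show "N (\<lambda>i. a i + b i) \<le> N a + N b + \<epsilon> * 3"
    using d[of a] d[of b] d[of "\<lambda>i. a i + b i"] by (simp add: abs_le_iff)
qed simp

lemma difference_limit_cmult_le:
  assumes N: "difference_limit \<eta> N" and a: "a \<in> c00"
  shows "\<bar>N (\<lambda>i. c * a i) - norm c * N a\<bar> \<le> 0"
proof (rule le_of_all_pos[where C = "1 + norm c"])
  fix \<epsilon> :: real assume \<epsilon>: "\<epsilon> > 0"
  have "(\<lambda>i. c * a i) \<in> c00" using a by (auto simp: c00_def)
  then have A: "finite {a, \<lambda>i. c * a i}" "{a, \<lambda>i. c * a i} \<subseteq> c00" using a by auto
  obtain m d where "\<And>j. norm (d j :: 'a) \<le> 2" "\<And>b j. b \<in> {a, \<lambda>i. c * a i} \<Longrightarrow> j \<ge> m \<Longrightarrow> b j = 0"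
    and d: "\<And>b. b \<in> {a, \<lambda>i. c * a i} \<Longrightarrow> \<bar>norm (\<Sum>j<m. scale (b j) (d j)) - N b\<bar> \<le> \<epsilon>"
    by (rule difference_limit_approx[OF N A \<epsilon>]) (rule that)
  have "(\<Sum>j<m. scale (c * a j) (d j)) = scale c (\<Sum>j<m. scale (a j) (d j))"
    by (simp add: scale_sum_right)
  then have "norm (\<Sum>j<m. scale (c * a j) (d j)) = norm c * norm (\<Sum>j<m. scale (a j) (d j))"
    by (simp add: norm_scale)
  then have "\<bar>norm c * norm (\<Sum>j<m. scale (a j) (d j)) - N (\<lambda>i. c * a i)\<bar> \<le> \<epsilon>"
    using d[of "\<lambda>i. c * a i"] by simp
  moreover have "\<bar>norm c * norm (\<Sum>j<m. scale (a j) (d j)) - norm c * N a\<bar> \<le> norm c * \<epsilon>"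
    using mult_left_mono[OF d[of a], of "norm c"] by (simp add: abs_mult right_diff_distrib[symmetric])
  ultimately show "\<bar>N (\<lambda>i. c * a i) - norm c * N a\<bar> \<le> 0 + \<epsilon> * (1 + norm c)"
    by (simp add: algebra_simps abs_le_iff)
qed simp

lemma difference_limit_cmult:
  "difference_limit \<eta> N \<Longrightarrow> a \<in> c00 \<Longrightarrow> N (\<lambda>i. c * a i) = norm c * N a"
  using difference_limit_cmult_le[of \<eta> N a c] by simp

lemma difference_limit_bounds:
  assumes N: "difference_limit \<eta> N" and a: "\<And>i. i \<ge> n \<Longrightarrow> a i = 0"
  shows "0 \<le> N a" "N a \<le> 2 * (\<Sum>i<n. norm (a i))"
proof -
  have A: "finite {a}" "{a} \<subseteq> c00" using c00I[OF a] by auto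
  have "0 \<le> N a + \<epsilon> * 1 \<and> N a \<le> 2 * (\<Sum>i<n. norm (a i)) + \<epsilon> * 1" if \<epsilon>: "\<epsilon> > 0" for \<epsilon>
  proof -
    obtain m d where d0: "\<And>j. norm (d j :: 'a) \<le> 2" "\<And>b j. b \<in> {a} \<Longrightarrow> j \<ge> m \<Longrightarrow> b j = 0"
      "\<And>b. b \<in> {a} \<Longrightarrow> \<bar>norm (\<Sum>j<m. scale (b j) (d j)) - N b\<bar> \<le> \<epsilon>"
      by (rule difference_limit_approx[OF N A \<epsilon>]) (rule that)
    note d = d0(1) d0(2)[OF singletonI] d0(3)[OF singletonI]
    have "norm (\<Sum>j<m. scale (a j) (d j)) \<le> (\<Sum>j<m. norm (a j) * 2)"
      by (intro sum_norm_le) (simp add: norm_scale d(1) mult_left_mono)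
    also have "\<dots> = (\<Sum>j<n. norm (a j) * 2)"
    proof (cases "m \<le> n")
      case True
      then show ?thesis using d(2) by (intro sum.mono_neutral_left) auto
    next
      case False
      then show ?thesis using a by (intro sum.mono_neutral_right) auto
    qed
    finally have "norm (\<Sum>j<m. scale (a j) (d j)) \<le> 2 * (\<Sum>j<n. norm (a j))"
      by (simp add: sum_distrib_left mult.commute)
    then show ?thesis using d(3) norm_ge_zero[of "\<Sum>j<m. scale (a j) (d j)"]
      by (simp only: abs_le_iff) linarith
  qed
  then show "0 \<le> N a" "N a \<le> 2 * (\<Sum>i<n. norm (a i))"
    using le_of_all_pos[of 0 "N a" 1] le_of_all_pos[of "N a" "2 * (\<Sum>i<n. norm (a i))" 1] by auto
qed

text \<open>Moving the \<open>i\<close>-th pair through a long gap and averaging, the \<open>i\<close>-th difference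
  telescopes away.\<close>

lemma difference_limit_suppress:
  assumes N: "difference_limit \<eta> N" and a: "a \<in> c00"
  shows "N (a(i := 0)) \<le> N a"
proof (rule le_of_all_pos[where C = "2 + 2 * norm (a i)"])
  fix \<epsilon> :: real assume \<epsilon>: "\<epsilon> > 0"
  define b where "b = a(i := 0)"
  define T where "T = Suc (nat \<lceil>1 / \<epsilon>\<rceil>)"
  have "1 / \<epsilon> \<le> real T" unfolding T_def by linarith
  then have "1 \<le> \<epsilon> * real T" using \<epsilon> by (simp add: pos_divide_le_eq mult.commute)
  moreover have "T > 0" by (simp add: T_def)
  ultimately have T: "1 / real T \<le> \<epsilon>" "T > 0" by (simp_all add: pos_divide_le_eq)
  have "b \<in> c00" using a by (auto simp: c00_def b_def)
  then have A: "finite {a, b}" "{a, b} \<subseteq> c00" using a by auto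
  obtain m q y where y: "well_separated \<eta> q y" "2 * m + T \<le> q" "\<And>c j. c \<in> {a, b} \<Longrightarrow> j \<ge> m \<Longrightarrow> c j = 0"
    "\<And>c \<tau>. c \<in> {a, b} \<Longrightarrow> strict_mono_on {..<2 * m} \<tau> \<Longrightarrow> \<tau> ` {..<2 * m} \<subseteq> {..<q} \<Longrightarrow>
          \<bar>norm (\<Sum>j<m. scale (c j) (y (\<tau> (2 * j)) - y (\<tau> (Suc (2 * j))))) - N c\<bar> \<le> \<epsilon>"
    by (rule difference_limitE[OF N A \<epsilon>, where L = T]) (rule that)
  show "N (a(i := 0)) \<le> N a + \<epsilon> * (2 + 2 * norm (a i))"
  proof (cases "i < m")
    case False
    then have "a i = 0" using y(3)[of a i] by simp
    then have "a(i := 0) = a" by auto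
    then show ?thesis using \<epsilon> by simp
  next
    case True
    \<comment> \<open>The \<open>i\<close>-th pair is shifted by \<open>t\<close> and everything
      after it by the full gap \<open>T\<close>. All other differences keep positions independent of
      \<open>t\<close> and sum to \<open>Y\<close>; monotonicity requires
      \<open>t < T\<close>.\<close>
    define \<tau> where "\<tau> = (\<lambda>t k. if k < 2 * i then k else if k < 2 * i + 2 then k + t else k + T)"
    have mono: "strict_mono_on {..<2 * m} (\<tau> t)" "\<tau> t ` {..<2 * m} \<subseteq> {..<q}" if "t < T" for t
      using that y(2) by (auto simp: strict_mono_on_def \<tau>_def)
    define Y where "Y = (\<Sum>j<m. scale (b j) (y (\<tau> 0 (2 * j)) - y (\<tau> 0 (Suc (2 * j)))))"
    have split: "(\<Sum>j<m. scale (a j) (y (\<tau> t (2 * j)) - y (\<tau> t (Suc (2 * j)))))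
        = Y + scale (a i) (y (2 * i + t) - y (2 * i + Suc t))" for t
    proof -
      have "(\<Sum>j<m. scale (a j) (y (\<tau> t (2 * j)) - y (\<tau> t (Suc (2 * j)))))
          = (\<Sum>j<m. scale (b j) (y (\<tau> 0 (2 * j)) - y (\<tau> 0 (Suc (2 * j))))
              + (if j = i then scale (a i) (y (2 * i + t) - y (2 * i + Suc t)) else 0))"
        by (rule sum.cong) (auto simp: b_def \<tau>_def)
      then show ?thesis using True by (simp add: sum.distrib Y_def)
    qed
    have le: "norm (Y + scale (a i) (y (2 * i + t) - y (2 * i + Suc t))) \<le> N a + \<epsilon>" if "t < T" for t
      using y(4)[of a, OF _ mono[OF that]] unfolding split by (simp add: abs_le_iff)
    \<comment> \<open>Summed over \<open>t\<close>, the moving differences telescope to one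
      difference of norm at most 2, which division by \<open>T\<close> makes small.\<close>
    have "(\<Sum>t<T. Y + scale (a i) (y (2 * i + t) - y (2 * i + Suc t)))
        = real T *\<^sub>R Y + scale (a i) (\<Sum>t<T. y (2 * i + t) - y (2 * i + Suc t))"
      by (simp add: sum.distrib scale_sum_right scaleR_conv_of_real sum_constant_scaleR)
    also have "(\<Sum>t<T. y (2 * i + t) - y (2 * i + Suc t)) = y (2 * i) - y (2 * i + T)"
      using sum_lessThan_telescope'[of "\<lambda>t. y (2 * i + t)" T] by simp
    finally have eq: "real T *\<^sub>R Y = (\<Sum>t<T. Y + scale (a i) (y (2 * i + t) - y (2 * i + Suc t)))
        - scale (a i) (y (2 * i) - y (2 * i + T))" by simp
    have "norm (y (2 * i) - y (2 * i + T)) \<le> 2"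
      by (rule well_separated_diff[OF y(1)])
    then have n2: "norm (scale (a i) (y (2 * i) - y (2 * i + T))) \<le> norm (a i) * 2"
      by (simp add: norm_scale mult_left_mono)
    have "real T * norm Y = norm (real T *\<^sub>R Y)" by simp
    also have "\<dots> \<le> norm (\<Sum>t<T. Y + scale (a i) (y (2 * i + t) - y (2 * i + Suc t))) + norm (a i) * 2"
      unfolding eq using norm_triangle_ineq4 n2 by (meson add_left_mono order_trans)
    also have "norm (\<Sum>t<T. Y + scale (a i) (y (2 * i + t) - y (2 * i + Suc t))) \<le> (\<Sum>t<T. N a + \<epsilon>)"
      using le by (intro sum_norm_le) auto
    finally have "real T * norm Y \<le> real T * (N a + \<epsilon>) + 2 * norm (a i)" by simp
    then have "norm Y \<le> (N a + \<epsilon>) + 2 * norm (a i) * (1 / real T)" using T(2) by (simp add: field_simps)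
    also have "2 * norm (a i) * (1 / real T) \<le> 2 * norm (a i) * \<epsilon>" using T(1) by (intro mult_left_mono) auto
    finally have "norm Y \<le> (N a + \<epsilon>) + 2 * norm (a i) * \<epsilon>" by simp
    moreover have "N b \<le> norm Y + \<epsilon>"
      using y(4)[of b, OF _ mono[OF T(2)]] by (simp add: Y_def abs_le_iff)
    ultimately show ?thesis by (simp add: b_def algebra_simps)
  qed
qed simp

lemma difference_limit_restrict:
  assumes N: "difference_limit \<eta> N" and a: "a \<in> c00" and "finite J"
  shows "N (\<lambda>i. if i \<in> J then 0 else a i) \<le> N a"
  using assms(3)
proof induction
  case (insert j J)
  have "(\<lambda>i. if i \<in> J then 0 else a i) \<in> c00" using a by (auto simp: c00_def)
  from difference_limit_suppress[OF N this, of j]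
  have "N ((\<lambda>i. if i \<in> J then 0 else a i)(j := 0)) \<le> N a" using insert.IH by simp
  moreover have "(\<lambda>i. if i \<in> J then 0 else a i)(j := 0) = (\<lambda>i. if i \<in> insert j J then 0 else a i)" by auto
  ultimately show ?case by simp
qed simp

text \<open>A functional that is large on average over many consecutive pairs is large on at least
  \<open>n\<close> of them. Spreading places the combination on those pairs, a subset of coordinates
  is selected whose values add up without cancellation, and suppression bounds that part by the
  whole.\<close>

lemma difference_limit_lower:
  assumes N: "difference_limit \<eta> N" and \<eta>: "\<eta> > 0" and a: "\<And>i. i \<ge> n \<Longrightarrow> a i = 0"
  shows "\<eta> / (2 * real DIM('k)) * (\<Sum>i<n. norm (a i)) \<le> N a"
proof (rule le_of_all_pos[where C = 1])
  fix \<epsilon> :: real assume \<epsilon>: "\<epsilon> > 0"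
  have ac: "a \<in> c00" by (rule c00I[OF a])
  define res where "res = (\<lambda>J i. if i \<in> J then 0 else a i)"
  \<comment> \<open>The coordinates to be kept depend on the points \<open>y\<close>, which are
    chosen after \<open>A\<close>; so all restrictions of \<open>a\<close> are controlled from the
    start.\<close>
  define A where "A = res ` Pow {..<n}"
  have A: "finite A" "A \<subseteq> c00" using a by (auto simp: A_def res_def intro!: c00I[of n])
  \<comment> \<open>At least \<open>\<eta> * M / 2\<close> of the \<open>M\<close> pairs will be
    good, and this must reach \<open>n\<close>, one pair for each coordinate.\<close>
  define M where "M = nat \<lceil>2 * real n / \<eta>\<rceil>"
  have "2 * real n / \<eta> \<le> real M" unfolding M_def by linarith
  then have M: "2 * real n \<le> \<eta> * real M" using \<eta> by (simp add: field_simps)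
  obtain m q y where y: "well_separated \<eta> q y" "2 * m + 2 * M \<le> q" "\<And>c j. c \<in> A \<Longrightarrow> j \<ge> m \<Longrightarrow> c j = 0"
    "\<And>c \<tau>. c \<in> A \<Longrightarrow> strict_mono_on {..<2 * m} \<tau> \<Longrightarrow> \<tau> ` {..<2 * m} \<subseteq> {..<q} \<Longrightarrow>
          \<bar>norm (\<Sum>j<m. scale (c j) (y (\<tau> (2 * j)) - y (\<tau> (Suc (2 * j))))) - N c\<bar> \<le> \<epsilon>"
    by (rule difference_limitE[OF N A \<epsilon>, where L = "2 * M"]) (rule that)
  define d where "d = (\<lambda>l. y (2 * l) - y (Suc (2 * l)))"
  have d2: "norm (d l) \<le> 2" for l
    unfolding d_def by (rule well_separated_diff[OF y(1)])
  have "\<forall>l<M. 2 * l < Suc (2 * l) \<and> Suc (2 * l) < q" using y(2) by auto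
  then obtain \<psi> where \<psi>: "\<psi> \<in> dual_ball scale" "2 * \<eta> * real M \<le> (\<Sum>l<M. norm (\<psi> (d l)))"
    using y(1)[unfolded well_separated_def, THEN conjunct2, rule_format, of M "\<lambda>l. 2 * l" "\<lambda>l. Suc (2 * l)"]
    unfolding d_def by blast
  have \<psi>d: "norm (\<psi> (d l)) \<le> 2" for l using \<psi>(1) d2[of l] by (auto simp: dual_ball_iff intro: order_trans)
  define S where "S = {l. l < M \<and> \<eta> \<le> norm (\<psi> (d l))}"
  have finS: "finite S" by (simp add: S_def)
  \<comment> \<open>Half of the average \<open>2 * \<eta>\<close> covers the pairs outside
    \<open>S\<close>; pairs in \<open>S\<close> have value at most 2.\<close>
  have "2 * \<eta> * real M \<le> (\<Sum>l<M. (if l \<in> S then 2 else 0) + \<eta>)"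
    using \<psi>(2) by (rule order_trans) (intro sum_mono, use \<psi>d \<eta> in \<open>auto simp: S_def intro: add_increasing2\<close>)
  also have "\<dots> = 2 * real (card S) + \<eta> * real M"
  proof -
    have "(\<Sum>l<M. if l \<in> S then 2 else 0 :: real) = (\<Sum>l\<in>S. 2)"
      by (intro sum.mono_neutral_cong_right) (auto simp: S_def)
    then show ?thesis by (simp add: sum.distrib)
  qed
  finally have "n \<le> card S" using M by simp
  obtain \<rho> where \<rho>: "bij_betw \<rho> {..<card S} S" "strict_mono_on {..<card S} \<rho>"
    using ex_bij_betw_strict_mono_card[OF finS] by metis
  have \<rho>S: "\<rho> j \<in> S" if "j < n" for j using \<rho>(1) that \<open>n \<le> card S\<close> by (auto simp: bij_betw_def)
  have \<rho>M: "\<rho> j < M" if "j < n" for j using \<rho>S[OF that] by (simp add: S_def)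
  have \<rho>mono: "\<rho> i < \<rho> j" if "i < j" "j < n" for i j
    using \<rho>(2) that \<open>n \<le> card S\<close> by (auto simp: strict_mono_on_def)
  \<comment> \<open>The \<open>j\<close>-th pair is placed on the \<open>j\<close>-th good pair.
    Positions from \<open>2 * n\<close> on, where \<open>a\<close> vanishes, go past all
    \<open>M\<close> pairs to keep \<open>\<tau>\<close> increasing.\<close>
  define \<tau> where "\<tau> = (\<lambda>k. if k < 2 * n then 2 * \<rho> (k div 2) + k mod 2 else k + 2 * M)"
  have "strict_mono_on {..<2 * m} \<tau>"
  proof (rule strict_mono_onI)
    fix k l :: nat assume kl: "k \<in> {..<2 * m}" "l \<in> {..<2 * m}" "k < l"
    consider "l < 2 * n" "k div 2 < l div 2" | "l < 2 * n" "k div 2 = l div 2" | "k < 2 * n" "2 * n \<le> l" | "2 * n \<le> k"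
      using kl(3) div_le_mono[of k l 2] by linarith
    then show "\<tau> k < \<tau> l"
    proof cases
      case 1
      then have "\<rho> (k div 2) < \<rho> (l div 2)" by (intro \<rho>mono) auto
      then show ?thesis using 1 kl(3) by (simp add: \<tau>_def)
    next
      case 2
      have "k = 2 * (k div 2) + k mod 2" "l = 2 * (l div 2) + l mod 2" by simp_all
      then have "k mod 2 < l mod 2" using 2(2) kl(3) by linarith
      moreover have "k < 2 * n" using 2(1) kl(3) by linarith
      ultimately show ?thesis using 2 by (simp only: \<tau>_def if_True)
    next
      case 3
      then have "\<rho> (k div 2) < M" by (intro \<rho>M) auto
      then show ?thesis using 3 by (simp add: \<tau>_def)
    next
      case 4
      then show ?thesis using kl(3) by (simp add: \<tau>_def)
    qed
  qed
  moreover have "\<tau> ` {..<2 * m} \<subseteq> {..<q}"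
  proof (rule image_subsetI)
    fix k assume k: "k \<in> {..<2 * m}"
    show "\<tau> k \<in> {..<q}"
    proof (cases "k < 2 * n")
      case True
      then have "\<rho> (k div 2) < M" by (intro \<rho>M) auto
      then have "2 * \<rho> (k div 2) + k mod 2 < 2 * M" using mod_less_divisor[of 2 k] by linarith
      then show ?thesis using True y(2) by (simp add: \<tau>_def)
    next
      case False
      then show ?thesis using k y(2) by (simp add: \<tau>_def)
    qed
  qed
  ultimately have approx: "\<bar>norm (\<Sum>j<m. scale (c j) (y (\<tau> (2 * j)) - y (\<tau> (Suc (2 * j))))) - N c\<bar> \<le> \<epsilon>"
    if "c \<in> A" for c by (rule y(4)[OF that])
  obtain J where J: "J \<subseteq> {..<n}"
    "(\<Sum>j<n. norm (a j * \<psi> (d (\<rho> j)))) \<le> 2 * real DIM('k) * norm (\<Sum>j\<in>J. a j * \<psi> (d (\<rho> j)))"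
    using large_partial_sum[of "{..<n}" "\<lambda>j. a j * \<psi> (d (\<rho> j))"] by blast
  define c where "c = res ({..<n} - J)"
  have c: "c \<in> A" by (auto simp: A_def c_def)
  have cj: "c j = (if j \<in> J then a j else 0)" for j
    using a[of j] J(1) by (auto simp: c_def res_def not_less)
  have \<psi>lin: "\<psi> (\<Sum>j\<in>I. f j) = (\<Sum>j\<in>I. \<psi> (f j))" for I and f :: "nat \<Rightarrow> 'a"
  proof -
    have "linear \<psi>"
      using \<psi>(1) linear_functional_scaleR[of \<psi>]
      by (intro linearI) (auto simp: dual_ball_iff linear_functional_iff)
    then show ?thesis by (rule linear_sum)
  qed
  have "(\<Sum>j<m. scale (c j) (y (\<tau> (2 * j)) - y (\<tau> (Suc (2 * j))))) = (\<Sum>j\<in>J. scale (a j) (d (\<rho> j)))"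
  proof (rule sum.mono_neutral_cong)
    show "scale (c j) (y (\<tau> (2 * j)) - y (\<tau> (Suc (2 * j)))) = 0" if "j \<in> {..<m} - J" for j
      using that by (simp add: cj)
    show "scale (a j) (d (\<rho> j)) = 0" if "j \<in> J - {..<m}" for j
      using y(3)[OF c, of j] that by (simp add: cj)
    show "scale (c j) (y (\<tau> (2 * j)) - y (\<tau> (Suc (2 * j)))) = scale (a j) (d (\<rho> j))" if "j \<in> {..<m} \<inter> J" for j
    proof -
      have "j < n" using that J(1) by auto
      then show ?thesis using that by (simp add: cj \<tau>_def d_def)
    qed
  qed (use finite_subset[OF J(1)] in auto)
  then have "norm (\<Sum>j\<in>J. scale (a j) (d (\<rho> j))) \<le> N c + \<epsilon>" using approx[OF c] by (simp add: abs_le_iff)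
  also have "N c \<le> N a" unfolding c_def res_def by (rule difference_limit_restrict[OF N ac]) simp
  finally have up: "norm (\<Sum>j\<in>J. scale (a j) (d (\<rho> j))) \<le> N a + \<epsilon>" by simp
  have "(\<Sum>j\<in>J. a j * \<psi> (d (\<rho> j))) = \<psi> (\<Sum>j\<in>J. scale (a j) (d (\<rho> j)))"
    using \<psi>(1) by (simp add: \<psi>lin dual_ball_iff)
  then have "norm (\<Sum>j\<in>J. a j * \<psi> (d (\<rho> j))) \<le> norm (\<Sum>j\<in>J. scale (a j) (d (\<rho> j)))"
    using \<psi>(1) by (simp add: dual_ball_iff)
  with up have "norm (\<Sum>j\<in>J. a j * \<psi> (d (\<rho> j))) \<le> N a + \<epsilon>" by simp
  then have "2 * real DIM('k) * norm (\<Sum>j\<in>J. a j * \<psi> (d (\<rho> j))) \<le> 2 * real DIM('k) * (N a + \<epsilon>)"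
    by (intro mult_left_mono) auto
  moreover have "\<eta> * (\<Sum>j<n. norm (a j)) \<le> (\<Sum>j<n. norm (a j * \<psi> (d (\<rho> j))))"
    unfolding sum_distrib_left
  proof (rule sum_mono)
    fix j assume "j \<in> {..<n}"
    then have *: "\<eta> \<le> norm (\<psi> (d (\<rho> j)))" using \<rho>S[of j] by (simp add: S_def)
    show "\<eta> * norm (a j) \<le> norm (a j * \<psi> (d (\<rho> j)))"
      using mult_right_mono[OF * norm_ge_zero[of "a j"]] by (simp add: norm_mult mult.commute)
  qed
  ultimately have "\<eta> * (\<Sum>j<n. norm (a j)) \<le> 2 * real DIM('k) * (N a + \<epsilon>)" using J(2) by linarith
  then show "\<eta> / (2 * real DIM('k)) * (\<Sum>i<n. norm (a i)) \<le> N a + \<epsilon> * 1"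
    by (simp add: pos_divide_le_eq mult.commute)
qed simp

end

section \<open>A renorming of the space of summable sequences\<close>

definition l1 :: "(nat \<Rightarrow> 'k::real_normed_vector) set" where
  "l1 = {a. summable (\<lambda>i. norm (a i))}"

definition trunc :: "nat \<Rightarrow> (nat \<Rightarrow> 'k::zero) \<Rightarrow> nat \<Rightarrow> 'k" where
  "trunc m a = (\<lambda>i. if i < m then a i else 0)"

lemma trunc_c00: "trunc m a \<in> c00"
  by (rule c00I[of m]) (simp add: trunc_def)

lemma l1_add: "a \<in> l1 \<Longrightarrow> b \<in> l1 \<Longrightarrow> (\<lambda>i. a i + b i) \<in> l1"
  unfolding l1_def mem_Collect_eq
  by (rule summable_comparison_test'[of "\<lambda>i. norm (a i) + norm (b i)" 0])
    (auto intro: summable_add norm_triangle_ineq)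

lemma l1_cmult: "a \<in> l1 \<Longrightarrow> (\<lambda>i. c * a i :: 'k::real_normed_field) \<in> l1"
  by (simp add: l1_def norm_mult summable_mult)

lemma l1_c00: "a \<in> c00 \<Longrightarrow> a \<in> l1"
proof -
  assume "a \<in> c00"
  then obtain m where "\<forall>i\<ge>m. a i = 0" by (auto simp: c00_def)
  then have "summable (\<lambda>i. norm (a i))" by (intro summable_finite[of "{..<m}"]) (auto simp: not_less)
  then show ?thesis by (simp add: l1_def)
qed

lemma l1_complete:
  fixes \<sigma> :: "nat \<Rightarrow> nat \<Rightarrow> 'k::banach"
  assumes \<sigma>: "\<And>n. \<sigma> n \<in> l1"
    and cauchy: "\<And>\<epsilon>. \<epsilon> > 0 \<Longrightarrow> \<exists>K. \<forall>m\<ge>K. \<forall>n\<ge>K. (\<Sum>i. norm (\<sigma> m i - \<sigma> n i)) < \<epsilon>"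
  shows "\<exists>a\<in>l1. (\<lambda>n. \<Sum>i. norm (\<sigma> n i - a i)) \<longlonglongrightarrow> 0"
proof -
  have diff: "summable (\<lambda>i. norm (\<sigma> m i - \<sigma> n i))" for m n
    by (rule summable_comparison_test'[of "\<lambda>i. norm (\<sigma> m i) + norm (\<sigma> n i)" 0])
      (use \<sigma> in \<open>auto intro: summable_add norm_triangle_ineq4 simp: l1_def\<close>)
  have part: "(\<Sum>i<k. norm (\<sigma> m i - \<sigma> n i)) \<le> (\<Sum>i. norm (\<sigma> m i - \<sigma> n i))" for k m n
    by (rule sum_le_suminf[OF diff]) auto
  have "convergent (\<lambda>n. \<sigma> n i)" for i
  proof (rule Cauchy_convergent, rule CauchyI)
    fix \<epsilon> :: real assume "\<epsilon> > 0"
    then obtain K where K: "\<forall>m\<ge>K. \<forall>n\<ge>K. (\<Sum>i. norm (\<sigma> m i - \<sigma> n i)) < \<epsilon>" using cauchy by blast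
    have "norm (\<sigma> m i - \<sigma> n i) < \<epsilon>" if "m \<ge> K" "n \<ge> K" for m n
    proof -
      have "norm (\<sigma> m i - \<sigma> n i) \<le> (\<Sum>j<Suc i. norm (\<sigma> m j - \<sigma> n j))" by (intro member_le_sum) auto
      also have "\<dots> \<le> (\<Sum>j. norm (\<sigma> m j - \<sigma> n j))" by (rule part)
      also have "\<dots> < \<epsilon>" using K that by blast
      finally show ?thesis .
    qed
    then show "\<exists>K. \<forall>m\<ge>K. \<forall>n\<ge>K. norm (\<sigma> m i - \<sigma> n i) < \<epsilon>" by blast
  qed
  then obtain a where a: "\<And>i. (\<lambda>n. \<sigma> n i) \<longlonglongrightarrow> a i" unfolding convergent_def by metis
  have bound: "\<exists>K. \<forall>n\<ge>K. \<forall>k. (\<Sum>i<k. norm (\<sigma> n i - a i)) \<le> \<epsilon>" if "\<epsilon> > 0" for \<epsilon>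
  proof -
    obtain K where K: "\<forall>m\<ge>K. \<forall>n\<ge>K. (\<Sum>i. norm (\<sigma> m i - \<sigma> n i)) < \<epsilon>" using cauchy \<open>\<epsilon> > 0\<close> by blast
    have "(\<Sum>i<k. norm (\<sigma> n i - a i)) \<le> \<epsilon>" if n: "n \<ge> K" for n k
    proof (rule LIMSEQ_le_const2)
      show "(\<lambda>m. \<Sum>i<k. norm (\<sigma> n i - \<sigma> m i)) \<longlonglongrightarrow> (\<Sum>i<k. norm (\<sigma> n i - a i))"
        by (intro tendsto_intros a)
      have "(\<Sum>i<k. norm (\<sigma> n i - \<sigma> m i)) \<le> \<epsilon>" if "m \<ge> K" for m
        using part[of n m k] K n that by (meson less_imp_le order_trans)
      then show "\<exists>M. \<forall>m\<ge>M. (\<Sum>i<k. norm (\<sigma> n i - \<sigma> m i)) \<le> \<epsilon>" by blast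
    qed
    then show ?thesis by blast
  qed
  obtain K1 where K1: "\<forall>n\<ge>K1. \<forall>k. (\<Sum>i<k. norm (\<sigma> n i - a i)) \<le> 1" using bound[of 1] by auto
  have "summable (\<lambda>i. norm (\<sigma> K1 i - a i))"
    by (rule summableI_nonneg_bounded[where x = 1]) (use K1 in auto)
  then have "summable (\<lambda>i. norm (\<sigma> K1 i) + norm (\<sigma> K1 i - a i))"
    using \<sigma>[of K1] by (intro summable_add) (auto simp: l1_def)
  then have "summable (\<lambda>i. norm (a i))"
    by (rule summable_comparison_test'[where N = 0]) (simp, metis add.commute diff_add_cancel norm_minus_commute norm_triangle_ineq)
  then have al: "a \<in> l1" by (simp add: l1_def)
  have sum_a: "summable (\<lambda>i. norm (\<sigma> n i - a i))" for n
    by (rule summable_comparison_test'[of "\<lambda>i. norm (\<sigma> n i) + norm (a i)" 0])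
      (use \<sigma> al in \<open>auto intro: summable_add norm_triangle_ineq4 simp: l1_def\<close>)
  have "(\<lambda>n. \<Sum>i. norm (\<sigma> n i - a i)) \<longlonglongrightarrow> 0"
  proof (rule LIMSEQ_I)
    fix r :: real assume r: "r > 0"
    obtain K where K: "\<forall>n\<ge>K. \<forall>k. (\<Sum>i<k. norm (\<sigma> n i - a i)) \<le> r / 2" using bound[of "r / 2"] r by auto
    have "norm ((\<Sum>i. norm (\<sigma> n i - a i)) - 0) < r" if "n \<ge> K" for n
    proof -
      have "(\<Sum>i. norm (\<sigma> n i - a i)) \<le> r / 2"
        using K that by (intro suminf_le_const[OF sum_a]) auto
      moreover have "(\<Sum>i. norm (\<sigma> n i - a i)) \<ge> 0" by (intro suminf_nonneg sum_a) auto
      ultimately show ?thesis using r by simp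
    qed
    then show "\<exists>K. \<forall>n\<ge>K. norm ((\<Sum>i. norm (\<sigma> n i - a i)) - 0) < r" by blast
  qed
  then show ?thesis using al by blast
qed

text \<open>Gaussian elimination: on the span of finitely many sequences, finitely many coordinates
  determine all others.\<close>

lemma coordinate_representation:
  fixes S L :: "(nat \<Rightarrow> 'k::field) set"
  assumes "finite S" and L: "\<And>a b c. a \<in> L \<Longrightarrow> b \<in> L \<Longrightarrow> (\<lambda>i. a i + c * b i) \<in> L" and "S \<subseteq> L"
  shows "\<exists>J w. finite J \<and> (\<forall>j\<in>J. w j \<in> L) \<and> (\<forall>i\<in>J. \<forall>j\<in>J. w j i = (if i = j then 1 else 0))
    \<and> (\<forall>a\<in>S. \<forall>i. a i = (\<Sum>j\<in>J. a j * w j i))"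
  using assms(1,3)
proof induction
  case empty
  show ?case by (intro exI[of _ "{}"]) simp
next
  case (insert b S)
  have "S \<subseteq> L" using insert.prems by simp
  from insert.IH[OF this] obtain J w where J: "finite J" and w0: "\<forall>j\<in>J. w j \<in> L"
    "\<forall>i\<in>J. \<forall>j\<in>J. w j i = (if i = j then 1 else 0)" and S0: "\<forall>a\<in>S. \<forall>i. a i = (\<Sum>j\<in>J. a j * w j i)"
    by (elim exE conjE) (rule that)
  note w = w0(1)[rule_format] w0(2)[rule_format] and S = S0[rule_format]
  define r where "r = (\<lambda>i. b i - (\<Sum>j\<in>J. b j * w j i))"
  have rJ: "r i = 0" if "i \<in> J" for i
    using J w(2) that by (simp add: r_def if_distrib[of "\<lambda>x. _ * x"] cong: if_cong sum.cong)
  have rL: "r \<in> L"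
  proof -
    have "(\<lambda>i. b i - (\<Sum>j\<in>J'. b j * w j i)) \<in> L" if "J' \<subseteq> J" for J'
      using finite_subset[OF that J] that
    proof (induction J')
      case empty
      then show ?case using insert.prems by simp
    next
      case (insert j J')
      then have "(\<lambda>i. (b i - (\<Sum>j\<in>J'. b j * w j i)) + (- b j) * w j i) \<in> L" by (intro L w) auto
      then show ?case using insert by (simp add: algebra_simps)
    qed
    then show ?thesis by (simp add: r_def)
  qed
  show ?case
  proof (cases "\<forall>i. r i = 0")
    case True
    have "b i = (\<Sum>j\<in>J. b j * w j i)" for i
      using spec[OF True, of i] by (simp only: r_def right_minus_eq)
    then have "\<forall>a\<in>insert b S. \<forall>i. a i = (\<Sum>j\<in>J. a j * w j i)" using S0 by blast
    then show ?thesis using J w0 by (intro exI[of _ J] exI[of _ w] conjI)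
  next
    case False
    \<comment> \<open>A pivot outside \<open>J\<close>: the remainder of \<open>b\<close> vanishes
      on \<open>J\<close> but not at \<open>l\<close>. It is scaled to 1 at \<open>l\<close> and
      eliminated from the earlier \<open>w j\<close>.\<close>
    then obtain l where l: "r l \<noteq> 0" by blast
    then have lJ: "l \<notin> J" using rJ by blast
    define u where "u = (\<lambda>i. r i / r l)"
    define w' where "w' = (\<lambda>j. if j = l then u else (\<lambda>i. w j i - w j l * u i))"
    have uJ: "u i = 0" if "i \<in> J" for i using rJ[OF that] by (simp add: u_def)
    have ul: "u l = 1" using l by (simp add: u_def)
    have uL: "u \<in> L"
    proof -
      have "(\<lambda>i. r i + (1 / r l - 1) * r i) \<in> L" by (rule L[OF rL rL])
      then show ?thesis by (simp add: u_def algebra_simps)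
    qed
    have w'L: "w' j \<in> L" if "j \<in> insert l J" for j
    proof (cases "j = l")
      case False
      then have "(\<lambda>i. w j i + (- w j l) * u i) \<in> L" using that by (intro L w uL) auto
      then show ?thesis using False by (simp add: w'_def)
    qed (simp add: w'_def uL)
    have w'\<delta>: "w' j i = (if i = j then 1 else 0)" if "i \<in> insert l J" "j \<in> insert l J" for i j
      using that w(2) uJ ul lJ by (auto simp: w'_def)
    have rep: "(\<Sum>j\<in>insert l J. a j * w' j i)
        = (\<Sum>j\<in>J. a j * w j i) + (a l - (\<Sum>j\<in>J. a j * w j l)) * u i" for a i
    proof -
      have "(\<Sum>j\<in>J. a j * w' j i) = (\<Sum>j\<in>J. a j * w j i - a j * w j l * u i)"
        using lJ by (intro sum.cong) (auto simp: w'_def algebra_simps)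
      also have "\<dots> = (\<Sum>j\<in>J. a j * w j i) - (\<Sum>j\<in>J. a j * w j l) * u i"
        by (simp add: sum_subtractf sum_distrib_right)
      finally have "(\<Sum>j\<in>J. a j * w' j i) = (\<Sum>j\<in>J. a j * w j i) - (\<Sum>j\<in>J. a j * w j l) * u i" .
      moreover have "w' l = u" by (simp add: w'_def)
      ultimately show ?thesis using J lJ by (simp add: left_diff_distrib)
    qed
    have rep': "a i = (\<Sum>j\<in>insert l J. a j * w' j i)" if a: "a \<in> insert b S" for a i
    proof (cases "a = b")
      case True
      have "(\<Sum>j\<in>insert l J. b j * w' j i) = (\<Sum>j\<in>J. b j * w j i) + r l * u i"
        unfolding rep by (simp add: r_def)
      also have "r l * u i = r i" using l by (simp add: u_def)
      also have "(\<Sum>j\<in>J. b j * w j i) + r i = b i" by (simp add: r_def)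
      finally show ?thesis using True by simp
    next
      case False
      then have "a \<in> S" using a by simp
      then show ?thesis unfolding rep using S[of a i] S[of a l] by simp
    qed
    show ?thesis
      by (rule exI[of _ "insert l J"], rule exI[of _ w'], intro conjI ballI allI)
        (simp_all only: finite_insert J w'L w'\<delta> rep'[symmetric])
  qed
qed

section \<open>The limit norm on all summable sequences\<close>

context kbanach
begin

text \<open>The estimates for \<open>N\<close> concern finitely supported sequences only.
  Suppression makes the values on truncations increase, and they are bounded for summable
  sequences.\<close>

definition limit_norm :: "((nat \<Rightarrow> 'k) \<Rightarrow> real) \<Rightarrow> (nat \<Rightarrow> 'k) \<Rightarrow> real" where
  "limit_norm N a = lim (\<lambda>m. N (trunc m a))"

lemma difference_limit_trunc_mono:
  assumes N: "difference_limit \<eta> N" shows "incseq (\<lambda>m. N (trunc m a))"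
proof (rule incseq_SucI)
  fix m
  have "(trunc (Suc m) a)(m := 0) = trunc m a" by (auto simp: trunc_def)
  then show "N (trunc m a) \<le> N (trunc (Suc m) a)"
    using difference_limit_suppress[OF N trunc_c00, of "Suc m" a m] by simp
qed

lemma difference_limit_trunc_le:
  assumes N: "difference_limit \<eta> N" and "m \<le> n"
  shows "N (trunc n a) \<le> N (trunc m a) + 2 * (\<Sum>i=m..<n. norm (a i))"
proof -
  define b where "b = (\<lambda>i. if m \<le> i \<and> i < n then a i else 0)"
  have b: "b i = 0" if "i \<ge> n" for i using that by (simp add: b_def)
  have "trunc n a = (\<lambda>i. trunc m a i + b i)" using assms(2) by (auto simp: trunc_def b_def)
  then have "N (trunc n a) \<le> N (trunc m a) + N b"
    using difference_limit_add[OF N trunc_c00[of m a] c00I[OF b]] by simp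
  also have "N b \<le> 2 * (\<Sum>i<n. norm (b i))" by (rule difference_limit_bounds(2)[OF N b])
  also have "(\<Sum>i<n. norm (b i)) = (\<Sum>i=m..<n. norm (a i))"
    by (rule sum.mono_neutral_cong_right) (auto simp: b_def)
  finally show ?thesis by simp
qed

lemma limit_norm_lim:
  assumes N: "difference_limit \<eta> N" and a: "a \<in> l1"
  shows "(\<lambda>m. N (trunc m a)) \<longlonglongrightarrow> limit_norm N a"
proof -
  have "N (trunc m a) \<le> 2 * (\<Sum>i. norm (a i))" for m
  proof -
    have "N (trunc m a) \<le> 2 * (\<Sum>i<m. norm (trunc m a i))"
      by (rule difference_limit_bounds(2)[OF N]) (simp add: trunc_def)
    also have "(\<Sum>i<m. norm (trunc m a i)) = (\<Sum>i<m. norm (a i))" by (simp add: trunc_def)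
    also have "\<dots> \<le> (\<Sum>i. norm (a i))" using a by (intro sum_le_suminf) (auto simp: l1_def)
    finally show ?thesis by simp
  qed
  then obtain L where "(\<lambda>m. N (trunc m a)) \<longlonglongrightarrow> L"
    using incseq_convergent[OF difference_limit_trunc_mono[OF N, of a]] by blast
  then show ?thesis unfolding limit_norm_def by (metis limI)
qed

lemma limit_norm_tail:
  assumes N: "difference_limit \<eta> N" and a: "a \<in> l1"
  shows "N (trunc m a) \<le> limit_norm N a"
    and "limit_norm N a \<le> N (trunc m a) + 2 * (\<Sum>i. norm (a (i + m)))"
proof -
  show "N (trunc m a) \<le> limit_norm N a"
    by (rule incseq_le[OF difference_limit_trunc_mono[OF N] limit_norm_lim[OF N a]])
  have summ: "summable (\<lambda>i. norm (a (i + m)))"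
    using a summable_ignore_initial_segment[of "\<lambda>i. norm (a i)" m] by (simp add: l1_def)
  have "N (trunc n a) \<le> N (trunc m a) + 2 * (\<Sum>i. norm (a (i + m)))" if "n \<ge> m" for n
  proof -
    have "(\<Sum>i=m..<n. norm (a i)) = (\<Sum>i<n - m. norm (a (i + m)))"
      using sum.shift_bounds_nat_ivl[of "\<lambda>i. norm (a i)" 0 m "n - m"] that by (simp add: atLeast0LessThan)
    also have "\<dots> \<le> (\<Sum>i. norm (a (i + m)))" by (rule sum_le_suminf[OF summ]) auto
    finally show ?thesis using difference_limit_trunc_le[OF N that, of a] by simp
  qed
  then show "limit_norm N a \<le> N (trunc m a) + 2 * (\<Sum>i. norm (a (i + m)))"
    by (intro LIMSEQ_le_const2[OF limit_norm_lim[OF N a]]) blast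
qed

text \<open>Equivalence with the l1 norm, from which completeness and the continuity of coordinate
  functionals are drawn.\<close>

lemma limit_norm_bounds:
  assumes N: "difference_limit \<eta> N" and \<eta>: "\<eta> > 0" and a: "a \<in> l1"
  shows "\<eta> / (2 * real DIM('k)) * (\<Sum>i. norm (a i)) \<le> limit_norm N a"
    and "limit_norm N a \<le> 2 * (\<Sum>i. norm (a i))"
proof -
  have "\<eta> / (2 * real DIM('k)) * (\<Sum>i<m. norm (a i)) \<le> limit_norm N a" for m
  proof -
    have "\<eta> / (2 * real DIM('k)) * (\<Sum>i<m. norm (trunc m a i)) \<le> N (trunc m a)"
      by (rule difference_limit_lower[OF N \<eta>]) (simp add: trunc_def)
    also have "\<dots> \<le> limit_norm N a" by (rule limit_norm_tail(1)[OF N a])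
    finally show ?thesis by (simp add: trunc_def)
  qed
  moreover have "(\<lambda>m. \<eta> / (2 * real DIM('k)) * (\<Sum>i<m. norm (a i)))
      \<longlonglongrightarrow> \<eta> / (2 * real DIM('k)) * (\<Sum>i. norm (a i))"
    using a by (intro tendsto_mult_left summable_LIMSEQ) (simp add: l1_def)
  ultimately show "\<eta> / (2 * real DIM('k)) * (\<Sum>i. norm (a i)) \<le> limit_norm N a"
    by (intro LIMSEQ_le_const2) blast+
  have "N (trunc 0 a) \<le> 2 * (\<Sum>i<0. norm (trunc 0 a i))"
    by (rule difference_limit_bounds(2)[OF N]) (simp add: trunc_def)
  then show "limit_norm N a \<le> 2 * (\<Sum>i. norm (a i))"
    using limit_norm_tail(2)[OF N a, of 0] by simp
qed

lemma limit_norm_add: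
  assumes N: "difference_limit \<eta> N" and ab: "a \<in> l1" "b \<in> l1"
  shows "limit_norm N (\<lambda>i. a i + b i) \<le> limit_norm N a + limit_norm N b"
proof (rule LIMSEQ_le[OF limit_norm_lim[OF N l1_add[OF ab]]])
  show "(\<lambda>m. N (trunc m a) + N (trunc m b)) \<longlonglongrightarrow> limit_norm N a + limit_norm N b"
    by (intro tendsto_add limit_norm_lim[OF N] ab)
  have "trunc m (\<lambda>i. a i + b i) = (\<lambda>i. trunc m a i + trunc m b i)" for m by (auto simp: trunc_def)
  then show "\<exists>K. \<forall>m\<ge>K. N (trunc m (\<lambda>i. a i + b i)) \<le> N (trunc m a) + N (trunc m b)"
    using difference_limit_add[OF N trunc_c00 trunc_c00] by simp
qed

lemma limit_norm_cmult:
  assumes N: "difference_limit \<eta> N" and a: "a \<in> l1"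
  shows "limit_norm N (\<lambda>i. c * a i) = norm c * limit_norm N a"
proof (rule LIMSEQ_unique[OF limit_norm_lim[OF N l1_cmult[OF a]]])
  have "trunc m (\<lambda>i. c * a i) = (\<lambda>i. c * trunc m a i)" for m by (auto simp: trunc_def)
  then have "N (trunc m (\<lambda>i. c * a i)) = norm c * N (trunc m a)" for m
    using difference_limit_cmult[OF N trunc_c00] by simp
  then show "(\<lambda>m. N (trunc m (\<lambda>i. c * a i))) \<longlonglongrightarrow> norm c * limit_norm N a"
    using tendsto_mult_left[OF limit_norm_lim[OF N a]] by simp
qed

text \<open>The limit controls finitely many sequences at a time. A finite net in the unit ball of
  scalars makes the approximation uniform over coefficients of size at most 1, and homogeneity does
  the rest.\<close>

lemma difference_limit_realised:
  assumes N: "difference_limit \<eta> N" and \<delta>: "\<delta> > 0"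
  shows "\<exists>d :: nat \<Rightarrow> 'a. \<forall>a. (\<forall>i\<ge>m. a i = 0) \<longrightarrow>
    \<bar>norm (\<Sum>j<m. scale (a j) (d j)) - N a\<bar> \<le> \<delta> * (\<Sum>j<m. norm (a j))"
proof -
  \<comment> \<open>Replacing \<open>a\<close> by a net point costs at most
    \<open>2 * m * \<theta>\<close> in the norm and as much in \<open>N\<close>, together at most
    \<open>\<delta> / 2\<close>.\<close>
  define \<theta> where "\<theta> = \<delta> / (8 * (real m + 1))"
  have \<theta>: "\<theta> > 0" using \<delta> by (simp add: \<theta>_def)
  have "4 * real m * \<theta> \<le> \<delta> / 2"
    using \<delta> by (simp add: \<theta>_def field_simps)
  note \<theta>m = this
  obtain C where C: "finite C" "cball (0::'k) 1 \<subseteq> (\<Union>c\<in>C. ball c \<theta>)"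
    using compact_cball[of "0::'k" 1] \<theta> unfolding compact_eq_totally_bounded by blast
  \<comment> \<open>Including this sequence in \<open>A\<close> forces \<open>m <= m'\<close>, so
    enough vectors \<open>d j\<close> are covered.\<close>
  define one where "one = (\<lambda>i. if i < m then 1 else 0 :: 'k)"
  define A where "A = insert one ((\<lambda>f i. if i < m then f i else 0) ` PiE {..<m} (\<lambda>_. C))"
  have vanish: "b i = 0" if "b \<in> A" "i \<ge> m" for b i using that unfolding A_def one_def by (elim insertE imageE) simp_all
  have "finite A" unfolding A_def by (intro finite.insertI finite_imageI finite_PiE C(1)) simp
  moreover have "A \<subseteq> c00"
  proof
    fix b assume "b \<in> A"
    then show "b \<in> c00" by (intro c00I[of m] vanish)
  qed
  ultimately have A: "finite A" "A \<subseteq> c00" by blast+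
  have "\<delta> / 2 > 0" using \<delta> by simp
  obtain m' d where d: "\<And>j. norm (d j :: 'a) \<le> 2" "\<And>b j. b \<in> A \<Longrightarrow> j \<ge> m' \<Longrightarrow> b j = 0"
    "\<And>b. b \<in> A \<Longrightarrow> \<bar>norm (\<Sum>j<m'. scale (b j) (d j)) - N b\<bar> \<le> \<delta> / 2"
    by (rule difference_limit_approx[OF N A \<open>\<delta> / 2 > 0\<close>]) (rule that)
  have "m \<le> m'"
  proof (rule ccontr)
    assume "\<not> m \<le> m'"
    then have "one m' = 1" by (simp add: one_def)
    moreover have "one m' = 0" by (rule d(2)) (auto simp: A_def)
    ultimately show False by simp
  qed
  then have dm: "\<bar>norm (\<Sum>j<m. scale (b j) (d j)) - N b\<bar> \<le> \<delta> / 2" if "b \<in> A" for b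
  proof -
    have "(\<Sum>j<m. scale (b j) (d j)) = (\<Sum>j<m'. scale (b j) (d j))"
      using \<open>m \<le> m'\<close> vanish[OF that] by (intro sum.mono_neutral_left) auto
    then show ?thesis using d(3)[OF that] by simp
  qed
  have unit: "\<bar>norm (\<Sum>j<m. scale (a j) (d j)) - N a\<bar> \<le> \<delta>"
    if a: "\<And>i. i \<ge> m \<Longrightarrow> a i = 0" "\<And>i. norm (a i) \<le> 1" for a
  proof -
    have "\<exists>c\<in>C. norm (a i - c) < \<theta>" for i
      using C(2) a(2)[of i] by (force simp: dist_norm norm_minus_commute)
    then obtain f where f: "\<And>i. f i \<in> C" "\<And>i. norm (a i - f i) < \<theta>" by metis
    define b where "b = (\<lambda>i. if i < m then f i else 0)"
    have "b = (\<lambda>i. if i < m then restrict f {..<m} i else 0)" by (auto simp: b_def)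
    moreover have "restrict f {..<m} \<in> PiE {..<m} (\<lambda>_. C)" using f(1) by simp
    ultimately have bA: "b \<in> A"
      unfolding A_def by (intro insertI2 image_eqI[of b _ "restrict f {..<m}"])
    have ab: "norm (a i - b i) \<le> \<theta>" if "i < m" for i using f(2)[of i] that by (simp add: b_def)
    have abz: "a i - b i = 0" if "i \<ge> m" for i using that a(1) by (simp add: b_def)
    have sum_ab: "(\<Sum>j<m. norm (a j - b j)) \<le> real m * \<theta>"
      using sum_bounded_above[of "{..<m}" "\<lambda>j. norm (a j - b j)" \<theta>] ab by simp
    have "norm (\<Sum>j<m. scale (a j) (d j)) - norm (\<Sum>j<m. scale (b j) (d j))
        \<le> norm ((\<Sum>j<m. scale (a j) (d j)) - (\<Sum>j<m. scale (b j) (d j)))"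
      by (rule norm_triangle_ineq2)
    moreover have "norm (\<Sum>j<m. scale (b j) (d j)) - norm (\<Sum>j<m. scale (a j) (d j))
        \<le> norm ((\<Sum>j<m. scale (a j) (d j)) - (\<Sum>j<m. scale (b j) (d j)))"
      using norm_triangle_ineq2 norm_minus_commute by metis
    moreover have "norm ((\<Sum>j<m. scale (a j) (d j)) - (\<Sum>j<m. scale (b j) (d j))) \<le> 2 * (real m * \<theta>)"
    proof -
      have "(\<Sum>j<m. scale (a j) (d j)) - (\<Sum>j<m. scale (b j) (d j)) = (\<Sum>j<m. scale (a j - b j) (d j))"
        by (simp add: scale_left_diff_distrib sum_subtractf)
      also have "norm \<dots> \<le> (\<Sum>j<m. norm (a j - b j) * 2)"
        using d(1) by (intro sum_norm_le) (simp add: norm_scale mult_left_mono)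
      also have "\<dots> = 2 * (\<Sum>j<m. norm (a j - b j))" by (simp add: sum_distrib_left mult.commute)
      finally show ?thesis using sum_ab by simp
    qed
    moreover have "N a \<le> N b + 2 * (real m * \<theta>)"
    proof -
      have "N (\<lambda>i. b i + (a i - b i)) \<le> N b + N (\<lambda>i. a i - b i)"
        using A(2) bA c00I[OF abz] by (intro difference_limit_add[OF N]) auto
      also have "N (\<lambda>i. a i - b i) \<le> 2 * (\<Sum>i<m. norm (a i - b i))"
        by (rule difference_limit_bounds(2)[OF N abz])
      finally show ?thesis using sum_ab by simp
    qed
    moreover have "N b \<le> N a + 2 * (real m * \<theta>)"
    proof -
      have baz: "b i - a i = 0" if "i \<ge> m" for i using abz[OF that] by simp
      have "N (\<lambda>i. a i + (b i - a i)) \<le> N a + N (\<lambda>i. b i - a i)"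
        by (intro difference_limit_add[OF N] c00I[OF a(1)] c00I[OF baz])
      also have "N (\<lambda>i. b i - a i) \<le> 2 * (\<Sum>i<m. norm (b i - a i))"
        by (rule difference_limit_bounds(2)[OF N baz])
      finally show ?thesis using sum_ab by (simp add: norm_minus_commute)
    qed
    ultimately show ?thesis using dm[OF bA] \<theta>m by linarith
  qed
  have "\<bar>norm (\<Sum>j<m. scale (a j) (d j)) - N a\<bar> \<le> \<delta> * (\<Sum>j<m. norm (a j))"
    if a: "\<forall>i\<ge>m. a i = 0" for a
  proof -
    define s where "s = (\<Sum>j<m. norm (a j))"
    have s0: "s \<ge> 0" by (simp add: s_def sum_nonneg)
    show ?thesis
    proof (cases "s = 0")
      case True
      then have "a j = 0" if "j < m" for j
        using that by (simp add: s_def sum_nonneg_eq_0_iff)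
      then have "(\<Sum>j<m. scale (a j) (d j)) = 0" by simp
      moreover have "N a = 0"
        using difference_limit_bounds[OF N, of m a] a True by (simp add: s_def)
      ultimately show ?thesis using True by (simp add: s_def)
    next
      case False
      then have s: "s > 0" using s0 by simp
      define c where "c = (of_real (1 / s) :: 'k)"
      have nc: "norm c = 1 / s" unfolding c_def norm_of_real using s by simp
      have "norm (c * a i) \<le> 1" for i
      proof (cases "i < m")
        case True
        then have "norm (a i) \<le> s" unfolding s_def by (intro member_le_sum) auto
        then show ?thesis using s by (simp add: norm_mult nc)
      qed (use a in simp)
      then have "\<bar>norm (\<Sum>j<m. scale (c * a j) (d j)) - N (\<lambda>i. c * a i)\<bar> \<le> \<delta>"
        using a by (intro unit) auto
      moreover have "norm (\<Sum>j<m. scale (c * a j) (d j)) = 1 / s * norm (\<Sum>j<m. scale (a j) (d j))"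
      proof -
        have "(\<Sum>j<m. scale (c * a j) (d j)) = scale c (\<Sum>j<m. scale (a j) (d j))" by (simp add: scale_sum_right)
        then show ?thesis by (simp only: norm_scale nc)
      qed
      moreover have "N (\<lambda>i. c * a i) = 1 / s * N a"
        using difference_limit_cmult[OF N c00I[of m a], of c] a by (simp only: nc)
      ultimately have "\<bar>norm (\<Sum>j<m. scale (a j) (d j)) - N a\<bar> / s \<le> \<delta>"
        using s by (simp add: diff_divide_distrib[symmetric] abs_divide)
      then show ?thesis using s by (simp add: pos_divide_le_eq s_def)
    qed
  qed
  then show ?thesis by blast
qed

end

section \<open>The renormed l1 as a carrier space: finite representability and failure of
  reflexivity\<close>

context kbanach
begin

text \<open>Superreflexivity only speaks of spaces with points of type \<open>(nat \<Rightarrow> 'a) set\<close>; a sequence of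
  scalars is coded by the singleton of its multiple of a nonzero vector \<open>v\<close>.\<close>

definition enc :: "'a \<Rightarrow> (nat \<Rightarrow> 'k) \<Rightarrow> (nat \<Rightarrow> 'a) set" where
  "enc v a = {\<lambda>n. scale (a n) v}"

definition dec :: "'a \<Rightarrow> (nat \<Rightarrow> 'a) set \<Rightarrow> nat \<Rightarrow> 'k" where
  "dec v = inv_into UNIV (enc v)"

lemma inj_enc: "v \<noteq> 0 \<Longrightarrow> inj (enc v)"
  by (auto simp: inj_def enc_def fun_eq_iff scale_right_imp_eq dest: fun_cong)

lemma dec_enc: "v \<noteq> 0 \<Longrightarrow> dec v (enc v a) = a"
  unfolding dec_def by (rule inv_f_f[OF inj_enc])

definition renormed_l1 :: "((nat \<Rightarrow> 'k) \<Rightarrow> real) \<Rightarrow> 'a \<Rightarrow> ('k, (nat \<Rightarrow> 'a) set) nspace" where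
  "renormed_l1 N v = \<lparr>pts = enc v ` l1, zer = enc v (\<lambda>i. 0),
     add = (\<lambda>x y. enc v (\<lambda>i. dec v x i + dec v y i)),
     smul = (\<lambda>c x. enc v (\<lambda>i. c * dec v x i)),
     nrm = (\<lambda>x. limit_norm N (dec v x))\<rparr>"

lemma renormed_l1_simps [simp]:
  "pts (renormed_l1 N v) = enc v ` l1"
  "zer (renormed_l1 N v) = enc v (\<lambda>i. 0)"
  "nspace.add (renormed_l1 N v) x y = enc v (\<lambda>i. dec v x i + dec v y i)"
  "smul (renormed_l1 N v) c x = enc v (\<lambda>i. c * dec v x i)"
  "nrm (renormed_l1 N v) x = limit_norm N (dec v x)"
  by (simp_all add: renormed_l1_def)

lemma zero_l1: "(\<lambda>i. 0) \<in> l1"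
  by (simp add: l1_def)

text \<open>Completeness is inherited from l1 through the two-sided estimate of the norms.\<close>

lemma carrier_banach_renormed_l1:
  assumes N: "difference_limit \<eta> N" and \<eta>: "\<eta> > 0" and v: "v \<noteq> 0"
  shows "carrier_banach (renormed_l1 N v)"
proof -
  define \<kappa> where "\<kappa> = \<eta> / (2 * real DIM('k))"
  have \<kappa>: "\<kappa> > 0" using \<eta> by (simp add: \<kappa>_def)
  note [simp] = dec_enc[OF v]
  note low = limit_norm_bounds(1)[OF N \<eta>, folded \<kappa>_def]
  show ?thesis
  proof (rule carrier_banach.intro)
    fix \<sigma> :: "nat \<Rightarrow> (nat \<Rightarrow> 'a) set"
    assume r: "range \<sigma> \<subseteq> pts (renormed_l1 N v)"
      and c: "\<forall>\<epsilon>>0. \<exists>K. \<forall>m\<ge>K. \<forall>n\<ge>K. nrm (renormed_l1 N v) (nspace.add (renormed_l1 N v) (\<sigma> m)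
        (smul (renormed_l1 N v) (- 1) (\<sigma> n))) < \<epsilon>"
    define \<tau> where "\<tau> = (\<lambda>n. dec v (\<sigma> n))"
    have \<sigma>: "\<sigma> n = enc v (\<tau> n)" and \<tau>: "\<tau> n \<in> l1" for n
    proof -
      have "\<sigma> n \<in> enc v ` l1" using r by auto
      then obtain a where "\<sigma> n = enc v a" "a \<in> l1" by (rule imageE)
      then show "\<sigma> n = enc v (\<tau> n)" "\<tau> n \<in> l1" by (simp_all add: \<tau>_def)
    qed
    have diff: "(\<lambda>i. \<tau> m i - \<tau> n i) \<in> l1" for m n
      using l1_add[OF \<tau> l1_cmult[OF \<tau>], of m "- 1" n] by simp
    have "\<exists>a\<in>l1. (\<lambda>n. \<Sum>i. norm (\<tau> n i - a i)) \<longlonglongrightarrow> 0"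
    proof (rule l1_complete[OF \<tau>])
      fix \<epsilon> :: real assume "\<epsilon> > 0"
      then obtain K where K: "\<And>m n. m \<ge> K \<Longrightarrow> n \<ge> K \<Longrightarrow> limit_norm N (\<lambda>i. \<tau> m i - \<tau> n i) < \<kappa> * \<epsilon>"
        using c[rule_format, of "\<kappa> * \<epsilon>"] \<kappa> by (auto simp: \<sigma>)
      have "(\<Sum>i. norm (\<tau> m i - \<tau> n i)) < \<epsilon>" if "m \<ge> K" "n \<ge> K" for m n
        using le_less_trans[OF low[OF diff] K[OF that]] \<kappa> by simp
      then show "\<exists>K. \<forall>m\<ge>K. \<forall>n\<ge>K. (\<Sum>i. norm (\<tau> m i - \<tau> n i)) < \<epsilon>" by blast
    qed
    then obtain a where a: "a \<in> l1" "(\<lambda>n. \<Sum>i. norm (\<tau> n i - a i)) \<longlonglongrightarrow> 0" by blast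
    have diff': "(\<lambda>i. \<tau> n i - a i) \<in> l1" for n
      using l1_add[OF \<tau>[of n] l1_cmult[OF a(1), of "- 1"]] by simp
    have "(\<lambda>n. limit_norm N (\<lambda>i. \<tau> n i - a i)) \<longlonglongrightarrow> 0"
    proof (rule tendsto_sandwich[of "\<lambda>n. 0" _ _ "\<lambda>n. 2 * (\<Sum>i. norm (\<tau> n i - a i))"])
      show "(\<lambda>n. 2 * (\<Sum>i. norm (\<tau> n i - a i))) \<longlonglongrightarrow> 0" using tendsto_mult_left[OF a(2), of 2] by simp
      show "\<forall>\<^sub>F n in sequentially. limit_norm N (\<lambda>i. \<tau> n i - a i) \<le> 2 * (\<Sum>i. norm (\<tau> n i - a i))"
        using limit_norm_bounds(2)[OF N \<eta> diff'] by simp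
      have "0 \<le> limit_norm N (\<lambda>i. \<tau> n i - a i)" for n
        using low[OF diff', of n] \<kappa> suminf_nonneg[of "\<lambda>i. norm (\<tau> n i - a i)"] diff'[of n]
        by (auto simp: l1_def intro: order_trans[rotated])
      then show "\<forall>\<^sub>F n in sequentially. 0 \<le> limit_norm N (\<lambda>i. \<tau> n i - a i)" by simp
    qed simp
    then show "\<exists>x\<in>pts (renormed_l1 N v). (\<lambda>n. nrm (renormed_l1 N v) (nspace.add (renormed_l1 N v) (\<sigma> n)
        (smul (renormed_l1 N v) (- 1) x))) \<longlonglongrightarrow> 0"
      using a(1) by (intro bexI[of _ "enc v a"]) (auto simp: \<sigma>)
  next
    fix x assume "x \<in> pts (renormed_l1 N v)"
    then obtain a where a: "x = enc v a" "a \<in> l1" by auto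
    have s: "summable (\<lambda>i. norm (a i))" using a(2) by (simp add: l1_def)
    have pos: "0 \<le> (\<Sum>i. norm (a i))" using s by (intro suminf_nonneg) auto
    then have nn: "0 \<le> limit_norm N a" using low[OF a(2)] \<kappa> by (auto intro: order_trans[rotated])
    then show "0 \<le> nrm (renormed_l1 N v) x" by (simp add: a(1))
    show "nrm (renormed_l1 N v) x = 0 \<longleftrightarrow> x = zer (renormed_l1 N v)"
    proof
      assume "nrm (renormed_l1 N v) x = 0"
      then have "\<kappa> * (\<Sum>i. norm (a i)) \<le> 0" using low[OF a(2)] by (simp add: a(1))
      then have "(\<Sum>i. norm (a i)) = 0" using pos \<kappa> by (simp add: mult_le_0_iff)
      then have "\<forall>i. norm (a i) = 0" using suminf_eq_zero_iff[OF s] by simp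
      then have "a = (\<lambda>i. 0)" by (intro ext) simp
      then show "x = zer (renormed_l1 N v)" by (simp add: a(1))
    next
      assume "x = zer (renormed_l1 N v)"
      then show "nrm (renormed_l1 N v) x = 0"
        using limit_norm_cmult[OF N zero_l1, of 0] by simp
    qed
  qed (auto simp: zero_l1 l1_add l1_cmult algebra_simps limit_norm_add[OF N] limit_norm_cmult[OF N])
qed

text \<open>A finite-dimensional subspace is truncated to \<open>m\<close> coordinates with
  uniformly small error, and the truncated sequences are mapped to combinations of vectors that
  realise \<open>N\<close>.\<close>

lemma finitely_representable_renormed_l1:
  assumes N: "difference_limit \<eta> N" and \<eta>: "\<eta> > 0" and v: "v \<noteq> 0"
  shows "finitely_representable (renormed_l1 N v) scale"
  unfolding finitely_representable_def
proof (intro allI impI, elim conjE)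
  fix G and \<epsilon> :: real
  assume G: "fin_dim_subspace_in (renormed_l1 N v) G" and \<epsilon>: "\<epsilon> > 0"
  note [simp] = dec_enc[OF v]
  define \<kappa> where "\<kappa> = \<eta> / (2 * real DIM('k))"
  have \<kappa>: "\<kappa> > 0" using \<eta> by (simp add: \<kappa>_def)
  note low = limit_norm_bounds(1)[OF N \<eta>, folded \<kappa>_def]
  obtain S where S: "finite S" "S \<subseteq> G" "\<And>H. subspace_in (renormed_l1 N v) H \<Longrightarrow> S \<subseteq> H \<Longrightarrow> G \<subseteq> H"
    and G1: "G \<subseteq> enc v ` l1"
    using G unfolding fin_dim_subspace_in_def subspace_in_def by auto
  have Sl1: "dec v ` S \<subseteq> l1" using S(2) G1 by auto
  have "\<exists>J w. finite J \<and> (\<forall>j\<in>J. w j \<in> l1) \<and> (\<forall>i\<in>J. \<forall>j\<in>J. w j i = (if i = j then 1 else 0))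
      \<and> (\<forall>a\<in>dec v ` S. \<forall>i. a i = (\<Sum>j\<in>J. a j * w j i))"
    by (rule coordinate_representation[OF finite_imageI[OF S(1)] _ Sl1]) (intro l1_add l1_cmult)
  then obtain J w where J: "finite J" "\<forall>j\<in>J. w j \<in> l1"
    "\<forall>a\<in>dec v ` S. \<forall>i. a i = (\<Sum>j\<in>J. a j * w j i)" by blast
  \<comment> \<open>Being determined by the coordinates in \<open>J\<close> is a linear condition,
    so it passes from the generators \<open>S\<close> to all of \<open>G\<close>.\<close>
  define H where "H = enc v ` {a \<in> l1. \<forall>i. a i = (\<Sum>j\<in>J. a j * w j i)}"
  have "subspace_in (renormed_l1 N v) H"
    unfolding subspace_in_def
  proof (intro conjI ballI allI)
    show "H \<subseteq> pts (renormed_l1 N v)" by (auto simp: H_def)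
    show "zer (renormed_l1 N v) \<in> H" unfolding H_def by (auto simp: zero_l1)
  next
    fix x y assume "x \<in> H" "y \<in> H"
    then obtain a b where ab: "x = enc v a" "y = enc v b" "a \<in> l1" "b \<in> l1"
      "\<forall>i. a i = (\<Sum>j\<in>J. a j * w j i)" "\<forall>i. b i = (\<Sum>j\<in>J. b j * w j i)" unfolding H_def by blast
    have "a i + b i = (\<Sum>j\<in>J. (a j + b j) * w j i)" for i
      using spec[OF ab(5), of i] spec[OF ab(6), of i] by (simp only: distrib_right sum.distrib)
    then have "(\<lambda>i. a i + b i) \<in> {a \<in> l1. \<forall>i. a i = (\<Sum>j\<in>J. a j * w j i)}"
      using l1_add[OF ab(3,4)] by blast
    then show "nspace.add (renormed_l1 N v) x y \<in> H"
      unfolding H_def ab(1,2) renormed_l1_simps dec_enc[OF v] by (rule imageI)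
  next
    fix c x assume "x \<in> H"
    then obtain a where a: "x = enc v a" "a \<in> l1" "\<forall>i. a i = (\<Sum>j\<in>J. a j * w j i)" unfolding H_def by blast
    have "c * a i = (\<Sum>j\<in>J. (c * a j) * w j i)" for i
      using spec[OF a(3), of i] by (simp only: mult.assoc sum_distrib_left[symmetric])
    then have "(\<lambda>i. c * a i) \<in> {a \<in> l1. \<forall>i. a i = (\<Sum>j\<in>J. a j * w j i)}"
      using l1_cmult[OF a(2), of c] by blast
    then show "smul (renormed_l1 N v) c x \<in> H"
      unfolding H_def a(1) renormed_l1_simps dec_enc[OF v] by (rule imageI)
  qed
  moreover have "S \<subseteq> H"
  proof
    fix x assume x: "x \<in> S"
    then obtain a where a: "x = enc v a" "a \<in> l1" using S(2) G1 by auto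
    then have "dec v x = a" by simp
    then have "\<forall>i. a i = (\<Sum>j\<in>J. a j * w j i)" using J(3) x by blast
    then show "x \<in> H" using a unfolding H_def by blast
  qed
  ultimately have GH: "G \<subseteq> H" by (rule S(3))
  define \<rho> where "\<rho> = min (1 / 2) (\<epsilon> / 4)"
  have \<rho>: "\<rho> > 0" "\<rho> \<le> 1 / 2" "\<rho> \<le> \<epsilon> / 4" using \<epsilon> by (auto simp: \<rho>_def)
  \<comment> \<open>Relative to the l1 norm, realising \<open>N\<close> costs
    \<open>\<delta>\<close> and truncation \<open>2 * \<delta>\<close>; the total
    \<open>3 * \<delta> = \<kappa> * \<rho>\<close> becomes a relative error \<open>\<rho>\<close>
    for the limit norm.\<close>
  define \<delta> where "\<delta> = \<kappa> * \<rho> / 3"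
  have \<delta>: "\<delta> > 0" using \<kappa> \<rho> by (simp add: \<delta>_def)
  \<comment> \<open>The finitely many \<open>w j\<close> dominate all tails: coordinates are bounded
    by the l1 norm, so tails are uniformly small on \<open>G\<close> without a compactness
    argument.\<close>
  have "(\<lambda>m. \<Sum>j\<in>J. \<Sum>i. norm (w j (i + m))) \<longlonglongrightarrow> (\<Sum>j\<in>J. 0)"
    using J(2) by (intro tendsto_sum suminf_exist_split2) (auto simp: l1_def)
  then have "(\<lambda>m. \<Sum>j\<in>J. \<Sum>i. norm (w j (i + m))) \<longlonglongrightarrow> 0" by simp
  then obtain m where "norm ((\<Sum>j\<in>J. \<Sum>i. norm (w j (i + m))) - 0) < \<delta>"
    using \<delta> LIMSEQ_D by blast
  then have m: "(\<Sum>j\<in>J. \<Sum>i. norm (w j (i + m))) < \<delta>" by simp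
  obtain d :: "nat \<Rightarrow> 'a" where d: "\<forall>a. (\<forall>i\<ge>m. a i = 0) \<longrightarrow>
    \<bar>norm (\<Sum>j<m. scale (a j) (d j)) - N a\<bar> \<le> \<delta> * (\<Sum>j<m. norm (a j))"
    using difference_limit_realised[OF N \<delta>, of m] by (rule exE)
  \<comment> \<open>Division by \<open>1 - \<rho>\<close> makes the lower estimate exact;
    \<open>\<rho> <= 1/2\<close> and \<open>\<rho> <= \<epsilon> / 4\<close> then give
    \<open>1 + \<rho> <= (1 + \<epsilon>) * (1 - \<rho>)\<close>.\<close>
  define T where "T = (\<lambda>x. (1 / (1 - \<rho>)) *\<^sub>R (\<Sum>j<m. scale (dec v x j) (d j)))"
  have key: "\<bar>norm (\<Sum>j<m. scale (a j) (d j)) - limit_norm N a\<bar> \<le> \<rho> * limit_norm N a"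
    if a: "enc v a \<in> G" for a
  proof -
    obtain b where b: "enc v a = enc v b" "b \<in> l1" "\<forall>i. b i = (\<Sum>j\<in>J. b j * w j i)"
      using GH a unfolding H_def by blast
    then have "a = b" using inj_enc[OF v] by (simp add: inj_eq)
    with b have al: "a \<in> l1" and rep: "\<And>i. a i = (\<Sum>j\<in>J. a j * w j i)" by blast+
    define s where "s = (\<Sum>i. norm (a i))"
    have summ: "summable (\<lambda>i. norm (a i))" using al by (simp add: l1_def)
    have s: "0 \<le> s" "norm (a j) \<le> s" "(\<Sum>j<m. norm (a j)) \<le> s" for j
    proof -
      show "0 \<le> s" unfolding s_def using summ by (intro suminf_nonneg) auto
      show "(\<Sum>j<m. norm (a j)) \<le> s" unfolding s_def using summ by (intro sum_le_suminf) auto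
      have "norm (a j) \<le> (\<Sum>i\<in>{j}. norm (a i))" by simp
      also have "\<dots> \<le> s" unfolding s_def using summ by (intro sum_le_suminf) auto
      finally show "norm (a j) \<le> s" .
    qed
    have wsum: "summable (\<lambda>i. norm (w j (i + m)))" if "j \<in> J" for j
      using summable_ignore_initial_segment[of "\<lambda>i. norm (w j i)" m] J(2) that by (simp add: l1_def)
    have tail: "(\<Sum>i. norm (a (i + m))) \<le> s * \<delta>"
    proof -
      have summ': "summable (\<lambda>i. \<Sum>j\<in>J. s * norm (w j (i + m)))"
        using wsum by (intro summable_sum summable_mult) auto
      have "(\<Sum>i. norm (a (i + m))) \<le> (\<Sum>i. \<Sum>j\<in>J. s * norm (w j (i + m)))"
      proof (rule suminf_le[OF _ _ summ'])
        show "summable (\<lambda>i. norm (a (i + m)))" by (rule summable_ignore_initial_segment[OF summ])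
        fix i
        have "norm (a (i + m)) \<le> (\<Sum>j\<in>J. norm (a j * w j (i + m)))"
          by (subst rep) (rule norm_sum)
        also have "\<dots> \<le> (\<Sum>j\<in>J. s * norm (w j (i + m)))"
          using s(2) by (intro sum_mono) (simp add: norm_mult mult_right_mono)
        finally show "norm (a (i + m)) \<le> (\<Sum>j\<in>J. s * norm (w j (i + m)))" .
      qed
      also have "\<dots> = (\<Sum>j\<in>J. \<Sum>i. s * norm (w j (i + m)))"
        using wsum by (intro suminf_sum summable_mult) auto
      also have "\<dots> = s * (\<Sum>j\<in>J. \<Sum>i. norm (w j (i + m)))"
        using wsum by (simp add: sum_distrib_left suminf_mult cong: sum.cong)
      also have "\<dots> \<le> s * \<delta>" using m s(1) by (intro mult_left_mono) auto
      finally show ?thesis .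
    qed
    have "(\<Sum>j<m. scale (trunc m a j) (d j)) = (\<Sum>j<m. scale (a j) (d j))" by (simp add: trunc_def)
    moreover have "(\<Sum>j<m. norm (trunc m a j)) = (\<Sum>j<m. norm (a j))" by (simp add: trunc_def)
    ultimately have 1: "\<bar>norm (\<Sum>j<m. scale (a j) (d j)) - N (trunc m a)\<bar> \<le> \<delta> * (\<Sum>j<m. norm (a j))"
      using d[rule_format, of "trunc m a"] by (simp add: trunc_def)
    have "\<delta> * (\<Sum>j<m. norm (a j)) \<le> \<delta> * s" using s(3) \<delta> by (intro mult_left_mono) auto
    with 1 have "\<bar>norm (\<Sum>j<m. scale (a j) (d j)) - N (trunc m a)\<bar> \<le> s * \<delta>" by (simp add: mult.commute)
    moreover have "N (trunc m a) \<le> limit_norm N a" "limit_norm N a \<le> N (trunc m a) + 2 * (s * \<delta>)"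
      using limit_norm_tail[OF N al, of m] tail by linarith+
    ultimately have "\<bar>norm (\<Sum>j<m. scale (a j) (d j)) - limit_norm N a\<bar> \<le> 3 * (s * \<delta>)" by linarith
    also have "\<dots> = \<rho> * (\<kappa> * s)" by (simp add: \<delta>_def)
    also have "\<dots> \<le> \<rho> * limit_norm N a" using low[OF al] \<rho>(1) by (intro mult_left_mono) (auto simp: s_def)
    finally show ?thesis .
  qed
  show "\<exists>T. (\<forall>x\<in>G. \<forall>y\<in>G. T (nspace.add (renormed_l1 N v) x y) = T x + T y)
         \<and> (\<forall>c. \<forall>x\<in>G. T (smul (renormed_l1 N v) c x) = scale c (T x))
         \<and> (\<forall>x\<in>G. nrm (renormed_l1 N v) x \<le> norm (T x)
              \<and> norm (T x) \<le> (1 + \<epsilon>) * nrm (renormed_l1 N v) x)"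
  proof (intro exI[of _ T] conjI ballI allI)
    show "T (nspace.add (renormed_l1 N v) x y) = T x + T y" for x y
      by (simp add: T_def scale_left_distrib sum.distrib scaleR_add_right)
    show "T (smul (renormed_l1 N v) c x) = scale c (T x)" for c x
    proof -
      have "(\<Sum>j<m. scale (c * dec v x j) (d j)) = scale c (\<Sum>j<m. scale (dec v x j) (d j))"
        by (simp add: scale_sum_right)
      moreover have "scale c (r *\<^sub>R y) = r *\<^sub>R scale c y" for r and y :: 'a
        using bounded_linear_scale bounded_linear.linear linear_cmul by blast
      ultimately show ?thesis by (simp add: T_def)
    qed
    fix x assume x: "x \<in> G"
    then obtain a where a: "x = enc v a" using G1 by blast
    define n where "n = norm (\<Sum>j<m. scale (a j) (d j))"
    define l where "l = limit_norm N a"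
    have nl: "\<bar>n - l\<bar> \<le> \<rho> * l" using key[of a] x unfolding a n_def l_def by blast
    have l0: "l \<ge> 0"
    proof (rule ccontr)
      assume "\<not> l \<ge> 0"
      then have "\<rho> * l < 0" using \<rho>(1) by (simp add: mult_pos_neg)
      then show False using nl by linarith
    qed
    have nT: "norm (T x) = n / (1 - \<rho>)" using \<rho>(2) by (simp add: T_def a n_def)
    have "l * (1 - \<rho>) \<le> n" using nl by (simp add: algebra_simps abs_le_iff)
    then show "nrm (renormed_l1 N v) x \<le> norm (T x)"
      unfolding nT using \<rho>(2) by (simp add: a l_def[symmetric] pos_le_divide_eq)
    have "n \<le> (1 + \<rho>) * l" using nl by (simp add: algebra_simps abs_le_iff)
    also have "\<dots> \<le> ((1 + \<epsilon>) * (1 - \<rho>)) * l"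
    proof (rule mult_right_mono[OF _ l0])
      have "\<epsilon> * \<rho> \<le> \<epsilon> * (1 / 2)" using \<rho>(2) \<epsilon> by (intro mult_left_mono) auto
      then show "1 + \<rho> \<le> (1 + \<epsilon>) * (1 - \<rho>)" using \<rho>(3) by (simp add: algebra_simps)
    qed
    finally show "norm (T x) \<le> (1 + \<epsilon>) * nrm (renormed_l1 N v) x"
      unfolding nT using \<rho>(2) by (simp add: a l_def[symmetric] pos_divide_le_eq mult_ac)
  qed
qed

text \<open>Meant for the unit vectors, which are only known to have norm at most 2 in the renormed
  space; halving brings them into the unit ball.\<close>

lemma dual_bound:
  assumes X: "carrier_banach X" and f: "f \<in> pts (dual X)" and x: "x \<in> pts X" "nrm X x \<le> 2"
  shows "norm (f x) \<le> 2 * nrm (dual X) f"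
proof -
  interpret X: carrier_banach X by (rule X)
  define y where "y = smul X (of_real (1 / 2)) x"
  have y: "y \<in> pts X" "nrm X y \<le> 1"
    using x X.smul_closed[OF x(1)] X.nrm_smul[OF x(1), of "of_real (1 / 2)"] by (auto simp: y_def)
  obtain C where C: "\<forall>x\<in>pts X. norm (f x) \<le> C * nrm X x" using f by (auto simp: dual_def)
  have "bdd_above ((\<lambda>x. norm (f x)) ` {x \<in> pts X. nrm X x \<le> 1})"
  proof (rule bdd_aboveI2[where M = "\<bar>C\<bar>"])
    fix x assume x: "x \<in> {x \<in> pts X. nrm X x \<le> 1}"
    then have "norm (f x) \<le> C * nrm X x" using C by blast
    also have "\<dots> \<le> \<bar>C\<bar> * 1" using x X.nrm_nonneg by (intro mult_mono) auto
    finally show "norm (f x) \<le> \<bar>C\<bar>" by simp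
  qed
  then have "norm (f y) \<le> (SUP x\<in>{x \<in> pts X. nrm X x \<le> 1}. norm (f x))"
    using y by (intro cSUP_upper) auto
  then have "norm (f y) \<le> nrm (dual X) f" by (simp add: dual_def)
  moreover have "f y = of_real (1 / 2) * f x" using f x(1) by (simp add: y_def dual_def)
  ultimately show ?thesis by (simp add: norm_mult)
qed

text \<open>A cluster point of the evaluations at the unit vectors vanishes on the coordinate functionals
  but not on the functional summing the coordinates, so it is not an evaluation.\<close>

lemma not_reflexive_renormed_l1:
  assumes N: "difference_limit \<eta> N" and \<eta>: "\<eta> > 0" and v: "v \<noteq> 0"
  shows "\<not> reflexive (renormed_l1 N v)"
proof
  assume refl: "reflexive (renormed_l1 N v)"
  define X where "X = renormed_l1 N v"
  note [simp] = dec_enc[OF v]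
  have cb: "carrier_banach X" unfolding X_def by (rule carrier_banach_renormed_l1[OF assms])
  define \<kappa> where "\<kappa> = \<eta> / (2 * real DIM('k))"
  have \<kappa>: "\<kappa> > 0" using \<eta> by (simp add: \<kappa>_def)
  note low = limit_norm_bounds(1)[OF N \<eta>, folded \<kappa>_def]
  define e where "e = (\<lambda>j i :: nat. if i = j then 1 else 0 :: 'k)"
  have e_c00: "e j \<in> c00" for j by (rule c00I[of "Suc j"]) (simp add: e_def)
  have e: "e j \<in> l1" for j by (rule l1_c00[OF e_c00])
  have e_sum: "(\<lambda>i. c (e j i)) sums c 1" if "c 0 = 0" for c :: "'k \<Rightarrow> 'm::real_normed_vector" and j
  proof -
    have "(\<lambda>i. if i = j then c 1 else 0) sums c 1" by (rule sums_single)
    moreover have "(\<lambda>i. if i = j then c 1 else 0) = (\<lambda>i. c (e j i))" by (auto simp: e_def that)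
    ultimately show ?thesis by simp
  qed
  have "(\<lambda>i. norm (e j i)) sums norm (1::'k)" for j by (rule e_sum) simp
  then have "(\<Sum>i. norm (e j i)) = 1" for j by (simp add: sums_iff)
  then have e2: "nrm X (enc v (e j)) \<le> 2" for j
    using limit_norm_bounds(2)[OF N \<eta> e, of j] by (simp add: X_def)
  have ein: "enc v (e j) \<in> pts X" for j using e by (simp add: X_def)
  \<comment> \<open>The value 0 off the dual follows the convention that functionals vanish outside
    the carrier, which the cluster point must satisfy to lie in the bidual.\<close>
  define h where "h = (\<lambda>j f. if f \<in> pts (dual X) then f (enc v (e j)) else 0)"
  \<comment> \<open>The condition \<open>1 / \<epsilon> <= j\<close> drives the index to infinity,
    so the cluster point only sees late unit vectors.\<close>
  define P where "P = (\<lambda>(A :: ((nat \<Rightarrow> 'a) set \<Rightarrow> 'k) set) \<epsilon> g. \<exists>j. 1 / \<epsilon> \<le> real j \<and> g = h j)"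
  have "\<exists>\<Phi>. \<forall>A \<epsilon>. finite A \<longrightarrow> \<epsilon> > 0 \<longrightarrow> (\<exists>g. P A \<epsilon> g \<and> (\<forall>f\<in>A. norm (g f - \<Phi> f) < \<epsilon>))"
  proof (rule cluster_function)
    show "\<exists>g. P A \<epsilon> g \<and> (\<forall>f. norm (g f) \<le> 2 * \<bar>nrm (dual X) f\<bar>)" for A \<epsilon>
    proof -
      obtain j :: nat where "1 / \<epsilon> \<le> real j" using real_arch_simple by blast
      moreover have "norm (h j f) \<le> 2 * \<bar>nrm (dual X) f\<bar>" for f
        using dual_bound[OF cb _ ein e2, of f j] by (auto simp: h_def intro: order_trans)
      ultimately show ?thesis by (intro exI[of _ "h j"]) (auto simp: P_def)
    qed
    fix A A' \<epsilon> \<epsilon>' g assume P: "P A' \<epsilon>' g" and \<epsilon>: "0 < \<epsilon>'" "\<epsilon>' \<le> (\<epsilon> :: real)"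
    from P obtain j where j: "1 / \<epsilon>' \<le> real j" "g = h j" unfolding P_def by blast
    have "1 / \<epsilon> \<le> 1 / \<epsilon>'" using \<epsilon> by (simp add: frac_le)
    then have "1 / \<epsilon> \<le> real j" using j(1) by linarith
    then show "P A \<epsilon> g" unfolding P_def using j(2) by blast
  qed
  then obtain \<Phi> where \<Phi>0: "\<forall>A \<epsilon>. finite A \<longrightarrow> \<epsilon> > 0 \<longrightarrow> (\<exists>g. P A \<epsilon> g \<and> (\<forall>f\<in>A. norm (g f - \<Phi> f) < \<epsilon>))"
    by (rule exE)
  have \<Phi>: "\<exists>j. 1 / \<epsilon> \<le> real j \<and> (\<forall>f\<in>A. norm (h j f - \<Phi> f) < \<epsilon>)" if "finite A" "\<epsilon> > 0" for A \<epsilon>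
    using \<Phi>0[rule_format, OF that] unfolding P_def by blast
  have zero: "x = 0" if "\<And>\<epsilon>. \<epsilon> > 0 \<Longrightarrow> norm x \<le> 3 * \<epsilon>" for x :: 'k
  proof -
    have "norm x \<le> 0"
    proof (rule field_le_epsilon)
      fix r :: real assume "r > 0"
      then show "norm x \<le> 0 + r" using that[of "r / 3"] by simp
    qed
    then show ?thesis by simp
  qed
  have add: "\<Phi> (\<lambda>x. f x + g x) = \<Phi> f + \<Phi> g" if fg: "f \<in> pts (dual X)" "g \<in> pts (dual X)" for f g
  proof -
    have fgd: "(\<lambda>x. f x + g x) \<in> pts (dual X)"
    proof -
      obtain C D where "\<forall>x\<in>pts X. norm (f x) \<le> C * nrm X x" "\<forall>x\<in>pts X. norm (g x) \<le> D * nrm X x"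
        using fg by (auto simp: dual_def)
      then have "\<forall>x\<in>pts X. norm (f x + g x) \<le> (C + D) * nrm X x"
        by (auto simp: distrib_right intro!: norm_triangle_le add_mono)
      then have "\<exists>C. \<forall>x\<in>pts X. norm (f x + g x) \<le> C * nrm X x" by blast
      then show ?thesis using fg by (simp add: dual_def distrib_left)
    qed
    have "\<Phi> (\<lambda>x. f x + g x) - (\<Phi> f + \<Phi> g) = 0"
    proof (rule zero)
      fix \<epsilon> :: real assume "\<epsilon> > 0"
      then obtain j where j: "\<forall>q\<in>{f, g, \<lambda>x. f x + g x}. norm (h j q - \<Phi> q) < \<epsilon>"
        using \<Phi>[of "{f, g, \<lambda>x. f x + g x}" \<epsilon>] by auto
      have "h j (\<lambda>x. f x + g x) = h j f + h j g" using fg fgd by (simp add: h_def)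
      then have "\<Phi> (\<lambda>x. f x + g x) - (\<Phi> f + \<Phi> g)
          = (h j f - \<Phi> f) + (h j g - \<Phi> g) - (h j (\<lambda>x. f x + g x) - \<Phi> (\<lambda>x. f x + g x))" by simp
      also have "norm \<dots> \<le> norm (h j f - \<Phi> f) + norm (h j g - \<Phi> g) + norm (h j (\<lambda>x. f x + g x) - \<Phi> (\<lambda>x. f x + g x))"
        using norm_triangle_ineq4 norm_triangle_ineq by (meson add_right_mono order_trans)
      also have "\<dots> \<le> \<epsilon> + \<epsilon> + \<epsilon>" using j by (intro add_mono) auto
      finally show "norm (\<Phi> (\<lambda>x. f x + g x) - (\<Phi> f + \<Phi> g)) \<le> 3 * \<epsilon>" by simp
    qed
    then show ?thesis by simp
  qed
  have cmult: "\<Phi> (\<lambda>x. c * f x) = c * \<Phi> f" if f: "f \<in> pts (dual X)" for c f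
  proof -
    have cfd: "(\<lambda>x. c * f x) \<in> pts (dual X)"
    proof -
      obtain C where "\<forall>x\<in>pts X. norm (f x) \<le> C * nrm X x" using f by (auto simp: dual_def)
      then have "\<forall>x\<in>pts X. norm (c * f x) \<le> (norm c * C) * nrm X x"
        by (auto simp: norm_mult mult.assoc intro!: mult_left_mono)
      then have "\<exists>C. \<forall>x\<in>pts X. norm (c * f x) \<le> C * nrm X x" by blast
      then show ?thesis using f by (simp add: dual_def distrib_left mult.left_commute)
    qed
    have "norm (\<Phi> (\<lambda>x. c * f x) - c * \<Phi> f) \<le> 0"
    proof (rule le_of_all_pos[where C = "1 + norm c"])
      fix \<epsilon> :: real assume "\<epsilon> > 0"
      then obtain j where j: "\<forall>q\<in>{f, \<lambda>x. c * f x}. norm (h j q - \<Phi> q) < \<epsilon>"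
        using \<Phi>[of "{f, \<lambda>x. c * f x}" \<epsilon>] by auto
      have "h j (\<lambda>x. c * f x) = c * h j f" using f cfd by (simp add: h_def)
      then have "\<Phi> (\<lambda>x. c * f x) - c * \<Phi> f
          = c * (h j f - \<Phi> f) - (h j (\<lambda>x. c * f x) - \<Phi> (\<lambda>x. c * f x))" by (simp add: right_diff_distrib)
      also have "norm \<dots> \<le> norm (c * (h j f - \<Phi> f)) + norm (h j (\<lambda>x. c * f x) - \<Phi> (\<lambda>x. c * f x))"
        by (rule norm_triangle_ineq4)
      also have "\<dots> \<le> norm c * \<epsilon> + \<epsilon>"
        using j by (intro add_mono) (auto simp: norm_mult intro: mult_left_mono less_imp_le)
      finally show "norm (\<Phi> (\<lambda>x. c * f x) - c * \<Phi> f) \<le> 0 + \<epsilon> * (1 + norm c)" by (simp add: algebra_simps)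
    qed simp
    then show ?thesis by simp
  qed
  have bound: "norm (\<Phi> f) \<le> 2 * nrm (dual X) f" if f: "f \<in> pts (dual X)" for f
  proof (rule le_of_all_pos[where C = 1])
    fix \<epsilon> :: real assume "\<epsilon> > 0"
    then obtain j where "norm (h j f - \<Phi> f) < \<epsilon>" using \<Phi>[of "{f}" \<epsilon>] by auto
    moreover have "norm (h j f) \<le> 2 * nrm (dual X) f" using dual_bound[OF cb f ein e2, of j] f by (simp add: h_def)
    ultimately show "norm (\<Phi> f) \<le> 2 * nrm (dual X) f + \<epsilon> * 1"
      using norm_triangle_ineq2[of "\<Phi> f" "h j f"] by (simp add: norm_minus_commute)
  qed simp
  have off: "\<Phi> f = 0" if f: "f \<notin> pts (dual X)" for f
  proof (rule zero)
    fix \<epsilon> :: real assume "\<epsilon> > 0"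
    then obtain j where "norm (h j f - \<Phi> f) < \<epsilon>" using \<Phi>[of "{f}" \<epsilon>] by auto
    then show "norm (\<Phi> f) \<le> 3 * \<epsilon>" using f \<open>\<epsilon> > 0\<close> by (simp add: h_def)
  qed
  have "\<Phi> \<in> pts (dual (dual X))"
    using add cmult bound off by (auto simp: dual_def[of "dual X"]) (auto simp: dual_def[of X])
  then obtain x where x: "x \<in> pts X" "\<And>f. f \<in> pts (dual X) \<Longrightarrow> \<Phi> f = f x"
    using refl unfolding reflexive_def X_def[symmetric] by blast
  then obtain a where a: "x = enc v a" "a \<in> l1" by (auto simp: X_def)
  have in_dual: "(\<lambda>x. if x \<in> pts X then g (dec v x) else 0) \<in> pts (dual X)"
    if g: "\<And>b c. b \<in> l1 \<Longrightarrow> c \<in> l1 \<Longrightarrow> g (\<lambda>i. b i + c i) = g b + g c" "\<And>b c. b \<in> l1 \<Longrightarrow> g (\<lambda>i. c * b i) = c * g b"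
      "\<And>b. b \<in> l1 \<Longrightarrow> norm (g b) \<le> (\<Sum>i. norm (b i))" for g
  proof -
    have "norm (g b) \<le> 1 / \<kappa> * limit_norm N b" if "b \<in> l1" for b
    proof -
      have "\<kappa> * norm (g b) \<le> \<kappa> * (\<Sum>i. norm (b i))" using g(3)[OF that] \<kappa> by (intro mult_left_mono) auto
      also have "\<dots> \<le> limit_norm N b" by (rule low[OF that])
      finally show ?thesis using \<kappa> by (simp add: field_simps)
    qed
    then have "\<exists>C. \<forall>b\<in>l1. norm (g b) \<le> C * limit_norm N b" by blast
    then show ?thesis
      using g(1,2) by (auto simp: dual_def X_def l1_add l1_cmult)
  qed
  have norm_le: "norm (b i) \<le> (\<Sum>i. norm (b i))" if "b \<in> l1" for b :: "nat \<Rightarrow> 'k" and i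
    using sum_le_suminf[of "\<lambda>i. norm (b i)" "{i}"] that by (simp add: l1_def)
  have "a i = 0" for i
  proof -
    define f where "f = (\<lambda>x. if x \<in> pts X then dec v x i else 0)"
    have fd: "f \<in> pts (dual X)" unfolding f_def by (rule in_dual) (auto intro: norm_le)
    have "\<Phi> f = 0"
    proof (rule zero)
      fix \<epsilon> :: real assume \<epsilon>: "\<epsilon> > 0"
      \<comment> \<open>A tolerance of at most \<open>1 / (i + 1)\<close> forces
        \<open>j > i\<close>, where the \<open>i\<close>-th coordinate of \<open>e j\<close> is
        zero.\<close>
      define \<theta> where "\<theta> = min \<epsilon> (1 / (real i + 1))"
      have \<theta>: "\<theta> > 0" using \<epsilon> by (simp add: \<theta>_def)
      obtain j where j: "1 / \<theta> \<le> real j" "norm (h j f - \<Phi> f) < \<theta>" using \<Phi>[of "{f}" \<theta>] \<theta> by auto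
      have "real i + 1 = 1 / (1 / (real i + 1))" by simp
      also have "\<dots> \<le> 1 / \<theta>" using \<theta> by (intro frac_le) (auto simp: \<theta>_def)
      finally have "i < j" using j(1) by linarith
      then have "h j f = 0" using fd ein by (simp add: h_def f_def e_def)
      then show "norm (\<Phi> f) \<le> 3 * \<epsilon>" using j(2) \<epsilon> by (simp add: \<theta>_def)
    qed
    then show ?thesis using x(2)[OF fd] x(1) by (simp add: f_def a(1))
  qed
  then have a0: "a = (\<lambda>i. 0)" by (intro ext)
  define f where "f = (\<lambda>x. if x \<in> pts X then (\<Sum>i. dec v x i) else 0)"
  have summ: "summable b" if "b \<in> l1" for b :: "nat \<Rightarrow> 'k"
    by (rule summable_norm_cancel) (use that in \<open>simp add: l1_def\<close>)
  have fd: "f \<in> pts (dual X)"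
    unfolding f_def
  proof (rule in_dual)
    show "(\<Sum>i. b i + c i) = (\<Sum>i. b i) + (\<Sum>i. c i)" if "b \<in> l1" "c \<in> l1" for b c :: "nat \<Rightarrow> 'k"
      using suminf_add[OF summ[OF that(1)] summ[OF that(2)]] by simp
    show "(\<Sum>i. c * b i) = c * (\<Sum>i. b i)" if "b \<in> l1" for b and c :: 'k
      by (rule suminf_mult[OF summ[OF that]])
    show "norm (\<Sum>i. b i) \<le> (\<Sum>i. norm (b i))" if "b \<in> l1" for b :: "nat \<Rightarrow> 'k"
      using that by (intro summable_norm) (simp add: l1_def)
  qed
  have "\<Phi> f - 1 = 0"
  proof (rule zero)
    fix \<epsilon> :: real assume \<epsilon>: "\<epsilon> > 0"
    obtain j where j: "norm (h j f - \<Phi> f) < \<epsilon>" using \<Phi>[of "{f}" \<epsilon>] \<epsilon> by auto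
    have "(\<Sum>i. e j i) = 1" using e_sum[of "\<lambda>x. x" j] by (simp add: sums_iff)
    then have "h j f = 1" using fd ein by (simp add: h_def f_def)
    then show "norm (\<Phi> f - 1) \<le> 3 * \<epsilon>" using j \<epsilon> by (simp add: norm_minus_commute)
  qed
  moreover have "f x = 0" by (simp add: f_def a(1) a0)
  ultimately show False using x(2)[OF fd] by simp
qed

lemma superreflexive_not_well_separated:
  assumes "superreflexive scale" and "\<eta> > 0" and v: "(v :: 'a) \<noteq> 0"
  shows "\<exists>q. \<forall>y. \<not> well_separated \<eta> q y"
proof (rule ccontr)
  assume "\<not> ?thesis"
  then have "\<And>q. \<exists>y. well_separated \<eta> q y" by blast
  then obtain N where N: "difference_limit \<eta> N" using difference_limit_exists by blast
  have "reflexive (renormed_l1 N v)"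
    using assms(1) carrier_banach_renormed_l1[OF N assms(2) v] finitely_representable_renormed_l1[OF N assms(2) v]
    unfolding superreflexive_def by blast
  then show False using not_reflexive_renormed_l1[OF N assms(2) v] by blast
qed

end

text \<open>The Dvoretzky-Rogers families are built in the underlying real spaces; a finite set
  spanning over the reals would also span over \<open>'k\<close>.\<close>

lemma (in kbanach) real_span_neq_UNIV:
  assumes "\<not> fin_dim scale UNIV"
  shows "\<forall>S :: 'a set. finite S \<longrightarrow> Real_Vector_Spaces.span S \<noteq> UNIV"
proof (intro allI impI notI)
  fix S :: "'a set" assume S: "finite S" "Real_Vector_Spaces.span S = UNIV"
  have "Real_Vector_Spaces.subspace (span S)"
    unfolding Real_Vector_Spaces.subspace_def
    using span_zero span_add span_scale scale_of_real by metis
  then have "Real_Vector_Spaces.span S \<subseteq> span S"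
    by (intro Real_Vector_Spaces.span_minimal span_superset)
  then show False using S assms by (auto simp: fin_dim_def)
qed

lemma lineable_mono:
  assumes "lineable s \<mu> A" "A \<subseteq> B" shows "lineable s \<mu> B"
proof -
  obtain W D where W: "module.subspace s W" "\<not> fin_dim s W" "W \<subseteq> A \<union> {0}"
    and D: "\<not> module.dependent s D" "module.span s D = W" "D \<approx> \<mu>"
    using assms(1) unfolding lineable_def by blast
  have "W \<subseteq> B \<union> {0}" using W(3) assms(2) by blast
  then show ?thesis unfolding lineable_def using W(1,2) D by (intro exI[of _ W] exI[of _ D] conjI)
qed

theorem theorem1p1:
  fixes sE :: "'k::{real_normed_field,euclidean_space} \<Rightarrow> 'a::banach \<Rightarrow> 'a"
    and sF :: "'k \<Rightarrow> 'b::banach \<Rightarrow> 'b"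
    and p :: real
  assumes "p \<ge> 1"
    and "kbanach sE" and "kbanach sF"
    and "\<not> fin_dim sE UNIV" and "\<not> fin_dim sF UNIV"
    and "superreflexive sE"
    and "(\<exists>M e. complemented sE M \<and> \<not> fin_dim sE M \<and> unconditional_basis_of sE e M)
         \<or> (\<exists>e. unconditional_basic_sequence sF e)"
  shows "lineable (op_scale sF) (UNIV :: real set) (compact_ops sE sF - summing_ops p sE sF)
       \<and> lineable (op_scale sF) (UNIV :: real set) (bounded_ops sE sF - summing_ops p sE sF)"
proof -
  interpret kbanach_pair sE sF using assms(2,3) by (rule kbanach_pair.intro)
  have v: "\<exists>v :: 'a. v \<noteq> 0"
  proof (rule ccontr)
    assume "\<not> ?thesis"
    then have "UNIV \<subseteq> E.span {0}" using E.span_zero by auto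
    then have "fin_dim sE UNIV" unfolding fin_dim_def by (intro exI[of _ "{0}"] conjI) simp
    then show False using assms(4) by blast
  qed
  \<comment> \<open>A nonzero vector is what allows scalar sequences to be encoded in the point type
    of superreflexivity.\<close>
  then obtain v :: 'a where v: "v \<noteq> 0" by blast
  have unbdd: "\<exists>T\<in>fin_ops. norm T \<le> 1 \<and>
      (\<exists>m x. C * wnorm p sE m x < pnorm p m (\<lambda>i. blinfun_apply T (x i)))" for C
  proof (rule ccontr)
    \<comment> \<open>The negation says that \<open>C\<close> bounds the \<open>p\<close>-summing
      norms of all finite rank operators of norm at most 1.\<close>
    assume *: "\<not> ?thesis"
    have "\<exists>\<eta>>0. \<forall>q. \<exists>y. E.well_separated \<eta> q y"
    proof (rule well_separated_of_bounded[OF E.real_span_neq_UNIV[OF assms(4)] F.real_span_neq_UNIV[OF assms(5)] assms(1)])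
      fix T m x assume "T \<in> fin_ops" "norm T \<le> 1"
      then show "pnorm p m (\<lambda>i. blinfun_apply T (x i)) \<le> C * wnorm p sE m x"
        using * by (meson not_le)
    qed
    then obtain \<eta> where "\<eta> > 0" "\<forall>q. \<exists>y. E.well_separated \<eta> q y" by blast
    then show False using E.superreflexive_not_well_separated[OF assms(6) \<open>\<eta> > 0\<close> v] by blast
  qed
  have "lineable (op_scale sF) (UNIV :: real set) (compact_ops sE sF - summing_ops p sE sF)"
    by (rule lineable_of_unbounded[OF assms(1) unbdd])
  moreover from this have "lineable (op_scale sF) (UNIV :: real set) (bounded_ops sE sF - summing_ops p sE sF)"
    by (rule lineable_mono) (auto simp: compact_ops_def)
  ultimately show ?thesis by (rule conjI)
qed

end
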